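(* (Restriction rule) Let $\alpha\vDash n$ and $0\leq m\leq n$. Then the following is an isomorphism of $H_m(0)\otimes H_{n-m}(0)$-modules: \[\mathbf{S}_\alpha\downarrow^{H_n(0)}_{H_{m,n-m}(0)}\ \cong\ \bigoplus_{\substack{\beta\vDash n-m\\ \beta\leq_c\alpha}}\mathbf{S}_{\alpha/\!\!/\beta}\otimes\mathbf{S}_\beta .\]
   Context: A composition $\alpha$ of $n$ ($\alpha\vDash n$) is an ordered list of positive integers summing to $n$; the empty composition $\varnothing$ is the unique composition of $0$. The reverse composition diagram of $\alpha$ is the array of left-justified cells with $\alpha_i$ cells in row $i$ from the top; $(i,j)$ is the cell in row $i$, column $j$. The reverse composition poset on all compositions is defined by the cover relations: $\alpha=(\alpha_1,\ldots,\alpha_\ell)$ is covered exactly by $(1,\alpha_1,\ldots,\alpha_\ell)$ and by $(\alpha_1,\ldots,\alpha_k+1,\ldots,\alpha_\ell)$ for each $k$ such that $\alpha_i\neq\alpha_k$ for all $i<k$; its strict order is $<_c$ and its weak order is $\leq_c$. If $\beta\leq_c\alpha$, the skew reverse composition shape $\alpha/\!\!/\beta$ is the set of cells of $\alpha$ not in $\beta$, where $\beta$ is drawn in the bottom left corner of $\alpha$ (rows of $\beta$ aligned with the last $\ell(\beta)$ rows of $\alpha$, left-justified); its size is $|\alpha|-|\beta|$, and $\alpha/\!\!/\varnothing$ is identified with $\alpha$. A (skew) standard reverse composition tableau (SRCT) of shape $\alpha/\!\!/\beta$ of size $m$ is a bijective filling $\tau:\alpha/\!\!/\beta\to\{1,\ldots,m\}$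 such that (1) entries in each row decrease from left to right; (2) entries in the first column increase from top to bottom; (3) (triple rule) setting $\tau(i,j)=\infty$ for $(i,j)\in\beta$: if $i<j$, $(j,k+1)\in\alpha/\!\!/\beta$ and $\tau(i,k)>\tau(j,k+1)$, then $\tau(i,k+1)$ exists and $\tau(i,k+1)>\tau(j,k+1)$. $\mathrm{Des}(\tau)=\{i\in[m-1]:i+1\text{ appears weakly right of }i\}$. Entries $i,i+1$ are attacking in $\tau$ if they are in the same column, or in adjacent columns with $i+1$ strictly southeast of $i$. For $1\leq i\leq m-1$, $\pi_i(\tau)=\tau$ if $i\notin\mathrm{Des}(\tau)$; $\pi_i(\tau)=0$ if $i\in\mathrm{Des}(\tau)$ and $i,i+1$ are attacking; $\pi_i(\tau)=s_i(\tau)$, the SRCT obtained by interchanging the positions of $i$ and $i+1$, if $i\in\mathrm{Des}(\tau)$ and $i,i+1$ are non-attacking. $H_m(0)$ is the $\mathbb{C}$-algebra generated by $T_1,\ldots,T_{m-1}$ with $T_i^2=T_i$, $T_iT_{i+1}T_i=T_{i+1}T_iT_{i+1}$, $T_iT_j=T_jT_i$ for $|i-j|\geq2$ (so $H_0(0)=H_1(0)=\mathbb{C}$). $\mathbf{S}_{\alpha/\!\!/\beta}$ is the $H_m(0)$-module spanned over $\mathbb{C}$ by all SRCTs of shape $\alpha/\!\!/\beta$, with $T_i$ acting as $\pi_i$; $\mathbf{S}_\alpha=\mathbf{S}_{\alpha/\!\!/\varnothing}$, and the module of an empty shape is $\mathbb{C}$. $H_{m,n-m}(0)$ is the subalgebra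 of $H_n(0)$ generated by $\{T_i:1\leq i\leq n-1,\ i\neq m\}$, identified with $H_m(0)\otimes H_{n-m}(0)$ via $T_i\mapsto T_i\otimes1$ for $i<m$ and $T_i\mapsto1\otimes T_{i-m}$ for $i>m$. The arrow $\downarrow$ denotes restriction of the module to this subalgebra. *)

theory Defs
  imports Complex_Main "HOL-Algebra.QuotRing" "HOL-Algebra.Module" "HOL-Algebra.Generated_Rings"
    "HOL-Algebra.Product_Groups" "HOL-Algebra.Free_Abelian_Groups" "HOL-Library.Poly_Mapping" "HOL-Library.Extended_Nat"
    "HOL-Combinatorics.Transposition"
begin

section \<open>Left modules over possibly noncommutative rings\<close>

text \<open>The locale \<^locale>\<open>module\<close> of the library requires a commutative ring. In all module
  records built below the ring fields \<open>mult\<close> and \<open>one\<close> play no role and are left undefined.\<close>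

locale left_module = R?: ring R + M?: abelian_group M
  for R :: "('a, 'r) ring_scheme" and M :: "('a, 'v, 's) module_scheme" +
  assumes smult_closed: "\<lbrakk>a \<in> carrier R; x \<in> carrier M\<rbrakk> \<Longrightarrow> a \<odot>\<^bsub>M\<^esub> x \<in> carrier M"
    and smult_l_distr: "\<lbrakk>a \<in> carrier R; b \<in> carrier R; x \<in> carrier M\<rbrakk>
      \<Longrightarrow> (a \<oplus>\<^bsub>R\<^esub> b) \<odot>\<^bsub>M\<^esub> x = a \<odot>\<^bsub>M\<^esub> x \<oplus>\<^bsub>M\<^esub> b \<odot>\<^bsub>M\<^esub> x"
    and smult_r_distr: "\<lbrakk>a \<in> carrier R; x \<in> carrier M; y \<in> carrier M\<rbrakk>
      \<Longrightarrow> a \<odot>\<^bsub>M\<^esub> (x \<oplus>\<^bsub>M\<^esub> y) = a \<odot>\<^bsub>M\<^esub> x \<oplus>\<^bsub>M\<^esub> a \<odot>\<^bsub>M\<^esub> y"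
    and smult_assoc: "\<lbrakk>a \<in> carrier R; b \<in> carrier R; x \<in> carrier M\<rbrakk>
      \<Longrightarrow> (a \<otimes>\<^bsub>R\<^esub> b) \<odot>\<^bsub>M\<^esub> x = a \<odot>\<^bsub>M\<^esub> (b \<odot>\<^bsub>M\<^esub> x)"
    and smult_one: "x \<in> carrier M \<Longrightarrow> \<one>\<^bsub>R\<^esub> \<odot>\<^bsub>M\<^esub> x = x"

definition left_module_iso :: "('a, 'r) ring_scheme \<Rightarrow> ('a, 'v) module \<Rightarrow> ('a, 'w) module \<Rightarrow> ('v \<Rightarrow> 'w) set"
  where "left_module_iso R M N =
    {\<phi> \<in> iso (add_monoid M) (add_monoid N).
      \<forall>a \<in> carrier R. \<forall>x \<in> carrier M. \<phi> (a \<odot>\<^bsub>M\<^esub> x) = a \<odot>\<^bsub>N\<^esub> \<phi> x}"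

definition left_module_isomorphic :: "('a, 'r) ring_scheme \<Rightarrow> ('a, 'v) module \<Rightarrow> ('a, 'w) module \<Rightarrow> bool"
  where "left_module_isomorphic R M N \<longleftrightarrow>
    left_module R M \<and> left_module R N \<and> left_module_iso R M N \<noteq> {}"

definition restrict_scalars :: "('b \<Rightarrow> 'a) \<Rightarrow> ('a, 'v) module \<Rightarrow> ('b, 'v) module"
  where "restrict_scalars h M =
    \<lparr>carrier = carrier M, monoid.mult = undefined, one = undefined, ring.zero = \<zero>\<^bsub>M\<^esub>, add = add M,
     smult = (\<lambda>b x. h b \<odot>\<^bsub>M\<^esub> x)\<rparr>"

definition direct_sum_module :: "'i set \<Rightarrow> ('i \<Rightarrow> ('a, 'v) module) \<Rightarrow> ('a, 'i \<Rightarrow> 'v) module"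
  where "direct_sum_module I M =
    (let G = sum_group I (\<lambda>i. add_monoid (M i)) in
     \<lparr>carrier = carrier G, monoid.mult = undefined, one = undefined, ring.zero = \<one>\<^bsub>G\<^esub>, add = monoid.mult G,
      smult = (\<lambda>a x. \<lambda>i\<in>I. a \<odot>\<^bsub>M i\<^esub> x i)\<rparr>)"


section \<open>Complex algebras and tensor products\<close>

text \<open>A complex algebra is a record of type \<open>(complex, 'a) module\<close>: its ring structure together
  with multiplication by complex scalars.\<close>

definition quotient_algebra :: "(complex, 'a) module \<Rightarrow> 'a set \<Rightarrow> (complex, 'a set) module"
  where "quotient_algebra A I =
    ring.extend (A Quot I) (module.fields (\<lambda>c P. \<Union>x\<in>P. I +>\<^bsub>A\<^esub> (c \<odot>\<^bsub>A\<^esub> x)))"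

definition algebra_iso :: "(complex, 'a) module \<Rightarrow> (complex, 'b) module \<Rightarrow> ('a \<Rightarrow> 'b) set"
  where "algebra_iso A B =
    {h \<in> ring_iso A B. \<forall>c. \<forall>x \<in> carrier A. h (c \<odot>\<^bsub>A\<^esub> x) = c \<odot>\<^bsub>B\<^esub> h x}"

definition generated_subalgebra :: "(complex, 'a) module \<Rightarrow> 'a set \<Rightarrow> (complex, 'a) module"
  where "generated_subalgebra A S =
    A\<lparr>carrier := generate_ring A (S \<union> {c \<odot>\<^bsub>A\<^esub> \<one>\<^bsub>A\<^esub> | c. True})\<rparr>"

text \<open>The complex vector space underlying a left module over a complex algebra.\<close>

definition underlying_space :: "(complex, 'a) module \<Rightarrow> ('a, 'v) module \<Rightarrow> (complex, 'v) module"
  where "underlying_space A M = restrict_scalars (\<lambda>c. c \<odot>\<^bsub>A\<^esub> \<one>\<^bsub>A\<^esub>) M"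

text \<open>The tensor product over the complex numbers of \<open>U\<close> and \<open>V\<close> is the free abelian group on
  pairs modulo biadditivity and balancedness.\<close>

definition tensor_rels :: "(complex, 'u) module \<Rightarrow> (complex, 'v) module \<Rightarrow> ('u \<times> 'v \<Rightarrow>\<^sub>0 int) set"
  where "tensor_rels U V =
    {frag_of (u \<oplus>\<^bsub>U\<^esub> u', v) - frag_of (u, v) - frag_of (u', v) | u u' v.
      u \<in> carrier U \<and> u' \<in> carrier U \<and> v \<in> carrier V} \<union>
    {frag_of (u, v \<oplus>\<^bsub>V\<^esub> v') - frag_of (u, v) - frag_of (u, v') | u v v'.
      u \<in> carrier U \<and> v \<in> carrier V \<and> v' \<in> carrier V} \<union>
    {frag_of (c \<odot>\<^bsub>U\<^esub> u, v) - frag_of (u, c \<odot>\<^bsub>V\<^esub> v) | c u v.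
      u \<in> carrier U \<and> v \<in> carrier V}"

definition tensor_kernel :: "(complex, 'u) module \<Rightarrow> (complex, 'v) module \<Rightarrow> ('u \<times> 'v \<Rightarrow>\<^sub>0 int) set"
  where "tensor_kernel U V =
    generate (free_Abelian_group (carrier U \<times> carrier V)) (tensor_rels U V)"

definition tensor_group :: "(complex, 'u) module \<Rightarrow> (complex, 'v) module \<Rightarrow> ('u \<times> 'v \<Rightarrow>\<^sub>0 int) set monoid"
  where "tensor_group U V = free_Abelian_group (carrier U \<times> carrier V) Mod tensor_kernel U V"

definition tensor_class ::
    "(complex, 'u) module \<Rightarrow> (complex, 'v) module \<Rightarrow> ('u \<times> 'v \<Rightarrow>\<^sub>0 int) \<Rightarrow> ('u \<times> 'v \<Rightarrow>\<^sub>0 int) set"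
  where "tensor_class U V x = tensor_kernel U V #>\<^bsub>free_Abelian_group (carrier U \<times> carrier V)\<^esub> x"

definition pure_tensor ::
    "(complex, 'u) module \<Rightarrow> (complex, 'v) module \<Rightarrow> 'u \<Rightarrow> 'v \<Rightarrow> ('u \<times> 'v \<Rightarrow>\<^sub>0 int) set"
  where "pure_tensor U V u v = tensor_class U V (frag_of (u, v))"

text \<open>The biadditive extension of \<open>(a, b), (x, y) \<mapsto> (f a x, g b y)\<close>.\<close>

definition frag_extend2 :: "('a \<Rightarrow> 'x \<Rightarrow> 'u) \<Rightarrow> ('b \<Rightarrow> 'y \<Rightarrow> 'v) \<Rightarrow>
    ('a \<times> 'b \<Rightarrow>\<^sub>0 int) \<Rightarrow> ('x \<times> 'y \<Rightarrow>\<^sub>0 int) \<Rightarrow> ('u \<times> 'v \<Rightarrow>\<^sub>0 int)"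
  where "frag_extend2 f g p q =
    frag_extend (\<lambda>(a, b). frag_extend (\<lambda>(x, y). frag_of (f a x, g b y)) q) p"

definition tensor_algebra ::
    "(complex, 'a) module \<Rightarrow> (complex, 'b) module \<Rightarrow> (complex, ('a \<times> 'b \<Rightarrow>\<^sub>0 int) set) module"
  where "tensor_algebra A B =
    \<lparr>carrier = carrier (tensor_group A B),
     monoid.mult = (\<lambda>P Q. \<Union>p\<in>P. \<Union>q\<in>Q. tensor_class A B (frag_extend2 (monoid.mult A) (monoid.mult B) p q)),
     one = pure_tensor A B \<one>\<^bsub>A\<^esub> \<one>\<^bsub>B\<^esub>,
     ring.zero = \<one>\<^bsub>tensor_group A B\<^esub>,
     add = monoid.mult (tensor_group A B),
     smult = (\<lambda>c P. \<Union>p\<in>P. tensor_class A B (frag_extend (\<lambda>(a, b). frag_of (c \<odot>\<^bsub>A\<^esub> a, b)) p))\<rparr>"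

text \<open>The external tensor product of an \<open>A\<close>-module and a \<open>B\<close>-module, over
  \<^term>\<open>tensor_algebra A B\<close>.\<close>

definition tensor_module :: "(complex, 'a) module \<Rightarrow> (complex, 'b) module \<Rightarrow>
    ('a, 'v) module \<Rightarrow> ('b, 'w) module \<Rightarrow> (('a \<times> 'b \<Rightarrow>\<^sub>0 int) set, ('v \<times> 'w \<Rightarrow>\<^sub>0 int) set) module"
  where "tensor_module A B M N =
    (let U = underlying_space A M; V = underlying_space B N in
     \<lparr>carrier = carrier (tensor_group U V), monoid.mult = undefined, one = undefined,
      ring.zero = \<one>\<^bsub>tensor_group U V\<^esub>,
      add = monoid.mult (tensor_group U V),
      smult = (\<lambda>P Q. \<Union>p\<in>P. \<Union>q\<in>Q. tensor_class U V (frag_extend2 (smult M) (smult N) p q))\<rparr>)"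


section \<open>0-Hecke algebras\<close>

text \<open>Words form a monoid under concatenation, so that the convolution product makes
  \<open>'a list \<Rightarrow>\<^sub>0 complex\<close> the free associative complex algebra on \<open>'a\<close>.\<close>

instantiation list :: (type) monoid_add
begin
definition zero_list :: "'a list" where "zero_list = []"
definition plus_list :: "'a list \<Rightarrow> 'a list \<Rightarrow> 'a list" where "plus_list = (@)"
instance by standard (simp_all add: zero_list_def plus_list_def)
end

definition scale :: "complex \<Rightarrow> ('a \<Rightarrow>\<^sub>0 complex) \<Rightarrow> ('a \<Rightarrow>\<^sub>0 complex)"
  where "scale c v = Poly_Mapping.map ((*) c) v"

definition linear_extend :: "('a \<Rightarrow> 'b \<Rightarrow>\<^sub>0 complex) \<Rightarrow> ('a \<Rightarrow>\<^sub>0 complex) \<Rightarrow> ('b \<Rightarrow>\<^sub>0 complex)"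
  where "linear_extend f v = (\<Sum>x \<in> Poly_Mapping.keys v. scale (Poly_Mapping.lookup v x) (f x))"

definition free_algebra :: "'a set \<Rightarrow> (complex, 'a list \<Rightarrow>\<^sub>0 complex) module"
  where "free_algebra S =
    \<lparr>carrier = {p. Poly_Mapping.keys p \<subseteq> lists S}, monoid.mult = (*), one = 1, ring.zero = 0, add = (+),
     smult = scale\<rparr>"

definition gen :: "nat \<Rightarrow> nat list \<Rightarrow>\<^sub>0 complex"
  where "gen i = Poly_Mapping.single [i] 1"

definition hecke_rels :: "nat \<Rightarrow> (nat list \<Rightarrow>\<^sub>0 complex) set"
  where "hecke_rels m =
    {gen i * gen i - gen i | i. i \<in> {1..<m}} \<union>
    {gen i * gen (i + 1) * gen i - gen (i + 1) * gen i * gen (i + 1) | i.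
      i \<in> {1..<m} \<and> i + 1 \<in> {1..<m}} \<union>
    {gen i * gen j - gen j * gen i | i j.
      i \<in> {1..<m} \<and> j \<in> {1..<m} \<and> \<bar>int i - int j\<bar> \<ge> 2}"

definition hecke_ideal :: "nat \<Rightarrow> (nat list \<Rightarrow>\<^sub>0 complex) set"
  where "hecke_ideal m = Idl\<^bsub>free_algebra {1..<m}\<^esub> (hecke_rels m)"

definition hecke :: "nat \<Rightarrow> (complex, (nat list \<Rightarrow>\<^sub>0 complex) set) module"
  where "hecke m = quotient_algebra (free_algebra {1..<m}) (hecke_ideal m)"

definition hecke_gen :: "nat \<Rightarrow> nat \<Rightarrow> (nat list \<Rightarrow>\<^sub>0 complex) set"
  where "hecke_gen m i = hecke_ideal m +>\<^bsub>free_algebra {1..<m}\<^esub> gen i"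

definition parabolic :: "nat \<Rightarrow> nat \<Rightarrow> (complex, (nat list \<Rightarrow>\<^sub>0 complex) set) module"
  where "parabolic n m = generated_subalgebra (hecke n) (hecke_gen n ` ({1..<n} - {m}))"

text \<open>The identification of the tensor product of \<^term>\<open>hecke m\<close> and \<^term>\<open>hecke (n - m)\<close> with
  \<^term>\<open>parabolic n m\<close>. It is unique on the carrier, being prescribed on algebra generators.\<close>

definition parabolic_identification :: "nat \<Rightarrow> nat \<Rightarrow>
    (((nat list \<Rightarrow>\<^sub>0 complex) set \<times> (nat list \<Rightarrow>\<^sub>0 complex) set \<Rightarrow>\<^sub>0 int) set
      \<Rightarrow> (nat list \<Rightarrow>\<^sub>0 complex) set) \<Rightarrow> bool"
  where "parabolic_identification n m \<iota> \<longleftrightarrow>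
    \<iota> \<in> algebra_iso (tensor_algebra (hecke m) (hecke (n - m))) (parabolic n m) \<and>
    (\<forall>i \<in> {1..<m}. \<iota> (pure_tensor (hecke m) (hecke (n - m)) (hecke_gen m i) \<one>\<^bsub>hecke (n - m)\<^esub>) = hecke_gen n i) \<and>
    (\<forall>i \<in> {m<..<n}. \<iota> (pure_tensor (hecke m) (hecke (n - m)) \<one>\<^bsub>hecke m\<^esub> (hecke_gen (n - m) (i - m))) = hecke_gen n i)"


section \<open>Reverse composition tableaux\<close>

definition is_composition :: "nat list \<Rightarrow> nat \<Rightarrow> bool"
  where "is_composition \<alpha> n \<longleftrightarrow> (\<forall>a \<in> set \<alpha>. 0 < a) \<and> sum_list \<alpha> = n"

inductive comp_cover :: "nat list \<Rightarrow> nat list \<Rightarrow> bool"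
  where
    prepend: "comp_cover \<alpha> (1 # \<alpha>)"
  | increment: "\<lbrakk>k < length \<alpha>; \<forall>i<k. \<alpha> ! i \<noteq> \<alpha> ! k\<rbrakk> \<Longrightarrow> comp_cover \<alpha> (\<alpha>[k := \<alpha> ! k + 1])"

text \<open>Covers of a composition are compositions, so chains starting at a composition stay in the poset.\<close>

definition comp_le :: "nat list \<Rightarrow> nat list \<Rightarrow> bool"  (infix \<open>\<le>\<^sub>c\<close> 50)
  where "\<beta> \<le>\<^sub>c \<alpha> \<longleftrightarrow> comp_cover\<^sup>*\<^sup>* \<beta> \<alpha>"

text \<open>Cells \<open>(row, column)\<close> are numbered from \<open>1\<close>, rows from top to bottom.\<close>

definition cells :: "nat list \<Rightarrow> (nat \<times> nat) set"
  where "cells \<alpha> = {(i, j). i \<in> {1..length \<alpha>} \<and> j \<in> {1..\<alpha> ! (i - 1)}}"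

definition inner_cells :: "nat list \<Rightarrow> nat list \<Rightarrow> (nat \<times> nat) set"
  where "inner_cells \<alpha> \<beta> = (\<lambda>(i, j). (i + (length \<alpha> - length \<beta>), j)) ` cells \<beta>"

definition skew_cells :: "nat list \<Rightarrow> nat list \<Rightarrow> (nat \<times> nat) set"
  where "skew_cells \<alpha> \<beta> = cells \<alpha> - inner_cells \<alpha> \<beta>"

definition skew_size :: "nat list \<Rightarrow> nat list \<Rightarrow> nat"
  where "skew_size \<alpha> \<beta> = sum_list \<alpha> - sum_list \<beta>"

definition entry :: "nat list \<Rightarrow> nat list \<Rightarrow> (nat \<times> nat \<Rightarrow> nat) \<Rightarrow> nat \<times> nat \<Rightarrow> enat"
  where "entry \<alpha> \<beta> \<tau> x = (if x \<in> inner_cells \<alpha> \<beta> then \<infinity> else enat (\<tau> x))"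

definition SRCT :: "nat list \<Rightarrow> nat list \<Rightarrow> (nat \<times> nat \<Rightarrow> nat) set"
  where "SRCT \<alpha> \<beta> = {\<tau> \<in> extensional (skew_cells \<alpha> \<beta>).
    bij_betw \<tau> (skew_cells \<alpha> \<beta>) {1..skew_size \<alpha> \<beta>} \<and>
    (\<forall>i j j'. (i, j) \<in> skew_cells \<alpha> \<beta> \<and> (i, j') \<in> skew_cells \<alpha> \<beta> \<and> j < j' \<longrightarrow> \<tau> (i, j) > \<tau> (i, j')) \<and>
    (\<forall>i i'. (i, 1) \<in> skew_cells \<alpha> \<beta> \<and> (i', 1) \<in> skew_cells \<alpha> \<beta> \<and> i < i' \<longrightarrow> \<tau> (i, 1) < \<tau> (i', 1)) \<and>
    (\<forall>i j k. i < j \<and> (j, k + 1) \<in> skew_cells \<alpha> \<beta> \<and> (i, k) \<in> cells \<alpha> \<and>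
        entry \<alpha> \<beta> \<tau> (i, k) > entry \<alpha> \<beta> \<tau> (j, k + 1) \<longrightarrow>
      (i, k + 1) \<in> cells \<alpha> \<and> entry \<alpha> \<beta> \<tau> (i, k + 1) > entry \<alpha> \<beta> \<tau> (j, k + 1))}"

definition position :: "nat list \<Rightarrow> nat list \<Rightarrow> (nat \<times> nat \<Rightarrow> nat) \<Rightarrow> nat \<Rightarrow> nat \<times> nat"
  where "position \<alpha> \<beta> \<tau> i = inv_into (skew_cells \<alpha> \<beta>) \<tau> i"

definition Des :: "nat list \<Rightarrow> nat list \<Rightarrow> (nat \<times> nat \<Rightarrow> nat) \<Rightarrow> nat set"
  where "Des \<alpha> \<beta> \<tau> =
    {i \<in> {1..<skew_size \<alpha> \<beta>}. snd (position \<alpha> \<beta> \<tau> i) \<le> snd (position \<alpha> \<beta> \<tau> (i + 1))}"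

definition attacking :: "nat list \<Rightarrow> nat list \<Rightarrow> (nat \<times> nat \<Rightarrow> nat) \<Rightarrow> nat \<Rightarrow> bool"
  where "attacking \<alpha> \<beta> \<tau> i \<longleftrightarrow>
    (let (r, c) = position \<alpha> \<beta> \<tau> i; (r', c') = position \<alpha> \<beta> \<tau> (i + 1) in
     c = c' \<or> (c' = c + 1 \<and> r < r'))"

definition swap_entries :: "nat list \<Rightarrow> nat list \<Rightarrow> nat \<Rightarrow> (nat \<times> nat \<Rightarrow> nat) \<Rightarrow> (nat \<times> nat \<Rightarrow> nat)"
  where "swap_entries \<alpha> \<beta> i \<tau> = (\<lambda>x \<in> skew_cells \<alpha> \<beta>. transpose i (i + 1) (\<tau> x))"

definition pi_op :: "nat list \<Rightarrow> nat list \<Rightarrow> nat \<Rightarrow> (nat \<times> nat \<Rightarrow> nat) \<Rightarrow> ((nat \<times> nat \<Rightarrow> nat) \<Rightarrow>\<^sub>0 complex)"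
  where "pi_op \<alpha> \<beta> i \<tau> =
    (if i \<notin> Des \<alpha> \<beta> \<tau> then Poly_Mapping.single \<tau> 1
     else if attacking \<alpha> \<beta> \<tau> i then 0
     else Poly_Mapping.single (swap_entries \<alpha> \<beta> i \<tau>) 1)"

text \<open>A word \<open>[i\<^sub>1, \<dots>, i\<^sub>k]\<close> acts as the composite of the operators for \<open>i\<^sub>1, \<dots>, i\<^sub>k\<close>, the last
  letter being applied first; a class in \<^term>\<open>hecke (skew_size \<alpha> \<beta>)\<close> acts as the common action
  of its representatives.\<close>

definition word_action :: "nat list \<Rightarrow> nat list \<Rightarrow> (nat list \<Rightarrow>\<^sub>0 complex) \<Rightarrow>
    ((nat \<times> nat \<Rightarrow> nat) \<Rightarrow>\<^sub>0 complex) \<Rightarrow> ((nat \<times> nat \<Rightarrow> nat) \<Rightarrow>\<^sub>0 complex)"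
  where "word_action \<alpha> \<beta> p v = linear_extend (\<lambda>w. foldr (\<lambda>i. linear_extend (pi_op \<alpha> \<beta> i)) w v) p"

definition srct_module :: "nat list \<Rightarrow> nat list \<Rightarrow>
    ((nat list \<Rightarrow>\<^sub>0 complex) set, (nat \<times> nat \<Rightarrow> nat) \<Rightarrow>\<^sub>0 complex) module"
  where "srct_module \<alpha> \<beta> =
    \<lparr>carrier = {v. Poly_Mapping.keys v \<subseteq> SRCT \<alpha> \<beta>}, monoid.mult = undefined, one = undefined,
     ring.zero = 0, add = (+),
     smult = (\<lambda>P v. the_elem ((\<lambda>p. word_action \<alpha> \<beta> p v) ` P))\<rparr>"

end

theory Submission
  imports Defs
begin

text \<open>In a tableau \<open>T\<close> of shape \<open>\<alpha>\<close> the cells with entries above \<open>m\<close> form a diagram \<open>\<beta> \<le>\<^sub>c \<alpha>\<close>, because removing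
  the smallest entry undoes a cover; they carry a tableau of shape \<open>\<beta>\<close>, the remaining cells one of shape
  \<open>\<alpha> // \<beta>\<close>, and \<open>T\<close> is recovered from the two. The operators \<open>\<pi>\<^sub>i\<close> with \<open>i < m\<close> only see the second
  tableau, those with \<open>i > m\<close> only the first, so this bijection of bases is the required isomorphism.
  That the tensor product of the two 0-Hecke algebras embeds into \<open>H\<^sub>n(0)\<close> needs no basis of \<open>H\<^sub>n(0)\<close>:
  sending \<open>T\<^sub>m\<close> to \<open>0\<close> respects the relations and defines a retraction.\<close>

section \<open>Complex spaces, algebras and bilinear maps\<close>

text \<open>\<open>T\<^sub>m\<close> is the only generator that can exchange an entry at most
  \<open>m\<close> with one above \<open>m\<close>. Without it the span of the tableaux with a fixed
  set of cells above \<open>m\<close> is stable, so the restriction splits as a direct sum and not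
  merely as a filtration. In the same way \<open>T\<^sub>m\<close> occurs in every term of each
  defining relation that contains it, which is why it can be sent to \<open>0\<close>. The obstacle
  is that no object comes with a basis. Tensor products are quotients of free abelian groups by
  biadditivity and balancedness, with products and actions defined by unions over representatives,
  and the 0-Hecke algebra is a quotient of a free algebra. Hence each construction needs a
  well-definedness argument and a universal property, and all maps out of it are built from the
  latter. Two places need more than generators and relations: the embedding into
  \<open>hecke n\<close>, where injectivity comes from the retraction, and the independence of
  tensors of tableaux, which is detected by a product of coordinate functions. Equivariance is
  checked on algebra generators and scalars only, and spreads because the good elements are closed
  under the ring operations.\<close>

locale complex_space = abelian_group U for U :: "(complex, 'u) module" (structure) +
  assumes scale_closed [simp, intro]: "x \<in> carrier U \<Longrightarrow> c \<odot> x \<in> carrier U"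
    and scale_add_left: "x \<in> carrier U \<Longrightarrow> (a + b) \<odot> x = a \<odot> x \<oplus> b \<odot> x"
    and scale_add_right: "\<lbrakk>x \<in> carrier U; y \<in> carrier U\<rbrakk> \<Longrightarrow> c \<odot> (x \<oplus> y) = c \<odot> x \<oplus> c \<odot> y"
    and scale_scale: "x \<in> carrier U \<Longrightarrow> (a * b) \<odot> x = a \<odot> (b \<odot> x)"
    and scale_one [simp]: "x \<in> carrier U \<Longrightarrow> 1 \<odot> x = x"

locale complex_algebra = ring A + complex_space A for A :: "(complex, 'a) module" (structure) +
  assumes scale_mult_left: "\<lbrakk>x \<in> carrier A; y \<in> carrier A\<rbrakk> \<Longrightarrow> c \<odot> (x \<otimes> y) = (c \<odot> x) \<otimes> y"
    and scale_mult_right: "\<lbrakk>x \<in> carrier A; y \<in> carrier A\<rbrakk> \<Longrightarrow> c \<odot> (x \<otimes> y) = x \<otimes> (c \<odot> y)"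
begin

lemma scale_eq_mult: "x \<in> carrier A \<Longrightarrow> c \<odot> x = (c \<odot> \<one>) \<otimes> x"
  by (metis l_one one_closed scale_mult_left)

end

text \<open>The condition under which \<open>frag_extend2\<close> descends to tensor classes. It is
  met by the product of a complex algebra and by the action of an algebra on the underlying space of
  a module.\<close>

definition bilinear_map where
  "bilinear_map A X U f \<longleftrightarrow>
    (\<forall>a\<in>carrier A. \<forall>x\<in>carrier X. f a x \<in> carrier U) \<and>
    (\<forall>a\<in>carrier A. \<forall>a'\<in>carrier A. \<forall>x\<in>carrier X. f (a \<oplus>\<^bsub>A\<^esub> a') x = f a x \<oplus>\<^bsub>U\<^esub> f a' x) \<and>
    (\<forall>a\<in>carrier A. \<forall>x\<in>carrier X. \<forall>x'\<in>carrier X. f a (x \<oplus>\<^bsub>X\<^esub> x') = f a x \<oplus>\<^bsub>U\<^esub> f a x') \<and>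
    (\<forall>c. \<forall>a\<in>carrier A. \<forall>x\<in>carrier X. f (c \<odot>\<^bsub>A\<^esub> a) x = c \<odot>\<^bsub>U\<^esub> f a x) \<and>
    (\<forall>c. \<forall>a\<in>carrier A. \<forall>x\<in>carrier X. f a (c \<odot>\<^bsub>X\<^esub> x) = c \<odot>\<^bsub>U\<^esub> f a x)"

lemma bilinear_mapD:
  assumes "bilinear_map A X U f"
  shows "\<lbrakk>a \<in> carrier A; x \<in> carrier X\<rbrakk> \<Longrightarrow> f a x \<in> carrier U"
    and "\<lbrakk>a \<in> carrier A; a' \<in> carrier A; x \<in> carrier X\<rbrakk> \<Longrightarrow> f (a \<oplus>\<^bsub>A\<^esub> a') x = f a x \<oplus>\<^bsub>U\<^esub> f a' x"
    and "\<lbrakk>a \<in> carrier A; x \<in> carrier X; x' \<in> carrier X\<rbrakk> \<Longrightarrow> f a (x \<oplus>\<^bsub>X\<^esub> x') = f a x \<oplus>\<^bsub>U\<^esub> f a x'"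
    and "\<lbrakk>a \<in> carrier A; x \<in> carrier X\<rbrakk> \<Longrightarrow> f (c \<odot>\<^bsub>A\<^esub> a) x = c \<odot>\<^bsub>U\<^esub> f a x"
    and "\<lbrakk>a \<in> carrier A; x \<in> carrier X\<rbrakk> \<Longrightarrow> f a (c \<odot>\<^bsub>X\<^esub> x) = c \<odot>\<^bsub>U\<^esub> f a x"
  using assms unfolding bilinear_map_def by blast+

lemma (in complex_algebra) bilinear_mult: "bilinear_map A A A (\<otimes>)"
  unfolding bilinear_map_def
  by (auto simp: l_distr r_distr scale_mult_left[symmetric] scale_mult_right[symmetric])

text \<open>The module records share their addition with other records, so the group axioms are
  carried over field by field instead of being proved again.\<close>

lemma comm_group_cong:
  assumes "comm_group G" "carrier H = carrier G" "monoid.mult H = monoid.mult G" "\<one>\<^bsub>H\<^esub> = \<one>\<^bsub>G\<^esub>"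
  shows "comm_group H"
proof -
  interpret comm_group G by fact
  show ?thesis
    by (rule comm_groupI) (auto simp: assms(2-4) m_assoc intro: l_inv_ex m_comm)
qed

lemma complex_space_underlying_space:
  assumes "complex_algebra A" "left_module A M"
  shows "complex_space (underlying_space A M)"
proof -
  interpret A: complex_algebra A by fact
  interpret M: left_module A M by fact
  have "comm_group (add_monoid (underlying_space A M))"
    by (intro comm_group_cong[OF M.a_comm_group])
      (simp_all add: underlying_space_def restrict_scalars_def)
  then interpret S: abelian_group "underlying_space A M"
    by (rule comm_group_abelian_groupI)
  show ?thesis
  proof
    fix x a b
    assume "x \<in> carrier (underlying_space A M)"
    then have x: "x \<in> carrier M"
      by (simp add: underlying_space_def restrict_scalars_def)
    \<comment> \<open>Scalars act on \<open>M\<close> through the unit of \<open>A\<close>, so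
      associativity of the scaling is multiplicativity of the map from \<open>c\<close> to
      \<open>c\<close> times the unit.\<close>
    have "(a * b) \<odot>\<^bsub>A\<^esub> \<one>\<^bsub>A\<^esub> = (a \<odot>\<^bsub>A\<^esub> \<one>\<^bsub>A\<^esub>) \<otimes>\<^bsub>A\<^esub> (b \<odot>\<^bsub>A\<^esub> \<one>\<^bsub>A\<^esub>)"
      by (metis A.l_one A.one_closed A.scale_closed A.scale_mult_left A.scale_scale)
    then show "(a * b) \<odot>\<^bsub>underlying_space A M\<^esub> x =
        a \<odot>\<^bsub>underlying_space A M\<^esub> (b \<odot>\<^bsub>underlying_space A M\<^esub> x)"
      using x by (simp add: underlying_space_def restrict_scalars_def M.smult_assoc)
  qed (simp_all add: underlying_space_def restrict_scalars_def M.smult_closed M.smult_l_distr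
      M.smult_r_distr M.smult_one A.scale_add_left)
qed

text \<open>Homogeneity in the module argument comes from the centrality of the scalar multiples of
  the unit of \<open>A\<close>, which the two equations \<open>*\<close> express.\<close>

lemma bilinear_smult_underlying:
  assumes "complex_algebra A" "left_module A M"
  shows "bilinear_map A (underlying_space A M) (underlying_space A M) (smult M)"
proof -
  interpret A: complex_algebra A by fact
  interpret M: left_module A M by fact
  have *: "(c \<odot>\<^bsub>A\<^esub> \<one>\<^bsub>A\<^esub>) \<otimes>\<^bsub>A\<^esub> a = c \<odot>\<^bsub>A\<^esub> a" "a \<otimes>\<^bsub>A\<^esub> (c \<odot>\<^bsub>A\<^esub> \<one>\<^bsub>A\<^esub>) = c \<odot>\<^bsub>A\<^esub> a"
    if "a \<in> carrier A" for c a
    using that A.scale_mult_left[of "\<one>\<^bsub>A\<^esub>" a c] A.scale_mult_right[of a "\<one>\<^bsub>A\<^esub>" c] by simp_all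
  have **: "(c \<odot>\<^bsub>A\<^esub> a) \<odot>\<^bsub>M\<^esub> x = (c \<odot>\<^bsub>A\<^esub> \<one>\<^bsub>A\<^esub>) \<odot>\<^bsub>M\<^esub> (a \<odot>\<^bsub>M\<^esub> x)"
    "a \<odot>\<^bsub>M\<^esub> ((c \<odot>\<^bsub>A\<^esub> \<one>\<^bsub>A\<^esub>) \<odot>\<^bsub>M\<^esub> x) = (c \<odot>\<^bsub>A\<^esub> \<one>\<^bsub>A\<^esub>) \<odot>\<^bsub>M\<^esub> (a \<odot>\<^bsub>M\<^esub> x)"
    if "a \<in> carrier A" "x \<in> carrier M" for c a x
    using that M.smult_assoc[of "c \<odot>\<^bsub>A\<^esub> \<one>\<^bsub>A\<^esub>" a x] M.smult_assoc[of a "c \<odot>\<^bsub>A\<^esub> \<one>\<^bsub>A\<^esub>" x]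
    by (simp_all add: *)
  show ?thesis
    unfolding bilinear_map_def underlying_space_def restrict_scalars_def
    by (simp add: M.smult_closed M.smult_l_distr M.smult_r_distr) (blast intro: **)
qed


section \<open>Tensor products\<close>

lemma frag_extend_fun_diff: "frag_extend (\<lambda>x. f x - g x) p = frag_extend f p - frag_extend g p"
proof -
  have "Poly_Mapping.keys p \<subseteq> UNIV" by simp
  then show ?thesis
    by (induction p rule: frag_induction) (simp_all add: frag_extend_diff)
qed

lemma frag_extend2_0 [simp]: "frag_extend2 f g 0 q = 0" "frag_extend2 f g p 0 = 0"
  by (auto simp: frag_extend2_def intro: frag_extend_eq_0)

lemma frag_extend2_diff_left: "frag_extend2 f g (p - p') q = frag_extend2 f g p q - frag_extend2 f g p' q"
  by (simp add: frag_extend2_def frag_extend_diff)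

lemma frag_extend2_diff_right: "frag_extend2 f g p (q - q') = frag_extend2 f g p q - frag_extend2 f g p q'"
  by (simp add: frag_extend2_def frag_extend_diff case_prod_unfold frag_extend_fun_diff)

lemma frag_extend2_of: "frag_extend2 f g (frag_of (a, b)) (frag_of (x, y)) = frag_of (f a x, g b y)"
  by (simp add: frag_extend2_def)

lemma frag_extend2_of_left:
  "frag_extend2 f g (frag_of (a, b)) q = frag_extend (\<lambda>(x, y). frag_of (f a x, g b y)) q"
  by (simp add: frag_extend2_def)

lemma frag_extend2_minus_left: "frag_extend2 f g (- p) q = - frag_extend2 f g p q"
  using frag_extend2_diff_left[of f g 0 p q] by simp

lemma frag_extend2_minus_right: "frag_extend2 f g p (- q) = - frag_extend2 f g p q"
  using frag_extend2_diff_right[of f g p 0 q] by simp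

lemma frag_extend2_add_left: "frag_extend2 f g (p + p') q = frag_extend2 f g p q + frag_extend2 f g p' q"
  by (simp add: frag_extend2_def frag_extend_add)

lemma frag_extend2_add_right: "frag_extend2 f g p (q + q') = frag_extend2 f g p q + frag_extend2 f g p q'"
  using frag_extend2_diff_right[of f g p q "- q'"] by (simp add: frag_extend2_minus_right)

lemma keys_frag_extend2:
  assumes "\<And>a x. \<lbrakk>a \<in> A; x \<in> X\<rbrakk> \<Longrightarrow> f a x \<in> U" "\<And>b y. \<lbrakk>b \<in> B; y \<in> Y\<rbrakk> \<Longrightarrow> g b y \<in> V"
    and "Poly_Mapping.keys p \<subseteq> A \<times> B" "Poly_Mapping.keys q \<subseteq> X \<times> Y"
  shows "Poly_Mapping.keys (frag_extend2 f g p q) \<subseteq> U \<times> V"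
proof -
  have "Poly_Mapping.keys (frag_extend (\<lambda>(x, y). frag_of (f a x, g b y)) q) \<subseteq> U \<times> V"
    if "a \<in> A" "b \<in> B" for a b
    using assms that by (intro order_trans[OF keys_frag_extend]) (auto simp: keys_frag_of)
  then show ?thesis
    using assms(3) unfolding frag_extend2_def
    by (intro order_trans[OF keys_frag_extend]) (force simp: case_prod_unfold)
qed

text \<open>Both sides are additive in each of the three arguments, so generators decide. The
  functions on the two sides are kept separate so that one statement yields associativity of the
  product in \<open>tensor_algebra\<close> and the rule \<open>(a b) x = a (b x)\<close> in
  \<open>tensor_module\<close>.\<close>

lemma frag_extend2_assoc:
  assumes p: "Poly_Mapping.keys p \<subseteq> A \<times> B" and q: "Poly_Mapping.keys q \<subseteq> A' \<times> B'"
    and r: "Poly_Mapping.keys r \<subseteq> X \<times> Y"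
    and f: "\<And>a b x. \<lbrakk>a \<in> A; b \<in> A'; x \<in> X\<rbrakk> \<Longrightarrow> f (m a b) x = f' a (f'' b x)"
    and g: "\<And>a b x. \<lbrakk>a \<in> B; b \<in> B'; x \<in> Y\<rbrakk> \<Longrightarrow> g (n a b) x = g' a (g'' b x)"
  shows "frag_extend2 f g (frag_extend2 m n p q) r = frag_extend2 f' g' p (frag_extend2 f'' g'' q r)"
  using p
proof (induction p rule: frag_induction)
  case (one ab)
  obtain a b where ab: "ab = (a, b)" by force
  show ?case
    using q
  proof (induction q rule: frag_induction)
    case (one cd)
    obtain c d where cd: "cd = (c, d)" by force
    show ?case
      using r
    proof (induction r rule: frag_induction)
      case (one xy)
      then show ?case
        using \<open>ab \<in> A \<times> B\<close> \<open>cd \<in> A' \<times> B'\<close> by (cases xy) (auto simp: ab cd frag_extend2_of f g)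
    qed (auto simp: frag_extend2_diff_left frag_extend2_diff_right)
  qed (auto simp: frag_extend2_diff_left frag_extend2_diff_right)
qed (auto simp: frag_extend2_diff_left frag_extend2_diff_right)

section \<open>The tensor product of two complex spaces and its universal property\<close>

locale tensor_spaces = U: complex_space U + V: complex_space V
  for U :: "(complex, 'u) module" and V :: "(complex, 'v) module"
begin

abbreviation "F \<equiv> {x :: ('u \<times> 'v) \<Rightarrow>\<^sub>0 int. Poly_Mapping.keys x \<subseteq> carrier U \<times> carrier V}"

lemma rels_subset: "tensor_rels U V \<subseteq> carrier (free_Abelian_group (carrier U \<times> carrier V))"
  unfolding tensor_rels_def by (auto dest!: subsetD[OF keys_diff] simp: keys_frag_of)

lemma subgroup_tensor_kernel: "subgroup (tensor_kernel U V) (free_Abelian_group (carrier U \<times> carrier V))"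
  unfolding tensor_kernel_def by (rule group.generate_is_subgroup[OF group_free_Abelian_group rels_subset])

lemma kernel_subset: "tensor_kernel U V \<subseteq> F"
proof
  fix x assume "x \<in> tensor_kernel U V"
  then have "x \<in> carrier (free_Abelian_group (carrier U \<times> carrier V))"
    by (rule subgroup.mem_carrier[OF subgroup_tensor_kernel])
  then show "x \<in> F" by simp
qed

lemma kernel_zero: "0 \<in> tensor_kernel U V"
  using subgroup.one_closed[OF subgroup_tensor_kernel] by simp

lemma kernel_add: "\<lbrakk>x \<in> tensor_kernel U V; y \<in> tensor_kernel U V\<rbrakk> \<Longrightarrow> x + y \<in> tensor_kernel U V"
  using subgroup.m_closed[OF subgroup_tensor_kernel] by simp

lemma kernel_minus: "x \<in> tensor_kernel U V \<Longrightarrow> - x \<in> tensor_kernel U V"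
  using subgroup.m_inv_closed[OF subgroup_tensor_kernel, of x] subsetD[OF kernel_subset, of x] by simp

lemma kernel_diff: "\<lbrakk>x \<in> tensor_kernel U V; y \<in> tensor_kernel U V\<rbrakk> \<Longrightarrow> x - y \<in> tensor_kernel U V"
  using kernel_add[of x "- y"] kernel_minus by simp

lemma kernel_rel: "x \<in> tensor_rels U V \<Longrightarrow> x \<in> tensor_kernel U V"
  by (simp add: tensor_kernel_def generate.incl)

text \<open>The induction rule of \<open>generate\<close> has a separate case for inverses of
  generators; here it is absorbed into closure under negation, and the group operations are already
  those of the type of formal sums.\<close>

lemma kernel_induct [consumes 1, case_names zero rel minus add]:
  assumes "x \<in> tensor_kernel U V" "P 0" "\<And>x. x \<in> tensor_rels U V \<Longrightarrow> P x"
    "\<And>x. \<lbrakk>x \<in> tensor_kernel U V; P x\<rbrakk> \<Longrightarrow> P (- x)"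
    "\<And>x y. \<lbrakk>x \<in> tensor_kernel U V; y \<in> tensor_kernel U V; P x; P y\<rbrakk> \<Longrightarrow> P (x + y)"
  shows "P x"
  using assms(1) unfolding tensor_kernel_def
proof (induction rule: generate.induct)
  case (inv h)
  then show ?case using assms rels_subset kernel_rel by (auto simp: subset_iff)
next
  case one
  then show ?case using assms(2) by simp
next
  case (incl h)
  then show ?case using assms(3) by simp
next
  case (eng a b)
  then show ?case using assms(5)[of a b] by (simp add: tensor_kernel_def)
qed

lemma tensor_class_eq: "tensor_class U V x = (\<lambda>k. k + x) ` tensor_kernel U V"
  by (auto simp: tensor_class_def r_coset_def)

lemma mem_tensor_class: "y \<in> tensor_class U V x \<longleftrightarrow> y - x \<in> tensor_kernel U V"
  by (auto simp: tensor_class_eq intro: image_eqI[of _ _ "y - x"])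

lemma tensor_class_eq_iff: "tensor_class U V x = tensor_class U V y \<longleftrightarrow> x - y \<in> tensor_kernel U V"
proof
  assume "tensor_class U V x = tensor_class U V y"
  then show "x - y \<in> tensor_kernel U V"
    using kernel_zero mem_tensor_class[of x x] mem_tensor_class[of x y] by simp
next
  assume k: "x - y \<in> tensor_kernel U V"
  have "z - x \<in> tensor_kernel U V \<longleftrightarrow> z - y \<in> tensor_kernel U V" for z
    using kernel_add[OF _ k, of "z - x"] kernel_diff[OF _ k, of "z - y"] by (auto simp: algebra_simps)
  then show "tensor_class U V x = tensor_class U V y"
    by (auto simp: mem_tensor_class)
qed

lemma normal_kernel: "tensor_kernel U V \<lhd> free_Abelian_group (carrier U \<times> carrier V)"
  by (rule comm_group.normal_iff_subgroup[OF abelian_free_Abelian_group, THEN iffD2, OF subgroup_tensor_kernel])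

lemma comm_group_tensor_group: "comm_group (tensor_group U V)"
  unfolding tensor_group_def
  by (rule comm_group.abelian_FactGroup[OF abelian_free_Abelian_group subgroup_tensor_kernel])

lemma carrier_tensor_group: "carrier (tensor_group U V) = tensor_class U V ` F"
  unfolding tensor_group_def FactGroup_def RCOSETS_def tensor_class_def by auto

lemma tensor_class_closed [simp]:
  "Poly_Mapping.keys x \<subseteq> carrier U \<times> carrier V \<Longrightarrow> tensor_class U V x \<in> carrier (tensor_group U V)"
  by (simp add: carrier_tensor_group)

lemma mult_tensor_group:
  assumes "x \<in> F" "y \<in> F"
  shows "tensor_class U V x \<otimes>\<^bsub>tensor_group U V\<^esub> tensor_class U V y = tensor_class U V (x + y)"
  using normal.rcos_sum[OF normal_kernel, of x y] assms
  unfolding tensor_group_def FactGroup_def tensor_class_def by auto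

lemma tensor_class_zero: "tensor_class U V 0 = \<one>\<^bsub>tensor_group U V\<^esub>"
  by (auto simp: tensor_class_eq tensor_group_def FactGroup_def)

lemma inv_tensor_group:
  assumes "x \<in> F"
  shows "inv\<^bsub>tensor_group U V\<^esub> tensor_class U V x = tensor_class U V (- x)"
proof -
  interpret comm_group "tensor_group U V" by (rule comm_group_tensor_group)
  show ?thesis
    by (rule inv_equality) (use assms in \<open>auto simp: mult_tensor_group tensor_class_zero\<close>)
qed

lemma pure_closed [simp, intro]:
  "\<lbrakk>u \<in> carrier U; v \<in> carrier V\<rbrakk> \<Longrightarrow> pure_tensor U V u v \<in> carrier (tensor_group U V)"
  by (simp add: pure_tensor_def keys_frag_of)

lemma pure_add_left:
  assumes "u \<in> carrier U" "u' \<in> carrier U" "v \<in> carrier V"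
  shows "pure_tensor U V (u \<oplus>\<^bsub>U\<^esub> u') v = pure_tensor U V u v \<otimes>\<^bsub>tensor_group U V\<^esub> pure_tensor U V u' v"
proof -
  have "frag_of (u \<oplus>\<^bsub>U\<^esub> u', v) - frag_of (u, v) - frag_of (u', v) \<in> tensor_kernel U V"
    using assms by (intro kernel_rel) (auto simp: tensor_rels_def)
  then show ?thesis
    using assms unfolding pure_tensor_def
    by (simp add: mult_tensor_group keys_frag_of tensor_class_eq_iff algebra_simps)
qed

lemma pure_add_right:
  assumes "u \<in> carrier U" "v' \<in> carrier V" "v \<in> carrier V"
  shows "pure_tensor U V u (v \<oplus>\<^bsub>V\<^esub> v') = pure_tensor U V u v \<otimes>\<^bsub>tensor_group U V\<^esub> pure_tensor U V u v'"
proof -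
  have "frag_of (u, v \<oplus>\<^bsub>V\<^esub> v') - frag_of (u, v) - frag_of (u, v') \<in> tensor_kernel U V"
    using assms by (intro kernel_rel) (auto simp: tensor_rels_def)
  then show ?thesis
    using assms unfolding pure_tensor_def
    by (simp add: mult_tensor_group keys_frag_of tensor_class_eq_iff algebra_simps)
qed

lemma pure_balanced:
  assumes "u \<in> carrier U" "v \<in> carrier V"
  shows "pure_tensor U V (c \<odot>\<^bsub>U\<^esub> u) v = pure_tensor U V u (c \<odot>\<^bsub>V\<^esub> v)"
proof -
  have "frag_of (c \<odot>\<^bsub>U\<^esub> u, v) - frag_of (u, c \<odot>\<^bsub>V\<^esub> v) \<in> tensor_kernel U V"
    using assms by (intro kernel_rel) (auto simp: tensor_rels_def)
  then show ?thesis
    unfolding pure_tensor_def by (simp add: tensor_class_eq_iff)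
qed

lemma pure_zero_left: "v \<in> carrier V \<Longrightarrow> pure_tensor U V \<zero>\<^bsub>U\<^esub> v = \<one>\<^bsub>tensor_group U V\<^esub>"
proof -
  assume v: "v \<in> carrier V"
  interpret comm_group "tensor_group U V" by (rule comm_group_tensor_group)
  show ?thesis
    using pure_add_left[of "\<zero>\<^bsub>U\<^esub>" "\<zero>\<^bsub>U\<^esub>" v] v by (simp add: r_cancel_one')
qed

lemma pure_minus_left:
  assumes "u \<in> carrier U" "v \<in> carrier V"
  shows "pure_tensor U V (\<ominus>\<^bsub>U\<^esub> u) v = inv\<^bsub>tensor_group U V\<^esub> pure_tensor U V u v"
proof -
  interpret comm_group "tensor_group U V" by (rule comm_group_tensor_group)
  show ?thesis
    by (rule inv_equality[symmetric])
      (use assms pure_add_left[of "\<ominus>\<^bsub>U\<^esub> u" u v] in \<open>auto simp: U.l_neg pure_zero_left\<close>)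
qed

text \<open>Zero and inverses fall under the pure case: zero is \<open>0 \<otimes> 0\<close>, and
  the inverse of \<open>u \<otimes> v\<close> is \<open>(- u) \<otimes> v\<close>.\<close>

lemma tensor_induct [consumes 1, case_names pure add]:
  assumes "t \<in> carrier (tensor_group U V)"
    and pure: "\<And>u v. \<lbrakk>u \<in> carrier U; v \<in> carrier V\<rbrakk> \<Longrightarrow> P (pure_tensor U V u v)"
    and add: "\<And>s t. \<lbrakk>s \<in> carrier (tensor_group U V); t \<in> carrier (tensor_group U V); P s; P t\<rbrakk>
      \<Longrightarrow> P (s \<otimes>\<^bsub>tensor_group U V\<^esub> t)"
  shows "P t"
proof -
  interpret comm_group "tensor_group U V" by (rule comm_group_tensor_group)
  obtain x where x: "Poly_Mapping.keys x \<subseteq> carrier U \<times> carrier V" "t = tensor_class U V x"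
    using assms(1) by (auto simp: carrier_tensor_group)
  \<comment> \<open>\<open>frag_induction\<close> builds differences while \<open>P\<close> is
    closed under sums only, so the claim is carried along for \<open>- x\<close> as well.\<close>
  have "x \<in> F \<and> P (tensor_class U V x) \<and> P (tensor_class U V (- x))"
    using x(1)
  proof (induction x rule: frag_induction)
    case zero
    then show ?case
      using pure[of "\<zero>\<^bsub>U\<^esub>" "\<zero>\<^bsub>V\<^esub>"] by (simp add: pure_zero_left tensor_class_zero)
  next
    case (one uv)
    then obtain u v where uv: "uv = (u, v)" "u \<in> carrier U" "v \<in> carrier V" by auto
    have "tensor_class U V (- frag_of (u, v)) = pure_tensor U V (\<ominus>\<^bsub>U\<^esub> u) v"
      using uv by (simp add: pure_minus_left inv_tensor_group keys_frag_of pure_tensor_def[of U V u])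
    then show ?case
      using uv pure by (simp add: keys_frag_of pure_tensor_def[symmetric])
  next
    case (diff a b)
    then have "a - b \<in> F" using keys_diff[of a b] by auto
    with diff add[of "tensor_class U V a" "tensor_class U V (- b)"]
      add[of "tensor_class U V (- a)" "tensor_class U V b"]
    show ?case by (simp add: mult_tensor_group)
  qed
  with x show ?thesis by simp
qed

text \<open>The target is any abelian group, because the tensor product is presented as a group in
  which scalars appear only through balancedness. This generality is used twice: for the additive
  group of an algebra, and for the complex numbers when coefficients are to be detected.\<close>

lemma tensor_lift:
  fixes G :: "('g, 'h) monoid_scheme" and f :: "'u \<Rightarrow> 'v \<Rightarrow> 'g"
  assumes "comm_group G"
    and cl: "\<And>u v. \<lbrakk>u \<in> carrier U; v \<in> carrier V\<rbrakk> \<Longrightarrow> f u v \<in> carrier G"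
    and left: "\<And>u u' v. \<lbrakk>u \<in> carrier U; u' \<in> carrier U; v \<in> carrier V\<rbrakk> \<Longrightarrow> f (u \<oplus>\<^bsub>U\<^esub> u') v = f u v \<otimes>\<^bsub>G\<^esub> f u' v"
    and right: "\<And>u v v'. \<lbrakk>u \<in> carrier U; v \<in> carrier V; v' \<in> carrier V\<rbrakk> \<Longrightarrow> f u (v \<oplus>\<^bsub>V\<^esub> v') = f u v \<otimes>\<^bsub>G\<^esub> f u v'"
    and bal: "\<And>c u v. \<lbrakk>u \<in> carrier U; v \<in> carrier V\<rbrakk> \<Longrightarrow> f (c \<odot>\<^bsub>U\<^esub> u) v = f u (c \<odot>\<^bsub>V\<^esub> v)"
  obtains h where "h \<in> hom (tensor_group U V) G"
    "\<And>u v. \<lbrakk>u \<in> carrier U; v \<in> carrier V\<rbrakk> \<Longrightarrow> h (pure_tensor U V u v) = f u v"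
proof -
  interpret G: comm_group G by fact
  have im: "case_prod f ` (carrier U \<times> carrier V) \<subseteq> carrier G" using cl by auto
  obtain h where h: "h \<in> hom (free_Abelian_group (carrier U \<times> carrier V)) G"
    and hf: "\<And>x. x \<in> carrier U \<times> carrier V \<Longrightarrow> h (frag_of x) = case_prod f x"
    by (rule G.free_Abelian_group_universal[OF im]) (rule that)
  interpret h: group_hom "free_Abelian_group (carrier U \<times> carrier V)" G h
    using h by (simp add: group_hom_def group_hom_axioms_def G.group_axioms)
  have hcl: "h x \<in> carrier G" if "x \<in> F" for x
    using h.hom_closed[of x] that by simp
  have hadd: "h (x + y) = h x \<otimes>\<^bsub>G\<^esub> h y" if "x \<in> F" "y \<in> F" for x y
    using h.hom_mult[of x y] that by simp
  have hneg: "h (- x) = inv\<^bsub>G\<^esub> (h x)" if "x \<in> F" for x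
    using h.hom_inv[of x] that by simp
  have hdiff: "h (x - y) = h x \<otimes>\<^bsub>G\<^esub> inv\<^bsub>G\<^esub> (h y)" if "x \<in> F" "y \<in> F" for x y
    using hadd[of x "- y"] hneg[of y] that by simp
  have F_diff: "x - y \<in> F" if "x \<in> F" "y \<in> F" for x y
    using keys_diff[of x y] that by auto
  have ker: "h x = \<one>\<^bsub>G\<^esub>" if "x \<in> tensor_kernel U V" for x
    using that
  proof (induction rule: kernel_induct)
    case zero
    then show ?case using h.hom_one by simp
  next
    case (rel x)
    have hF: "h (frag_of (u, v)) = f u v" "frag_of (u, v) \<in> F" "f u v \<in> carrier G"
      if "u \<in> carrier U" "v \<in> carrier V" for u v
      using that hf[of "(u, v)"] by (simp_all add: keys_frag_of cl)
    have cancel: "a \<otimes>\<^bsub>G\<^esub> b \<otimes>\<^bsub>G\<^esub> inv\<^bsub>G\<^esub> a \<otimes>\<^bsub>G\<^esub> inv\<^bsub>G\<^esub> b = \<one>\<^bsub>G\<^esub>" if "a \<in> carrier G" "b \<in> carrier G" for a b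
      using that G.r_inv[of "a \<otimes>\<^bsub>G\<^esub> b"] by (simp add: G.inv_mult G.m_assoc)
    from rel consider
      (1) u u' v where "x = frag_of (u \<oplus>\<^bsub>U\<^esub> u', v) - frag_of (u, v) - frag_of (u', v)"
        "u \<in> carrier U" "u' \<in> carrier U" "v \<in> carrier V"
      | (2) u v v' where "x = frag_of (u, v \<oplus>\<^bsub>V\<^esub> v') - frag_of (u, v) - frag_of (u, v')"
        "u \<in> carrier U" "v \<in> carrier V" "v' \<in> carrier V"
      | (3) c u v where "x = frag_of (c \<odot>\<^bsub>U\<^esub> u, v) - frag_of (u, c \<odot>\<^bsub>V\<^esub> v)" "u \<in> carrier U" "v \<in> carrier V"
      unfolding tensor_rels_def by blast
    then show ?case
    proof cases
      case 1
      then show ?thesis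
        using hF F_diff by (simp only: hdiff U.add.m_closed left cancel)
    next
      case 2
      then show ?thesis
        using hF F_diff by (simp only: hdiff V.add.m_closed right cancel)
    next
      case 3
      then show ?thesis
        using hF by (simp only: hdiff U.scale_closed V.scale_closed bal G.r_inv)
    qed
  next
    case (minus x)
    then show ?case using hneg[of x] kernel_subset by auto
  next
    case (add x y)
    then show ?case using hadd[of x y] kernel_subset by auto
  qed
  \<comment> \<open>By \<open>ker\<close> the map \<open>h\<close> is constant on classes, so the
    chosen representative does not matter.\<close>
  define k where "k t = h (SOME x. x \<in> F \<and> tensor_class U V x = t)" for t
  have k: "k (tensor_class U V x) = h x" if x: "x \<in> F" for x
  proof -
    define y where "y = (SOME y. y \<in> F \<and> tensor_class U V y = tensor_class U V x)"
    have y: "y \<in> F \<and> tensor_class U V y = tensor_class U V x"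
      unfolding y_def by (rule someI[of _ x]) (use x in simp)
    then have "h (y - x) = \<one>\<^bsub>G\<^esub>" using ker[of "y - x"] tensor_class_eq_iff[of y x] by simp
    then have eq: "h y \<otimes>\<^bsub>G\<^esub> inv\<^bsub>G\<^esub> (h x) = \<one>\<^bsub>G\<^esub>"
      using hdiff[of y x] y x by (simp only:)
    have "h y \<in> carrier G" "h x \<in> carrier G" using hcl y x by blast+
    then have "h y = h x" using G.inv_equality[OF eq] by simp
    then show ?thesis by (simp add: k_def y_def)
  qed
  show thesis
  proof
    show "k \<in> hom (tensor_group U V) G"
    proof (rule homI)
      show "k t \<in> carrier G" if "t \<in> carrier (tensor_group U V)" for t
        using that k hcl by (auto simp: carrier_tensor_group)
      fix s t assume "s \<in> carrier (tensor_group U V)" "t \<in> carrier (tensor_group U V)"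
      then obtain x y where xy: "x \<in> F" "y \<in> F" "s = tensor_class U V x" "t = tensor_class U V y"
        by (auto simp: carrier_tensor_group)
      then have "x + y \<in> F" using keys_add[of x y] by auto
      with xy show "k (s \<otimes>\<^bsub>tensor_group U V\<^esub> t) = k s \<otimes>\<^bsub>G\<^esub> k t"
        by (simp only: mult_tensor_group k hadd)
    qed
    show "k (pure_tensor U V u v) = f u v" if "u \<in> carrier U" "v \<in> carrier V" for u v
      using that hf[of "(u, v)"] by (simp add: pure_tensor_def k keys_frag_of)
  qed
qed

end



text \<open>With a generator as second argument, bilinearity of \<open>f\<close> and
  \<open>g\<close> turns each defining relation of the first tensor product into a defining relation
  of the target. Additivity then extends this to the whole kernel and to every
  \<open>q\<close>.\<close>

lemma frag_extend2_in_kernel_left: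
  assumes U: "tensor_spaces A B" "tensor_spaces X Y" "tensor_spaces U V"
    and f: "bilinear_map A X U f" and g: "bilinear_map B Y V g"
    and p: "p \<in> tensor_kernel A B" and q: "Poly_Mapping.keys q \<subseteq> carrier X \<times> carrier Y"
  shows "frag_extend2 f g p q \<in> tensor_kernel U V"
proof -
  interpret AB: tensor_spaces A B by fact
  interpret UV: tensor_spaces U V by fact
  note fD = bilinear_mapD[OF f] and gD = bilinear_mapD[OF g]
  show ?thesis
    using q
  proof (induction q rule: frag_induction)
    case (one xy)
    then obtain x y where xy: "xy = (x, y)" "x \<in> carrier X" "y \<in> carrier Y" by auto
    show ?case
      using p
    proof (induction p rule: AB.kernel_induct)
      case (rel r)
      then have "frag_extend2 f g r (frag_of (x, y)) \<in> tensor_rels U V"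
        unfolding tensor_rels_def using xy
        by (auto simp: frag_extend2_diff_left frag_extend2_of fD gD) (metis fD(1) gD(1))+
      then show ?case by (simp add: xy UV.kernel_rel)
    qed (auto simp: frag_extend2_minus_left frag_extend2_add_left intro: UV.kernel_zero UV.kernel_minus UV.kernel_add)
  qed (auto simp: frag_extend2_diff_right intro: UV.kernel_zero UV.kernel_diff)
qed

lemma frag_extend2_in_kernel_right:
  assumes U: "tensor_spaces A B" "tensor_spaces X Y" "tensor_spaces U V"
    and f: "bilinear_map A X U f" and g: "bilinear_map B Y V g"
    and p: "Poly_Mapping.keys p \<subseteq> carrier A \<times> carrier B" and q: "q \<in> tensor_kernel X Y"
  shows "frag_extend2 f g p q \<in> tensor_kernel U V"
proof -
  interpret XY: tensor_spaces X Y by fact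
  interpret UV: tensor_spaces U V by fact
  note fD = bilinear_mapD[OF f] and gD = bilinear_mapD[OF g]
  show ?thesis
    using p
  proof (induction p rule: frag_induction)
    case (one ab)
    then obtain a b where ab: "ab = (a, b)" "a \<in> carrier A" "b \<in> carrier B" by auto
    show ?case
      using q
    proof (induction q rule: XY.kernel_induct)
      case (rel r)
      then have "frag_extend2 f g (frag_of (a, b)) r \<in> tensor_rels U V"
        unfolding tensor_rels_def using ab
        by (auto simp: frag_extend2_diff_right frag_extend2_of fD gD) (metis fD(1) gD(1))+
      then show ?case by (simp add: ab UV.kernel_rel)
    qed (auto simp: frag_extend2_minus_right frag_extend2_add_right intro: UV.kernel_zero UV.kernel_minus UV.kernel_add)
  qed (auto simp: frag_extend2_diff_left intro: UV.kernel_zero UV.kernel_diff)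
qed

text \<open>This collapses the unions over representatives in \<open>tensor_algebra\<close> and
  \<open>tensor_module\<close> to a single class. Changing \<open>p\<close> to \<open>p'\<close> and
  \<open>q\<close> to \<open>q'\<close> changes the value by the extension at \<open>p' - p\<close>
  and \<open>q\<close> plus the extension at \<open>p'\<close> and \<open>q' - q\<close>, and both
  lie in the kernel.\<close>

lemma tensor_class_frag_extend2:
  assumes U: "tensor_spaces A B" "tensor_spaces X Y" "tensor_spaces U V"
    and f: "bilinear_map A X U f" and g: "bilinear_map B Y V g"
    and p: "Poly_Mapping.keys p \<subseteq> carrier A \<times> carrier B" and q: "Poly_Mapping.keys q \<subseteq> carrier X \<times> carrier Y"
  shows "(\<Union>p'\<in>tensor_class A B p. \<Union>q'\<in>tensor_class X Y q. tensor_class U V (frag_extend2 f g p' q')) =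
    tensor_class U V (frag_extend2 f g p q)"
proof -
  interpret AB: tensor_spaces A B by fact
  interpret XY: tensor_spaces X Y by fact
  interpret UV: tensor_spaces U V by fact
  have "tensor_class U V (frag_extend2 f g p' q') = tensor_class U V (frag_extend2 f g p q)"
    if p': "p' \<in> tensor_class A B p" and q': "q' \<in> tensor_class X Y q" for p' q'
  proof -
    have k: "p' - p \<in> tensor_kernel A B" "q' - q \<in> tensor_kernel X Y"
      using p' q' by (simp_all add: AB.mem_tensor_class XY.mem_tensor_class)
    have "Poly_Mapping.keys (p + (p' - p)) \<subseteq> carrier A \<times> carrier B"
      using p subsetD[OF AB.kernel_subset k(1)] keys_add[of p "p' - p"] by auto
    then have kp: "Poly_Mapping.keys p' \<subseteq> carrier A \<times> carrier B" by simp
    have "frag_extend2 f g (p' - p) q + frag_extend2 f g p' (q' - q) \<in> tensor_kernel U V"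
      using frag_extend2_in_kernel_left[OF U f g k(1) q] frag_extend2_in_kernel_right[OF U f g kp k(2)]
      by (rule UV.kernel_add)
    then show ?thesis
      by (simp add: UV.tensor_class_eq_iff frag_extend2_diff_left frag_extend2_diff_right)
  qed
  moreover have "p \<in> tensor_class A B p" "q \<in> tensor_class X Y q"
    by (simp_all add: AB.mem_tensor_class XY.mem_tensor_class AB.kernel_zero XY.kernel_zero)
  ultimately show ?thesis by blast
qed

section \<open>The tensor product of two complex algebras\<close>

locale tensor_algebras = A: complex_algebra A + B: complex_algebra B
  for A :: "(complex, 'a) module" and B :: "(complex, 'b) module"
begin

sublocale tensor_spaces A B by unfold_locales

abbreviation "T \<equiv> tensor_algebra A B"

lemma tensor_algebra_simps [simp]:
  "carrier T = carrier (tensor_group A B)" "add T = monoid.mult (tensor_group A B)"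
  "\<zero>\<^bsub>T\<^esub> = \<one>\<^bsub>tensor_group A B\<^esub>" "\<one>\<^bsub>T\<^esub> = pure_tensor A B \<one>\<^bsub>A\<^esub> \<one>\<^bsub>B\<^esub>"
  by (simp_all add: tensor_algebra_def)

lemma mult_class:
  assumes "p \<in> F" "q \<in> F"
  shows "tensor_class A B p \<otimes>\<^bsub>T\<^esub> tensor_class A B q =
    tensor_class A B (frag_extend2 (monoid.mult A) (monoid.mult B) p q)"
  using tensor_class_frag_extend2[OF tensor_spaces_axioms tensor_spaces_axioms tensor_spaces_axioms
      A.bilinear_mult B.bilinear_mult, of p q] assms
  by (simp add: tensor_algebra_def)

lemma mult_pure:
  assumes "a \<in> carrier A" "a' \<in> carrier A" "b \<in> carrier B" "b' \<in> carrier B"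
  shows "pure_tensor A B a b \<otimes>\<^bsub>T\<^esub> pure_tensor A B a' b' = pure_tensor A B (a \<otimes>\<^bsub>A\<^esub> a') (b \<otimes>\<^bsub>B\<^esub> b')"
  using assms unfolding pure_tensor_def by (simp add: mult_class keys_frag_of frag_extend2_of)

lemma ext_F: "\<lbrakk>p \<in> F; q \<in> F\<rbrakk> \<Longrightarrow> frag_extend2 (monoid.mult A) (monoid.mult B) p q \<in> F"
  by (simp, rule keys_frag_extend2) auto

lemma carrier_cases:
  assumes "t \<in> carrier (tensor_group A B)"
  obtains p where "p \<in> F" "t = tensor_class A B p"
  using assms by (auto simp: carrier_tensor_group)

lemma F_add: "\<lbrakk>p \<in> F; q \<in> F\<rbrakk> \<Longrightarrow> p + q \<in> F"
  using keys_add[of p q] by auto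

lemma mult_closed: "\<lbrakk>s \<in> carrier T; t \<in> carrier T\<rbrakk> \<Longrightarrow> s \<otimes>\<^bsub>T\<^esub> t \<in> carrier T"
  using ext_F by (auto elim!: carrier_cases simp: mult_class)

lemma ring_tensor_algebra: "ring T"
proof (rule ringI)
  show "abelian_group T"
    by (rule comm_group_abelian_groupI, rule comm_group_cong[OF comm_group_tensor_group]) simp_all
  show "monoid T"
  proof (rule monoidI)
    fix x y z assume "x \<in> carrier T" "y \<in> carrier T" "z \<in> carrier T"
    then obtain p q r where *: "p \<in> F" "q \<in> F" "r \<in> F"
      "x = tensor_class A B p" "y = tensor_class A B q" "z = tensor_class A B r"
      by (auto elim!: carrier_cases)
    have "frag_extend2 (monoid.mult A) (monoid.mult B) (frag_extend2 (monoid.mult A) (monoid.mult B) p q) r =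
      frag_extend2 (monoid.mult A) (monoid.mult B) p (frag_extend2 (monoid.mult A) (monoid.mult B) q r)"
      using * by (intro frag_extend2_assoc[of _ "carrier A" "carrier B" _ "carrier A" "carrier B" _ "carrier A" "carrier B"])
        (auto simp: A.m_assoc B.m_assoc)
    with * ext_F show "x \<otimes>\<^bsub>T\<^esub> y \<otimes>\<^bsub>T\<^esub> z = x \<otimes>\<^bsub>T\<^esub> (y \<otimes>\<^bsub>T\<^esub> z)"
      by (simp only: mult_class)
  next
    fix x assume x: "x \<in> carrier T"
    then obtain p where p: "p \<in> F" "x = tensor_class A B p" by (auto elim!: carrier_cases)
    have 1: "frag_of (\<one>\<^bsub>A\<^esub>, \<one>\<^bsub>B\<^esub>) \<in> F" by (simp add: keys_frag_of)
    have "Poly_Mapping.keys p \<subseteq> carrier A \<times> carrier B" using p by simp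
    then have "frag_extend2 (monoid.mult A) (monoid.mult B) (frag_of (\<one>\<^bsub>A\<^esub>, \<one>\<^bsub>B\<^esub>)) p = p \<and>
      frag_extend2 (monoid.mult A) (monoid.mult B) p (frag_of (\<one>\<^bsub>A\<^esub>, \<one>\<^bsub>B\<^esub>)) = p"
      by (induction p rule: frag_induction)
        (auto simp: frag_extend2_diff_left frag_extend2_diff_right frag_extend2_of)
    with p 1 show "\<one>\<^bsub>T\<^esub> \<otimes>\<^bsub>T\<^esub> x = x" "x \<otimes>\<^bsub>T\<^esub> \<one>\<^bsub>T\<^esub> = x"
      by (simp_all add: pure_tensor_def mult_class)
  qed (use mult_closed in auto)
  fix x y z assume "x \<in> carrier T" "y \<in> carrier T" "z \<in> carrier T"
  then obtain p q r where *: "p \<in> F" "q \<in> F" "r \<in> F"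
    "x = tensor_class A B p" "y = tensor_class A B q" "z = tensor_class A B r"
    by (auto elim!: carrier_cases)
  show "(x \<oplus>\<^bsub>T\<^esub> y) \<otimes>\<^bsub>T\<^esub> z = x \<otimes>\<^bsub>T\<^esub> z \<oplus>\<^bsub>T\<^esub> y \<otimes>\<^bsub>T\<^esub> z"
    using * ext_F F_add by (simp only: tensor_algebra_simps mult_tensor_group mult_class frag_extend2_add_left)
  show "z \<otimes>\<^bsub>T\<^esub> (x \<oplus>\<^bsub>T\<^esub> y) = z \<otimes>\<^bsub>T\<^esub> x \<oplus>\<^bsub>T\<^esub> z \<otimes>\<^bsub>T\<^esub> y"
    using * ext_F F_add by (simp only: tensor_algebra_simps mult_tensor_group mult_class frag_extend2_add_right)
qed

sublocale T: ring T by (rule ring_tensor_algebra)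

text \<open>Scaling becomes multiplication by one element, so the remaining axioms of a complex
  algebra reduce to ring axioms of \<open>T\<close> and to the centrality of that element.\<close>

lemma smult_tensor_algebra:
  assumes "t \<in> carrier T"
  shows "c \<odot>\<^bsub>T\<^esub> t = pure_tensor A B (c \<odot>\<^bsub>A\<^esub> \<one>\<^bsub>A\<^esub>) \<one>\<^bsub>B\<^esub> \<otimes>\<^bsub>T\<^esub> t"
proof -
  define e where "e = frag_of (c \<odot>\<^bsub>A\<^esub> \<one>\<^bsub>A\<^esub>, \<one>\<^bsub>B\<^esub>)"
  have e: "e \<in> F" by (simp add: e_def keys_frag_of)
  obtain q where q: "q \<in> F" "t = tensor_class A B q"
    using assms by (auto elim!: carrier_cases)
  have "frag_extend (\<lambda>(a, b). frag_of (c \<odot>\<^bsub>A\<^esub> a, b)) p = frag_extend2 (monoid.mult A) (monoid.mult B) e p"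
    if "p \<in> t" for p
  proof -
    have "p - q \<in> F" using that q(2) subsetD[OF kernel_subset] by (simp add: mem_tensor_class)
    then have "p \<in> F" using F_add[of "p - q" q] q by simp
    then show ?thesis
      unfolding e_def frag_extend2_of_left by (intro frag_extend_eq) (auto simp: A.scale_eq_mult[symmetric])
  qed
  moreover have "tensor_class A B (frag_extend2 (monoid.mult A) (monoid.mult B) e p) =
      tensor_class A B e \<otimes>\<^bsub>T\<^esub> t" if "p \<in> t" for p
  proof -
    have "p - q \<in> F" using that q(2) subsetD[OF kernel_subset] by (simp add: mem_tensor_class)
    then have "p \<in> F" using F_add[of "p - q" q] q by simp
    moreover have "tensor_class A B p = t"
      using that q by (simp add: tensor_class_eq_iff mem_tensor_class)
    ultimately show ?thesis using e by (simp add: mult_class[symmetric])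
  qed
  moreover have "q \<in> t" using q by (simp add: mem_tensor_class kernel_zero)
  ultimately show ?thesis
    by (auto simp: tensor_algebra_def pure_tensor_def e_def)
qed

lemma scalar_central:
  assumes "t \<in> carrier T"
  shows "pure_tensor A B (c \<odot>\<^bsub>A\<^esub> \<one>\<^bsub>A\<^esub>) \<one>\<^bsub>B\<^esub> \<otimes>\<^bsub>T\<^esub> t = t \<otimes>\<^bsub>T\<^esub> pure_tensor A B (c \<odot>\<^bsub>A\<^esub> \<one>\<^bsub>A\<^esub>) \<one>\<^bsub>B\<^esub>"
  using assms[simplified]
proof (induction t rule: tensor_induct)
  case (pure u v)
  then show ?case
    using A.scale_mult_left[of "\<one>\<^bsub>A\<^esub>" u c] A.scale_mult_right[of u "\<one>\<^bsub>A\<^esub>" c] by (simp add: mult_pure)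
next
  case (add s t)
  then show ?case
    using T.l_distr[of s t "pure_tensor A B (c \<odot>\<^bsub>A\<^esub> \<one>\<^bsub>A\<^esub>) \<one>\<^bsub>B\<^esub>"]
      T.r_distr[of s t "pure_tensor A B (c \<odot>\<^bsub>A\<^esub> \<one>\<^bsub>A\<^esub>) \<one>\<^bsub>B\<^esub>"] by simp
qed

lemma smult_pure: "\<lbrakk>a \<in> carrier A; b \<in> carrier B\<rbrakk> \<Longrightarrow> c \<odot>\<^bsub>T\<^esub> pure_tensor A B a b = pure_tensor A B (c \<odot>\<^bsub>A\<^esub> a) b"
  by (simp add: smult_tensor_algebra mult_pure A.scale_eq_mult[symmetric])

sublocale T: complex_algebra T
proof
  fix x assume x: "x \<in> carrier T"
  fix a b c
  let ?p = "\<lambda>c. pure_tensor A B (c \<odot>\<^bsub>A\<^esub> \<one>\<^bsub>A\<^esub>) \<one>\<^bsub>B\<^esub>"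
  have p: "?p c \<in> carrier T" for c by simp
  show "c \<odot>\<^bsub>T\<^esub> x \<in> carrier T" using x p mult_closed smult_tensor_algebra by metis
  have "?p (a + b) = ?p a \<oplus>\<^bsub>T\<^esub> ?p b" by (simp add: A.scale_add_left pure_add_left)
  then show "(a + b) \<odot>\<^bsub>T\<^esub> x = a \<odot>\<^bsub>T\<^esub> x \<oplus>\<^bsub>T\<^esub> b \<odot>\<^bsub>T\<^esub> x"
    using T.l_distr[OF p p x] x by (simp only: smult_tensor_algebra)
  have "?p (a * b) = ?p a \<otimes>\<^bsub>T\<^esub> ?p b" by (simp add: mult_pure A.scale_scale A.scale_eq_mult[symmetric])
  then show "(a * b) \<odot>\<^bsub>T\<^esub> x = a \<odot>\<^bsub>T\<^esub> (b \<odot>\<^bsub>T\<^esub> x)"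
    using T.m_assoc[OF p p x] x p mult_closed by (simp only: smult_tensor_algebra)
  have "?p 1 = \<one>\<^bsub>T\<^esub>" by simp
  then show "1 \<odot>\<^bsub>T\<^esub> x = x" using x T.l_one by (simp only: smult_tensor_algebra)
  fix y assume y: "y \<in> carrier T"
  show "c \<odot>\<^bsub>T\<^esub> (x \<oplus>\<^bsub>T\<^esub> y) = c \<odot>\<^bsub>T\<^esub> x \<oplus>\<^bsub>T\<^esub> c \<odot>\<^bsub>T\<^esub> y"
    using x y p T.add.m_closed T.r_distr by (simp only: smult_tensor_algebra)
  show "c \<odot>\<^bsub>T\<^esub> (x \<otimes>\<^bsub>T\<^esub> y) = (c \<odot>\<^bsub>T\<^esub> x) \<otimes>\<^bsub>T\<^esub> y"
    using x y p mult_closed T.m_assoc by (simp only: smult_tensor_algebra)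
  have "x \<otimes>\<^bsub>T\<^esub> (?p c \<otimes>\<^bsub>T\<^esub> y) = (?p c \<otimes>\<^bsub>T\<^esub> x) \<otimes>\<^bsub>T\<^esub> y"
    using x y p scalar_central[OF x, of c] T.m_assoc by metis
  then show "c \<odot>\<^bsub>T\<^esub> (x \<otimes>\<^bsub>T\<^esub> y) = x \<otimes>\<^bsub>T\<^esub> (c \<odot>\<^bsub>T\<^esub> y)"
    using x y p mult_closed T.m_assoc by (simp only: smult_tensor_algebra)
qed

section \<open>The external tensor product of two modules\<close>

lemma left_module_tensor_module:
  assumes "left_module A M" "left_module B N"
  shows "left_module T (tensor_module A B M N)"
    and "\<lbrakk>a \<in> carrier A; b \<in> carrier B; u \<in> carrier M; v \<in> carrier N\<rbrakk> \<Longrightarrow>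
      pure_tensor A B a b \<odot>\<^bsub>tensor_module A B M N\<^esub> pure_tensor (underlying_space A M) (underlying_space B N) u v =
      pure_tensor (underlying_space A M) (underlying_space B N) (a \<odot>\<^bsub>M\<^esub> u) (b \<odot>\<^bsub>N\<^esub> v)"
proof -
  interpret M: left_module A M by fact
  interpret N: left_module B N by fact
  define U V where "U = underlying_space A M" and "V = underlying_space B N"
  have sp: "complex_space U" "complex_space V" and bl: "bilinear_map A U U (smult M)" "bilinear_map B V V (smult N)"
    unfolding U_def V_def using assms A.complex_algebra_axioms B.complex_algebra_axioms
    by (auto intro: complex_space_underlying_space bilinear_smult_underlying)
  interpret UV: tensor_spaces U V using sp by (simp add: tensor_spaces_def)
  have cU: "carrier U = carrier M" "carrier V = carrier N"
    by (simp_all add: U_def V_def underlying_space_def restrict_scalars_def)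
  let ?W = "tensor_module A B M N"
  let ?e = "frag_extend2 (smult M) (smult N)"
  have W: "carrier ?W = carrier (tensor_group U V)" "add ?W = monoid.mult (tensor_group U V)"
    "\<zero>\<^bsub>?W\<^esub> = \<one>\<^bsub>tensor_group U V\<^esub>"
    by (simp_all add: tensor_module_def U_def V_def Let_def)
  have act: "tensor_class A B p \<odot>\<^bsub>?W\<^esub> tensor_class U V q = tensor_class U V (?e p q)"
    if "p \<in> F" "q \<in> UV.F" for p q
    using tensor_class_frag_extend2[OF tensor_spaces_axioms UV.tensor_spaces_axioms UV.tensor_spaces_axioms
      bl, of p q] that
    by (simp add: tensor_module_def U_def V_def Let_def)
  have eF: "?e p q \<in> UV.F" if "p \<in> F" "q \<in> UV.F" for p q
    using that keys_frag_extend2[of "carrier A" "carrier U" "smult M" "carrier U" "carrier B" "carrier V" "smult N" "carrier V" p q]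
    by (simp add: bilinear_mapD(1)[OF bl(1)] bilinear_mapD(1)[OF bl(2)])
  have Fadd: "p + q \<in> UV.F" if "p \<in> UV.F" "q \<in> UV.F" for p q
    using that keys_add[of p q] by auto
  have Wc: "\<exists>q. q \<in> UV.F \<and> t = tensor_class U V q" if "t \<in> carrier ?W" for t
    using that by (auto simp: W UV.carrier_tensor_group)
  have Tc: "\<exists>q. q \<in> F \<and> t = tensor_class A B q" if "t \<in> carrier T" for t
    using that by (auto simp: carrier_tensor_group)
  show "left_module T ?W"
  proof (rule left_module.intro[OF ring_tensor_algebra])
    show "abelian_group ?W"
      by (rule comm_group_abelian_groupI, rule comm_group_cong[OF UV.comm_group_tensor_group]) (simp_all add: W)
    show "left_module_axioms T ?W"
    proof
      fix x assume "x \<in> carrier ?W"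
      then obtain r where r: "r \<in> UV.F" "x = tensor_class U V r" using Wc[of x] by blast
      have "Poly_Mapping.keys r \<subseteq> carrier U \<times> carrier V" using r by simp
      then have "?e (frag_of (\<one>\<^bsub>A\<^esub>, \<one>\<^bsub>B\<^esub>)) r = r"
        by (induction r rule: frag_induction)
          (auto simp: frag_extend2_diff_right frag_extend2_of M.smult_one N.smult_one cU)
      then show "\<one>\<^bsub>T\<^esub> \<odot>\<^bsub>?W\<^esub> x = x"
        using r by (simp add: pure_tensor_def act keys_frag_of)
      fix a assume "a \<in> carrier T"
      then obtain p where p: "p \<in> F" "a = tensor_class A B p" using Tc[of a] by blast
      show "a \<odot>\<^bsub>?W\<^esub> x \<in> carrier ?W" using p r eF[of p r] by (simp add: act W)
      {
        fix b assume "b \<in> carrier T"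
        then obtain q where q: "q \<in> F" "b = tensor_class A B q" using Tc[of b] by blast
        show "(a \<oplus>\<^bsub>T\<^esub> b) \<odot>\<^bsub>?W\<^esub> x = a \<odot>\<^bsub>?W\<^esub> x \<oplus>\<^bsub>?W\<^esub> b \<odot>\<^bsub>?W\<^esub> x"
          using p q r eF F_add by (simp only: tensor_algebra_simps W mult_tensor_group UV.mult_tensor_group act frag_extend2_add_left)
        have "?e (frag_extend2 (monoid.mult A) (monoid.mult B) p q) r = ?e p (?e q r)"
          using p q r by (intro frag_extend2_assoc[of _ "carrier A" "carrier B" _ "carrier A" "carrier B" _ "carrier U" "carrier V"])
            (auto simp: M.smult_assoc N.smult_assoc cU)
        then show "(a \<otimes>\<^bsub>T\<^esub> b) \<odot>\<^bsub>?W\<^esub> x = a \<odot>\<^bsub>?W\<^esub> (b \<odot>\<^bsub>?W\<^esub> x)"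
          using p q r eF ext_F by (simp only: mult_class act)
      }
      fix y assume "y \<in> carrier ?W"
      then obtain s where s: "s \<in> UV.F" "y = tensor_class U V s" using Wc[of y] by blast
      show "a \<odot>\<^bsub>?W\<^esub> (x \<oplus>\<^bsub>?W\<^esub> y) = a \<odot>\<^bsub>?W\<^esub> x \<oplus>\<^bsub>?W\<^esub> a \<odot>\<^bsub>?W\<^esub> y"
        using p r s eF Fadd by (simp only: W UV.mult_tensor_group act frag_extend2_add_right)
    qed
  qed
  show "pure_tensor A B a b \<odot>\<^bsub>?W\<^esub> pure_tensor (underlying_space A M) (underlying_space B N) u v =
      pure_tensor (underlying_space A M) (underlying_space B N) (a \<odot>\<^bsub>M\<^esub> u) (b \<odot>\<^bsub>N\<^esub> v)"
    if "a \<in> carrier A" "b \<in> carrier B" "u \<in> carrier M" "v \<in> carrier N"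
    using that unfolding pure_tensor_def U_def[symmetric] V_def[symmetric]
    by (simp add: act keys_frag_of cU frag_extend2_of)
qed

end

section \<open>Finitely supported functions\<close>

lemma lookup_scale [simp]: "Poly_Mapping.lookup (scale c v) x = c * Poly_Mapping.lookup v x"
  by (simp add: scale_def Poly_Mapping.map.rep_eq when_def)

lemma scale_single [simp]: "scale c (Poly_Mapping.single x a) = Poly_Mapping.single x (c * a)"
  by (rule poly_mapping_eqI) (simp add: lookup_single when_def)

lemma scale_add: "scale c (v + w) = scale c v + scale c w"
  by (rule poly_mapping_eqI) (simp add: lookup_add algebra_simps)

lemma scale_plus: "scale (a + b) v = scale a v + scale b v"
  by (rule poly_mapping_eqI) (simp add: lookup_add algebra_simps)

lemma scale_mult: "scale (a * b) v = scale a (scale b v)"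
  by (rule poly_mapping_eqI) (simp add: algebra_simps)

lemma scale_1 [simp]: "scale 1 v = v"
  by (rule poly_mapping_eqI) simp

lemma scale_0 [simp]: "scale 0 v = 0" "scale c 0 = 0"
  by (rule poly_mapping_eqI, simp)+

lemma scale_sum: "scale c (\<Sum>x\<in>X. f x) = (\<Sum>x\<in>X. scale c (f x))"
  by (rule poly_mapping_eqI) (simp add: lookup_sum sum_distrib_left)

lemma keys_scale: "Poly_Mapping.keys (scale c v) \<subseteq> Poly_Mapping.keys v"
  by (auto simp: in_keys_iff)

lemma keys_add_subset: "\<lbrakk>Poly_Mapping.keys p \<subseteq> S; Poly_Mapping.keys q \<subseteq> S\<rbrakk> \<Longrightarrow> Poly_Mapping.keys (p + q) \<subseteq> S"
  using keys_add[of p q] by auto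

text \<open>\<open>p\<close> is the sum of its monomials over \<open>keys p\<close>, and every
  partial sum of it is still supported in \<open>S\<close>.\<close>

lemma finsupp_induct [consumes 1, case_names zero single add]:
  fixes p :: "'x \<Rightarrow>\<^sub>0 complex"
  assumes p: "Poly_Mapping.keys p \<subseteq> S" and zero: "P 0"
    and single: "\<And>x a. x \<in> S \<Longrightarrow> P (Poly_Mapping.single x a)"
    and add: "\<And>p q. \<lbrakk>Poly_Mapping.keys p \<subseteq> S; Poly_Mapping.keys q \<subseteq> S; P p; P q\<rbrakk> \<Longrightarrow> P (p + q)"
  shows "P p"
proof -
  let ?s = "\<lambda>K. \<Sum>x\<in>K. Poly_Mapping.single x (Poly_Mapping.lookup p x)"
  have "Poly_Mapping.keys (?s K) \<subseteq> S \<and> P (?s K)" if "finite K" "K \<subseteq> S" for K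
    using that
  proof (induction K rule: finite_induct)
    case empty
    then show ?case using zero by simp
  next
    case (insert x K)
    have "Poly_Mapping.keys (Poly_Mapping.single x (Poly_Mapping.lookup p x)) \<subseteq> S"
      using insert by simp
    then show ?case
      using insert single[of x] add[of "Poly_Mapping.single x (Poly_Mapping.lookup p x)" "?s K"]
        keys_add_subset[of "Poly_Mapping.single x (Poly_Mapping.lookup p x)" S "?s K"]
      by simp
  qed
  moreover have "?s (Poly_Mapping.keys p) = p"
    by (rule poly_mapping_eqI) (simp add: lookup_sum lookup_single when_def in_keys_iff)
  ultimately show ?thesis
    using p by (metis finite_keys)
qed

lemma linear_extend_superset:
  assumes "finite X" "Poly_Mapping.keys v \<subseteq> X"
  shows "linear_extend f v = (\<Sum>x\<in>X. scale (Poly_Mapping.lookup v x) (f x))"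
  unfolding linear_extend_def
  by (rule sum.mono_neutral_left) (use assms in \<open>auto simp: in_keys_iff\<close>)

lemma linear_extend_add: "linear_extend f (v + w) = linear_extend f v + linear_extend f w"
proof -
  let ?X = "Poly_Mapping.keys v \<union> Poly_Mapping.keys w"
  have "finite ?X" by simp
  then show ?thesis
    using keys_add[of v w]
    by (simp add: linear_extend_superset[of ?X] lookup_add scale_plus sum.distrib)
qed

lemma linear_extend_scale: "linear_extend f (scale c v) = scale c (linear_extend f v)"
  using keys_scale[of c v]
  by (simp add: linear_extend_superset[of "Poly_Mapping.keys v"] scale_mult scale_sum)

lemma linear_extend_single [simp]: "linear_extend f (Poly_Mapping.single x a) = scale a (f x)"
  by (simp add: linear_extend_superset[of "{x}"])

lemma linear_extend_0 [simp]: "linear_extend f 0 = 0"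
  by (simp add: linear_extend_def)

lemma linear_extend_fun_add: "linear_extend (\<lambda>x. f x + g x) v = linear_extend f v + linear_extend g v"
  by (simp add: linear_extend_def scale_add sum.distrib)

lemma linear_extend_fun_0 [simp]: "linear_extend (\<lambda>x. 0) v = 0"
  by (simp add: linear_extend_def)

lemma keys_linear_extend:
  assumes "Poly_Mapping.keys v \<subseteq> S" "\<And>x. x \<in> S \<Longrightarrow> Poly_Mapping.keys (f x) \<subseteq> Z"
  shows "Poly_Mapping.keys (linear_extend f v) \<subseteq> Z"
  using assms(1)
proof (induction v rule: finsupp_induct)
  case (single x a)
  then show ?case using assms(2)[of x] keys_scale[of a "f x"] by auto
next
  case (add p q)
  then show ?case by (simp add: linear_extend_add keys_add_subset)
qed simp

text \<open>The value \<open>k x\<close> takes the coefficient as an argument instead of being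
  scaled by it, so an abelian group suffices as target. The map \<open>part\<close> below needs
  this: the scalars of its target are elements of a tensor algebra, not complex numbers.\<close>

definition additive_extend :: "('g, 'h) ring_scheme \<Rightarrow> ('x \<Rightarrow> complex \<Rightarrow> 'g) \<Rightarrow> ('x \<Rightarrow>\<^sub>0 complex) \<Rightarrow> 'g"
  where "additive_extend G k p = finsum G (\<lambda>x. k x (Poly_Mapping.lookup p x)) (Poly_Mapping.keys p)"

locale additive_family = abelian_group G for G (structure) +
  fixes k :: "'x \<Rightarrow> complex \<Rightarrow> 'a" and S :: "'x set"
  assumes k_closed: "x \<in> S \<Longrightarrow> k x a \<in> carrier G"
    and k_add: "x \<in> S \<Longrightarrow> k x (a + b) = k x a \<oplus> k x b"
begin

lemma k_zero: "x \<in> S \<Longrightarrow> k x 0 = \<zero>"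
  using k_add[of x 0 0] k_closed[of x 0] by (metis add.r_cancel_one' add_0)

lemma additive_extend_superset:
  assumes "finite X" "Poly_Mapping.keys p \<subseteq> X" "X \<subseteq> S"
  shows "additive_extend G k p = (\<Oplus>x\<in>X. k x (Poly_Mapping.lookup p x))"
  unfolding additive_extend_def
  by (rule add.finprod_mono_neutral_cong_left) (use assms in \<open>auto simp: in_keys_iff k_zero k_closed subset_iff\<close>)

lemma additive_extend_closed: "Poly_Mapping.keys p \<subseteq> S \<Longrightarrow> additive_extend G k p \<in> carrier G"
  unfolding additive_extend_def by (rule finsum_closed) (auto simp: k_closed subset_iff)

lemma additive_extend_add:
  assumes "Poly_Mapping.keys p \<subseteq> S" "Poly_Mapping.keys q \<subseteq> S"
  shows "additive_extend G k (p + q) = additive_extend G k p \<oplus> additive_extend G k q"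
proof -
  let ?X = "Poly_Mapping.keys p \<union> Poly_Mapping.keys q"
  have X: "finite ?X" "?X \<subseteq> S" using assms by auto
  have "(\<Oplus>x\<in>?X. k x (Poly_Mapping.lookup (p + q) x)) =
      (\<Oplus>x\<in>?X. k x (Poly_Mapping.lookup p x) \<oplus> k x (Poly_Mapping.lookup q x))"
    by (rule finsum_cong') (use X in \<open>auto simp: k_add lookup_add k_closed subset_iff\<close>)
  also have "\<dots> = (\<Oplus>x\<in>?X. k x (Poly_Mapping.lookup p x)) \<oplus> (\<Oplus>x\<in>?X. k x (Poly_Mapping.lookup q x))"
    by (rule finsum_addf) (use X in \<open>auto simp: k_closed subset_iff\<close>)
  finally show ?thesis
    using X keys_add[of p q] by (simp add: additive_extend_superset[of ?X])
qed

lemma additive_extend_single: "x \<in> S \<Longrightarrow> additive_extend G k (Poly_Mapping.single x a) = k x a"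
  by (simp add: additive_extend_superset[of "{x}"] k_closed)

lemma additive_extend_0: "additive_extend G k 0 = \<zero>"
  by (simp add: additive_extend_def)

end


section \<open>Free algebras and 0-Hecke algebras\<close>

lemma keys_mult_lists:
  fixes p q :: "'a list \<Rightarrow>\<^sub>0 complex"
  assumes "Poly_Mapping.keys p \<subseteq> lists S" "Poly_Mapping.keys q \<subseteq> lists S"
  shows "Poly_Mapping.keys (p * q) \<subseteq> lists S"
  using keys_mult[of p q] assms by (fastforce simp: plus_list_def)

lemma scale_conv_mult: "scale c p = Poly_Mapping.single 0 c * p"
  for p :: "'a list \<Rightarrow>\<^sub>0 complex"
  by (simp add: scale_def mult_map_scale_conv_mult)

lemma scale_conv_mult': "scale c p = p * Poly_Mapping.single 0 c"
  for p :: "'a list \<Rightarrow>\<^sub>0 complex"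
proof -
  have "Poly_Mapping.keys p \<subseteq> UNIV" by simp
  then show ?thesis
    by (induction p rule: finsupp_induct) (auto simp: scale_add distrib_right mult_single mult.commute)
qed

lemma free_algebra_simps [simp]:
  "carrier (free_algebra S) = {p. Poly_Mapping.keys p \<subseteq> lists S}"
  "monoid.mult (free_algebra S) = (*)" "\<one>\<^bsub>free_algebra S\<^esub> = 1"
  "\<zero>\<^bsub>free_algebra S\<^esub> = 0" "add (free_algebra S) = (+)" "smult (free_algebra S) = scale"
  by (simp_all add: free_algebra_def)

lemma complex_algebra_free_algebra: "complex_algebra (free_algebra S)"
proof -
  have "abelian_group (free_algebra S)"
    by (rule abelian_groupI)
      (auto simp: keys_add_subset algebra_simps intro!: exI[of _ "- _"])
  then have r: "ring (free_algebra S)"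
    by (intro ringI monoidI) (auto simp: keys_mult_lists algebra_simps zero_list_def)
  then interpret ring "free_algebra S" .
  show ?thesis
    by unfold_locales
      (auto simp: scale_add scale_plus scale_mult dest: subsetD[OF keys_scale],
        auto simp: scale_conv_mult mult.assoc,
        auto simp: scale_conv_mult[symmetric] scale_conv_mult' mult.assoc)
qed

text \<open>\<open>hecke m\<close> is the record of a quotient ring extended by a scaling; the ring
  axioms pass to the extended record because the ring fields agree.\<close>

lemma ring_cong:
  assumes "ring R" "carrier S = carrier R" "monoid.mult S = monoid.mult R" "\<one>\<^bsub>S\<^esub> = \<one>\<^bsub>R\<^esub>"
    "add S = add R" "\<zero>\<^bsub>S\<^esub> = \<zero>\<^bsub>R\<^esub>"
  shows "ring S"
proof -
  interpret ring R by fact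
  have "\<exists>y\<in>carrier R. y \<oplus>\<^bsub>R\<^esub> x = \<zero>\<^bsub>R\<^esub>" if "x \<in> carrier R" for x
    using that by (auto intro!: bexI[of _ "\<ominus>\<^bsub>R\<^esub> x"] l_neg)
  then show ?thesis
    by (intro ringI abelian_groupI monoidI)
      (auto simp: assms(2-6) a_assoc m_assoc l_distr r_distr intro: a_comm)
qed

section \<open>The 0-Hecke algebra as a quotient of the free algebra\<close>

locale hecke_algebra =
  fixes m :: nat
begin

sublocale FA: complex_algebra "free_algebra {1..<m}"
  by (rule complex_algebra_free_algebra)

abbreviation "C \<equiv> carrier (free_algebra {1..<m})"

definition cls :: "(nat list \<Rightarrow>\<^sub>0 complex) \<Rightarrow> (nat list \<Rightarrow>\<^sub>0 complex) set"
  where "cls p = hecke_ideal m +>\<^bsub>free_algebra {1..<m}\<^esub> p"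

lemma gen_closed: "i \<in> {1..<m} \<Longrightarrow> gen i \<in> C"
  by (auto simp: gen_def)

lemma hecke_rels_subset: "hecke_rels m \<subseteq> C"
proof -
  have minus: "x - y \<in> C" if "x \<in> C" "y \<in> C" for x y
    using that keys_diff[of x y] keys_add_subset[of x "lists {1..<m}" "- y"] by simp
  have mult: "x * y \<in> C" if "x \<in> C" "y \<in> C" for x y
    using that FA.m_closed[of x y] by simp
  show ?thesis
    unfolding hecke_rels_def using gen_closed by (auto simp del: free_algebra_simps One_nat_def intro!: minus mult)
qed

sublocale I: ideal "hecke_ideal m" "free_algebra {1..<m}"
  unfolding hecke_ideal_def by (rule FA.genideal_ideal[OF hecke_rels_subset])

lemma rel_in_ideal: "r \<in> hecke_rels m \<Longrightarrow> r \<in> hecke_ideal m"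
  unfolding hecke_ideal_def using FA.genideal_self[OF hecke_rels_subset] by auto

lemma cls_eq: "cls p = (\<lambda>k. k + p) ` hecke_ideal m"
  by (auto simp: cls_def a_r_coset_def')

lemma ideal_diff: "\<lbrakk>x \<in> hecke_ideal m; y \<in> hecke_ideal m\<rbrakk> \<Longrightarrow> x - y \<in> hecke_ideal m"
proof -
  assume *: "x \<in> hecke_ideal m" "y \<in> hecke_ideal m"
  then have "y \<in> C" by (rule_tac I.a_Hcarr)
  then have "\<ominus>\<^bsub>free_algebra {1..<m}\<^esub> y = - y"
    by (intro FA.minus_equality) simp_all
  then show ?thesis
    using I.a_inv_closed[OF *(2)] I.a_closed[OF *(1), of "- y"] by simp
qed

lemma mem_cls: "q \<in> cls p \<longleftrightarrow> q - p \<in> hecke_ideal m"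
  by (auto simp: cls_eq intro: image_eqI[of _ _ "q - p"])

lemma cls_eq_iff: "cls p = cls q \<longleftrightarrow> p - q \<in> hecke_ideal m"
proof
  assume "cls p = cls q"
  then show "p - q \<in> hecke_ideal m"
    using mem_cls[of p p] mem_cls[of p q] I.zero_closed by simp
next
  assume k: "p - q \<in> hecke_ideal m"
  have "z - p \<in> hecke_ideal m \<longleftrightarrow> z - q \<in> hecke_ideal m" for z
    using ideal_diff[OF _ k, of "z - q"] I.a_closed[OF _ k, of "z - p"] by (auto simp: algebra_simps)
  then show "cls p = cls q" by (auto simp: mem_cls)
qed

lemma hecke_fields:
  "carrier (hecke m) = carrier (free_algebra {1..<m} Quot hecke_ideal m)"
  "monoid.mult (hecke m) = monoid.mult (free_algebra {1..<m} Quot hecke_ideal m)"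
  "\<one>\<^bsub>hecke m\<^esub> = \<one>\<^bsub>free_algebra {1..<m} Quot hecke_ideal m\<^esub>"
  "\<zero>\<^bsub>hecke m\<^esub> = \<zero>\<^bsub>free_algebra {1..<m} Quot hecke_ideal m\<^esub>"
  "add (hecke m) = add (free_algebra {1..<m} Quot hecke_ideal m)"
  "smult (hecke m) = (\<lambda>c P. \<Union>x\<in>P. cls (scale c x))"
  by (simp_all add: hecke_def quotient_algebra_def ring.defs module.defs cls_def FactRing_def)

lemma carrier_hecke: "carrier (hecke m) = cls ` C"
  by (auto simp: hecke_fields FactRing_def A_RCOSETS_def' cls_def)

lemma hecke_cases:
  assumes "P \<in> carrier (hecke m)"
  obtains p where "p \<in> C" "P = cls p"
  using assms by (auto simp: carrier_hecke)

lemma cls_ring_hom: "cls \<in> ring_hom (free_algebra {1..<m}) (hecke m)"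
  using I.rcos_ring_hom unfolding ring_hom_def cls_def hecke_fields by simp

lemma cls_closed: "p \<in> C \<Longrightarrow> cls p \<in> carrier (hecke m)"
  by (simp add: carrier_hecke)

lemma cls_hom:
  shows "\<lbrakk>p \<in> C; q \<in> C\<rbrakk> \<Longrightarrow> cls p \<otimes>\<^bsub>hecke m\<^esub> cls q = cls (p * q)"
    and "\<lbrakk>p \<in> C; q \<in> C\<rbrakk> \<Longrightarrow> cls p \<oplus>\<^bsub>hecke m\<^esub> cls q = cls (p + q)"
    and "\<one>\<^bsub>hecke m\<^esub> = cls 1"
    and "\<zero>\<^bsub>hecke m\<^esub> = cls 0"
proof -
  show "\<zero>\<^bsub>hecke m\<^esub> = cls 0" by (simp add: hecke_fields FactRing_def cls_eq)
qed (use ring_hom_mult[OF cls_ring_hom] ring_hom_add[OF cls_ring_hom] ring_hom_one[OF cls_ring_hom] in auto)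

lemma ring_hecke: "ring (hecke m)"
  by (rule ring_cong[OF I.quotient_is_ring]) (simp_all add: hecke_fields)

lemma scale_C: "p \<in> C \<Longrightarrow> scale c p \<in> C"
  using FA.scale_closed[of p c] by simp

text \<open>Scaling by \<open>c\<close> is multiplication by \<open>c\<close> times the empty word,
  which the ideal absorbs. So all representatives give the same class, and the union in
  \<open>quotient_algebra\<close> collapses.\<close>

lemma cls_smult: "c \<odot>\<^bsub>hecke m\<^esub> cls p = cls (scale c p)" if "p \<in> C"
proof -
  have "cls (scale c x) = cls (scale c p)" if "x \<in> cls p" for x
  proof -
    have "Poly_Mapping.single 0 c \<in> C" by (simp add: zero_list_def)
    then have "Poly_Mapping.single 0 c * (x - p) \<in> hecke_ideal m"
      using that I.I_l_closed[of "x - p" "Poly_Mapping.single 0 c"] by (simp add: mem_cls)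
    then show ?thesis
      by (simp add: cls_eq_iff scale_conv_mult right_diff_distrib)
  qed
  moreover have "p \<in> cls p" using I.zero_closed by (simp add: mem_cls)
  ultimately have "(\<Union>x\<in>cls p. cls (scale c x)) = cls (scale c p)" by blast
  then show ?thesis by (simp add: hecke_fields)
qed

sublocale H: complex_algebra "hecke m"
proof (rule complex_algebra.intro[OF ring_hecke])
  interpret ring "hecke m" by (rule ring_hecke)
  have add: "p + q \<in> C" "p * q \<in> C" if "p \<in> C" "q \<in> C" for p q
    using that FA.a_closed[of p q] FA.m_closed[of p q] by simp_all
  show "complex_space (hecke m)"
  proof
    fix x assume "x \<in> carrier (hecke m)"
    then obtain p where p: "p \<in> C" "x = cls p" by (rule hecke_cases)
    fix c a b
    show "c \<odot>\<^bsub>hecke m\<^esub> x \<in> carrier (hecke m)" using p scale_C by (simp add: cls_smult cls_closed del: free_algebra_simps)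
    show "(a + b) \<odot>\<^bsub>hecke m\<^esub> x = a \<odot>\<^bsub>hecke m\<^esub> x \<oplus>\<^bsub>hecke m\<^esub> b \<odot>\<^bsub>hecke m\<^esub> x"
      using p scale_C by (simp add: cls_smult cls_hom scale_plus del: free_algebra_simps)
    show "(a * b) \<odot>\<^bsub>hecke m\<^esub> x = a \<odot>\<^bsub>hecke m\<^esub> (b \<odot>\<^bsub>hecke m\<^esub> x)"
      using p scale_C by (simp add: cls_smult scale_mult del: free_algebra_simps)
    show "1 \<odot>\<^bsub>hecke m\<^esub> x = x" using p by (simp add: cls_smult del: free_algebra_simps)
    fix y assume "y \<in> carrier (hecke m)"
    then obtain q where q: "q \<in> C" "y = cls q" by (rule hecke_cases)
    show "c \<odot>\<^bsub>hecke m\<^esub> (x \<oplus>\<^bsub>hecke m\<^esub> y) = c \<odot>\<^bsub>hecke m\<^esub> x \<oplus>\<^bsub>hecke m\<^esub> c \<odot>\<^bsub>hecke m\<^esub> y"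
      using p q scale_C add by (simp add: cls_smult cls_hom scale_add del: free_algebra_simps)
  qed
  show "complex_algebra_axioms (hecke m)"
  proof
    fix x y c assume "x \<in> carrier (hecke m)" "y \<in> carrier (hecke m)"
    then obtain p q where p: "p \<in> C" "x = cls p" and q: "q \<in> C" "y = cls q" by (meson hecke_cases)
    have 1: "scale c (p * q) = scale c p * q" by (simp add: scale_conv_mult mult.assoc)
    have 2: "scale c (p * q) = p * scale c q" by (simp add: scale_conv_mult' mult.assoc)
    show "c \<odot>\<^bsub>hecke m\<^esub> (x \<otimes>\<^bsub>hecke m\<^esub> y) = (c \<odot>\<^bsub>hecke m\<^esub> x) \<otimes>\<^bsub>hecke m\<^esub> y"
      using p q scale_C add by (simp add: cls_smult cls_hom 1 del: free_algebra_simps)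
    show "c \<odot>\<^bsub>hecke m\<^esub> (x \<otimes>\<^bsub>hecke m\<^esub> y) = x \<otimes>\<^bsub>hecke m\<^esub> (c \<odot>\<^bsub>hecke m\<^esub> y)"
      using p q scale_C add by (simp add: cls_smult cls_hom 2 del: free_algebra_simps)
  qed
qed

lemma hecke_gen_eq: "hecke_gen m i = cls (gen i)"
  by (simp add: hecke_gen_def cls_def)

lemma hecke_gen_closed: "i \<in> {1..<m} \<Longrightarrow> hecke_gen m i \<in> carrier (hecke m)"
  unfolding hecke_gen_eq using gen_closed cls_closed by blast

lemma hecke_gen_rels:
  shows "i \<in> {1..<m} \<Longrightarrow> hecke_gen m i \<otimes>\<^bsub>hecke m\<^esub> hecke_gen m i = hecke_gen m i"
    and "\<lbrakk>i \<in> {1..<m}; i + 1 \<in> {1..<m}\<rbrakk> \<Longrightarrow>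
      hecke_gen m i \<otimes>\<^bsub>hecke m\<^esub> hecke_gen m (i + 1) \<otimes>\<^bsub>hecke m\<^esub> hecke_gen m i =
      hecke_gen m (i + 1) \<otimes>\<^bsub>hecke m\<^esub> hecke_gen m i \<otimes>\<^bsub>hecke m\<^esub> hecke_gen m (i + 1)"
    and "\<lbrakk>i \<in> {1..<m}; j \<in> {1..<m}; \<bar>int i - int j\<bar> \<ge> 2\<rbrakk> \<Longrightarrow>
      hecke_gen m i \<otimes>\<^bsub>hecke m\<^esub> hecke_gen m j = hecke_gen m j \<otimes>\<^bsub>hecke m\<^esub> hecke_gen m i"
proof -
  have mult: "p * q \<in> C" if "p \<in> C" "q \<in> C" for p q
    using that FA.m_closed[of p q] by simp
  show "hecke_gen m i \<otimes>\<^bsub>hecke m\<^esub> hecke_gen m i = hecke_gen m i" if "i \<in> {1..<m}"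
  proof -
    have "gen i * gen i - gen i \<in> hecke_ideal m"
      using that by (intro rel_in_ideal) (auto simp: hecke_rels_def)
    then show ?thesis using gen_closed[OF that] by (simp only: hecke_gen_eq cls_hom cls_eq_iff)
  qed
  show "hecke_gen m i \<otimes>\<^bsub>hecke m\<^esub> hecke_gen m (i + 1) \<otimes>\<^bsub>hecke m\<^esub> hecke_gen m i =
      hecke_gen m (i + 1) \<otimes>\<^bsub>hecke m\<^esub> hecke_gen m i \<otimes>\<^bsub>hecke m\<^esub> hecke_gen m (i + 1)"
    if "i \<in> {1..<m}" "i + 1 \<in> {1..<m}"
  proof -
    have "gen i * gen (i + 1) * gen i - gen (i + 1) * gen i * gen (i + 1) \<in> hecke_ideal m"
      using that by (intro rel_in_ideal) (auto simp: hecke_rels_def)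
    then show ?thesis using gen_closed[OF that(1)] gen_closed[OF that(2)] mult
      by (simp only: hecke_gen_eq cls_hom cls_eq_iff)
  qed
  show "hecke_gen m i \<otimes>\<^bsub>hecke m\<^esub> hecke_gen m j = hecke_gen m j \<otimes>\<^bsub>hecke m\<^esub> hecke_gen m i"
    if "i \<in> {1..<m}" "j \<in> {1..<m}" "\<bar>int i - int j\<bar> \<ge> 2"
  proof -
    have "gen i * gen j - gen j * gen i \<in> hecke_ideal m"
      using that by (intro rel_in_ideal) (auto simp: hecke_rels_def)
    then show ?thesis using gen_closed[OF that(1)] gen_closed[OF that(2)] mult
      by (simp only: hecke_gen_eq cls_hom cls_eq_iff)
  qed
qed

text \<open>\<open>generate_ring\<close> closes under ring operations only, so the scalar multiples
  of the unit have to be listed among the generators. A monomial with coefficient \<open>a\<close>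
  is the product of its letters followed by \<open>a\<close> times the unit.\<close>

lemma hecke_generated:
  "carrier (hecke m) = generate_ring (hecke m) (hecke_gen m ` {1..<m} \<union> {c \<odot>\<^bsub>hecke m\<^esub> \<one>\<^bsub>hecke m\<^esub> | c. True})"
  (is "_ = generate_ring _ ?S")
proof
  have S: "?S \<subseteq> carrier (hecke m)" using hecke_gen_closed by auto
  then show "generate_ring (hecke m) ?S \<subseteq> carrier (hecke m)" by (rule H.generate_ring_incl)
  have monomial: "cls (Poly_Mapping.single w a) \<in> generate_ring (hecke m) ?S" if "w \<in> lists {1..<m}" for w a
    using that
  proof (induction w)
    case Nil
    have "cls (Poly_Mapping.single [] a) = a \<odot>\<^bsub>hecke m\<^esub> \<one>\<^bsub>hecke m\<^esub>"
      by (simp add: cls_hom cls_smult zero_list_def flip: single_one)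
    then show ?case by (auto intro!: generate_ring.incl)
  next
    case (Cons i w)
    have "Poly_Mapping.single (i # w) a = gen i * Poly_Mapping.single w a"
      by (simp add: gen_def mult_single plus_list_def)
    moreover have "gen i \<in> C" "Poly_Mapping.single w a \<in> C"
      using Cons.hyps gen_closed by auto
    ultimately have "cls (Poly_Mapping.single (i # w) a) = hecke_gen m i \<otimes>\<^bsub>hecke m\<^esub> cls (Poly_Mapping.single w a)"
      by (simp only: hecke_gen_eq cls_hom)
    then show ?case
      using Cons by (simp add: generate_ring.eng_mult generate_ring.incl)
  qed
  show "carrier (hecke m) \<subseteq> generate_ring (hecke m) ?S"
  proof
    fix x assume "x \<in> carrier (hecke m)"
    then obtain p where p: "p \<in> C" "x = cls p" by (rule hecke_cases)
    have "Poly_Mapping.keys p \<subseteq> lists {1..<m}" using p by simp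
    then have "cls p \<in> generate_ring (hecke m) ?S"
    proof (induction p rule: finsupp_induct)
      case zero
      then show ?case using H.zero_in_generate by (simp add: cls_hom)
    next
      case (single w a)
      then show ?case by (rule monomial)
    next
      case (add p q)
      have "cls (p + q) = cls p \<oplus>\<^bsub>hecke m\<^esub> cls q" using add(1,2) by (simp add: cls_hom)
      then show ?case using add by (simp add: generate_ring.eng_add)
    qed
    then show "x \<in> generate_ring (hecke m) ?S" using p by simp
  qed
qed

end

definition algebra_hom :: "(complex, 'a) module \<Rightarrow> (complex, 'b) module \<Rightarrow> ('a \<Rightarrow> 'b) set"
  where "algebra_hom A B = {h \<in> ring_hom A B. \<forall>c. \<forall>x \<in> carrier A. h (c \<odot>\<^bsub>A\<^esub> x) = c \<odot>\<^bsub>B\<^esub> h x}"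

section \<open>The universal property of the presentation\<close>

context hecke_algebra
begin

text \<open>Evaluation \<open>ev\<close> of noncommutative polynomials at the elements
  \<open>t i\<close> is a ring homomorphism on the free algebra. Its kernel is an ideal containing
  \<open>hecke_rels m\<close>, hence all of \<open>hecke_ideal m\<close>, so \<open>ev\<close>
  factors through the quotient. The two embeddings into \<open>hecke n\<close> and the retraction
  are all obtained from this.\<close>

lemma hecke_lift:
  fixes R :: "(complex, 'r) module"
  assumes "complex_algebra R"
    and t: "\<And>i. i \<in> {1..<m} \<Longrightarrow> t i \<in> carrier R"
    and idem: "\<And>i. i \<in> {1..<m} \<Longrightarrow> t i \<otimes>\<^bsub>R\<^esub> t i = t i"
    and braid: "\<And>i. \<lbrakk>i \<in> {1..<m}; i + 1 \<in> {1..<m}\<rbrakk> \<Longrightarrow>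
      t i \<otimes>\<^bsub>R\<^esub> t (i + 1) \<otimes>\<^bsub>R\<^esub> t i = t (i + 1) \<otimes>\<^bsub>R\<^esub> t i \<otimes>\<^bsub>R\<^esub> t (i + 1)"
    and comm: "\<And>i j. \<lbrakk>i \<in> {1..<m}; j \<in> {1..<m}; \<bar>int i - int j\<bar> \<ge> 2\<rbrakk> \<Longrightarrow> t i \<otimes>\<^bsub>R\<^esub> t j = t j \<otimes>\<^bsub>R\<^esub> t i"
  obtains h where "h \<in> algebra_hom (hecke m) R" "\<And>i. i \<in> {1..<m} \<Longrightarrow> h (hecke_gen m i) = t i"
proof -
  interpret R: complex_algebra R by fact
  define W where "W w = foldr (\<lambda>i x. t i \<otimes>\<^bsub>R\<^esub> x) w \<one>\<^bsub>R\<^esub>" for w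
  have W_closed: "W w \<in> carrier R" if "w \<in> lists {1..<m}" for w
    using that by (induction w) (auto simp: W_def t simp del: One_nat_def)
  have W_append: "W (u + v) = W u \<otimes>\<^bsub>R\<^esub> W v" if "u \<in> lists {1..<m}" "v \<in> lists {1..<m}" for u v
    using that(1)
  proof (induction u)
    case Nil
    then show ?case using W_closed[OF that(2)] by (simp add: W_def plus_list_def)
  next
    case (Cons i u)
    then show ?case using W_closed[OF that(2)] W_closed[of u] t[of i]
      by (simp add: plus_list_def R.m_assoc) (simp add: W_def R.m_assoc)
  qed
  define ev where "ev = additive_extend R (\<lambda>w c. c \<odot>\<^bsub>R\<^esub> W w)"
  interpret ev: additive_family R "\<lambda>w c. c \<odot>\<^bsub>R\<^esub> W w" "lists {1..<m}"
    by unfold_locales (use W_closed in \<open>auto simp: R.scale_add_left simp del: One_nat_def\<close>)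
  have ev_closed: "ev p \<in> carrier R" if "p \<in> C" for p
    using that ev.additive_extend_closed by (simp add: ev_def)
  have ev_add: "ev (p + q) = ev p \<oplus>\<^bsub>R\<^esub> ev q" if "p \<in> C" "q \<in> C" for p q
    using that ev.additive_extend_add by (simp add: ev_def)
  have ev_single: "ev (Poly_Mapping.single w a) = a \<odot>\<^bsub>R\<^esub> W w" if "w \<in> lists {1..<m}" for w a
    using that ev.additive_extend_single by (simp add: ev_def)
  have ev_0: "ev 0 = \<zero>\<^bsub>R\<^esub>" using ev.additive_extend_0 by (simp add: ev_def)
  have C_mult: "p * q \<in> C" if "p \<in> C" "q \<in> C" for p q
    using that FA.m_closed[of p q] by simp
  have ev_mult: "ev (p * q) = ev p \<otimes>\<^bsub>R\<^esub> ev q" if p: "p \<in> C" and q: "q \<in> C" for p q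
  proof -
    have "Poly_Mapping.keys p \<subseteq> lists {1..<m}" using p by simp
    then show ?thesis
    proof (induction p rule: finsupp_induct)
      case zero
      then show ?case using q ev_closed[of q] by (simp add: ev_0)
    next
      case (add p p')
      then have *: "p \<in> C" "p' \<in> C" by simp_all
      then show ?case
        using add q ev_closed[of p] ev_closed[of p'] ev_closed[of q] C_mult[of p q] C_mult[of p' q]
        by (simp only: distrib_right ev_add R.l_distr)
    next
      case (single u a)
      have "Poly_Mapping.keys q \<subseteq> lists {1..<m}" using q by simp
      then show ?case
      proof (induction q rule: finsupp_induct)
        case zero
        then show ?case using single ev_closed[of "Poly_Mapping.single u a"] by (simp add: ev_0)
      next
        case (add q q')
        then have *: "q \<in> C" "q' \<in> C" "Poly_Mapping.single u a \<in> C" using single by simp_all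
        then show ?case
          using add ev_closed[of q] ev_closed[of q'] ev_closed[of "Poly_Mapping.single u a"]
            C_mult[of "Poly_Mapping.single u a" q] C_mult[of "Poly_Mapping.single u a" q']
          by (simp only: distrib_left ev_add R.r_distr)
      next
        case (single v b)
        have "u + v \<in> lists {1..<m}" using single \<open>u \<in> _\<close> by (simp add: plus_list_def)
        moreover have "(a * b) \<odot>\<^bsub>R\<^esub> (W u \<otimes>\<^bsub>R\<^esub> W v) = (a \<odot>\<^bsub>R\<^esub> W u) \<otimes>\<^bsub>R\<^esub> (b \<odot>\<^bsub>R\<^esub> W v)"
          using W_closed[OF \<open>u \<in> _\<close>] W_closed[OF \<open>v \<in> _\<close>]
          by (simp add: R.scale_scale R.scale_mult_right R.scale_mult_left[symmetric])
        ultimately show ?case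
          using single \<open>u \<in> _\<close> by (simp only: mult_single ev_single W_append)
      qed
    qed
  qed
  have ev_scale: "ev (scale c p) = c \<odot>\<^bsub>R\<^esub> ev p" if p: "p \<in> C" for c p
  proof -
    have z: "Poly_Mapping.single 0 c \<in> C" and z': "ev (Poly_Mapping.single 0 c) = c \<odot>\<^bsub>R\<^esub> \<one>\<^bsub>R\<^esub>"
      using ev_single[of "[]" c] by (simp_all add: zero_list_def W_def)
    show ?thesis
      unfolding scale_conv_mult ev_mult[OF z p] z' using ev_closed[OF p] by (simp add: R.scale_eq_mult[symmetric])
  qed
  have ev_gen: "ev (gen i) = t i" if "i \<in> {1..<m}" for i
    using ev_single[of "[i]" 1] that t[OF that] by (simp add: gen_def W_def del: One_nat_def)
  have ev_hom: "ev \<in> ring_hom (free_algebra {1..<m}) R"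
    using ev_closed ev_mult ev_add ev_single[of "[]" 1]
    by (intro ring_hom_memI) (simp_all add: W_def zero_list_def flip: single_one)
  interpret evh: ring_hom_ring "free_algebra {1..<m}" R ev
    by (intro ring_hom_ringI2 FA.ring_axioms R.ring_axioms ev_hom)
  have ev_diff: "ev (p - q) = ev p \<ominus>\<^bsub>R\<^esub> ev q" if "p \<in> C" "q \<in> C" for p q
  proof -
    have "p - q \<in> C" using that keys_diff[of p q] by auto
    then have "ev p = ev (p - q) \<oplus>\<^bsub>R\<^esub> ev q" using ev_add[of "p - q" q] that by simp
    then show ?thesis using ev_closed[OF \<open>p - q \<in> C\<close>] ev_closed[OF that(2)]
      by (simp add: a_minus_def R.a_assoc R.r_neg)
  qed
  have "hecke_rels m \<subseteq> a_kernel (free_algebra {1..<m}) R ev"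
  proof
    fix r assume r: "r \<in> hecke_rels m"
    then have rC: "r \<in> C" using hecke_rels_subset by blast
    have "ev r = \<zero>\<^bsub>R\<^esub>"
    proof -
      from r consider (1) i where "i \<in> {1..<m}" "r = gen i * gen i - gen i"
        | (2) i where "i \<in> {1..<m}" "i + 1 \<in> {1..<m}"
          "r = gen i * gen (i + 1) * gen i - gen (i + 1) * gen i * gen (i + 1)"
        | (3) i j where "i \<in> {1..<m}" "j \<in> {1..<m}" "\<bar>int i - int j\<bar> \<ge> 2" "r = gen i * gen j - gen j * gen i"
        unfolding hecke_rels_def by blast
      then show ?thesis
      proof cases
        case 1
        then show ?thesis
          using gen_closed[of i] C_mult t[of i] by (simp only: ev_diff ev_mult ev_gen idem R.r_right_minus_eq)
      next
        case 2
        then show ?thesis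
          using gen_closed[of i] gen_closed[of "i + 1"] C_mult t[of i] t[of "i + 1"] R.m_closed
          by (simp only: ev_diff ev_mult ev_gen braid R.r_right_minus_eq)
      next
        case 3
        then have "ev r = t i \<otimes>\<^bsub>R\<^esub> t j \<ominus>\<^bsub>R\<^esub> t j \<otimes>\<^bsub>R\<^esub> t i"
          using gen_closed[of i] gen_closed[of j] C_mult by (simp only: ev_diff ev_mult ev_gen)
        moreover have "t j \<otimes>\<^bsub>R\<^esub> t i \<in> carrier R" using 3 t by blast
        ultimately show ?thesis by (simp only: comm[OF 3(1-3)] R.r_right_minus_eq)
      qed
    qed
    then show "r \<in> a_kernel (free_algebra {1..<m}) R ev"
      using rC unfolding a_kernel_def' by blast
  qed
  then have "hecke_ideal m \<subseteq> a_kernel (free_algebra {1..<m}) R ev"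
    unfolding hecke_ideal_def by (intro FA.genideal_minimal evh.kernel_is_ideal)
  then have ker: "ev p = \<zero>\<^bsub>R\<^esub>" if "p \<in> hecke_ideal m" for p
    using that unfolding a_kernel_def' by blast
  define h where "h P = ev (SOME p. p \<in> C \<and> cls p = P)" for P
  have h: "h (cls p) = ev p" if p: "p \<in> C" for p
  proof -
    define q where "q = (SOME q. q \<in> C \<and> cls q = cls p)"
    have q: "q \<in> C \<and> cls q = cls p"
      unfolding q_def by (rule someI[of _ p]) (use p in simp)
    then have k: "q - p \<in> hecke_ideal m" using cls_eq_iff[of q p] by blast
    then have "q - p \<in> C" by (rule I.a_Hcarr)
    then have "ev q = ev (q - p) \<oplus>\<^bsub>R\<^esub> ev p" using ev_add[of "q - p" p] p by simp
    then have "ev q = ev p" using ker[OF k] ev_closed[OF p] by simp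
    then show ?thesis by (simp add: h_def q_def)
  qed
  show thesis
  proof
    show "h \<in> algebra_hom (hecke m) R"
      unfolding algebra_hom_def
    proof (intro CollectI conjI ballI allI ring_hom_memI)
      fix x assume "x \<in> carrier (hecke m)"
      then obtain p where p: "p \<in> C" "x = cls p" by (rule hecke_cases)
      show "h x \<in> carrier R" using p ev_closed by (simp add: h del: free_algebra_simps)
      show "h (c \<odot>\<^bsub>hecke m\<^esub> x) = c \<odot>\<^bsub>R\<^esub> h x" for c
        using p scale_C by (simp add: h cls_smult ev_scale del: free_algebra_simps)
      fix y assume "y \<in> carrier (hecke m)"
      then obtain q where q: "q \<in> C" "y = cls q" by (rule hecke_cases)
      have "p + q \<in> C" using p q FA.a_closed[of p q] by simp
      then show "h (x \<otimes>\<^bsub>hecke m\<^esub> y) = h x \<otimes>\<^bsub>R\<^esub> h y" "h (x \<oplus>\<^bsub>hecke m\<^esub> y) = h x \<oplus>\<^bsub>R\<^esub> h y"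
        using p q C_mult by (simp_all only: h cls_hom ev_mult ev_add)
    next
      have "(1 :: nat list \<Rightarrow>\<^sub>0 complex) \<in> C" using FA.one_closed by simp
      then show "h \<one>\<^bsub>hecke m\<^esub> = \<one>\<^bsub>R\<^esub>"
        using ring_hom_one[OF ev_hom] by (simp add: cls_hom h del: free_algebra_simps(1))
    qed
    show "h (hecke_gen m i) = t i" if "i \<in> {1..<m}" for i
      using that gen_closed[OF that] by (simp only: hecke_gen_eq h ev_gen)
  qed
qed

end

section \<open>The parabolic subalgebra\<close>

lemma algebra_homD:
  assumes "h \<in> algebra_hom A B"
  shows "h \<in> ring_hom A B"
    and "x \<in> carrier A \<Longrightarrow> h x \<in> carrier B"
    and "\<lbrakk>x \<in> carrier A; y \<in> carrier A\<rbrakk> \<Longrightarrow> h (x \<otimes>\<^bsub>A\<^esub> y) = h x \<otimes>\<^bsub>B\<^esub> h y"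
    and "\<lbrakk>x \<in> carrier A; y \<in> carrier A\<rbrakk> \<Longrightarrow> h (x \<oplus>\<^bsub>A\<^esub> y) = h x \<oplus>\<^bsub>B\<^esub> h y"
    and "h \<one>\<^bsub>A\<^esub> = \<one>\<^bsub>B\<^esub>"
    and "x \<in> carrier A \<Longrightarrow> h (c \<odot>\<^bsub>A\<^esub> x) = c \<odot>\<^bsub>B\<^esub> h x"
  using assms by (auto simp: algebra_hom_def ring_hom_def)

lemma ring_hom_a_inv:
  assumes "ring R" "ring S" "h \<in> ring_hom R S" "x \<in> carrier R"
  shows "h (\<ominus>\<^bsub>R\<^esub> x) = \<ominus>\<^bsub>S\<^esub> h x"
proof -
  interpret ring_hom_ring R S h using assms by (simp add: ring_hom_ringI2)
  show ?thesis using assms(4) by (rule hom_a_inv)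
qed

text \<open>Used to identify the image of the tensor product with \<open>parabolic n m\<close> and
  to move generating sets into the tensor algebra.\<close>

lemma generate_ring_image:
  assumes "ring R" "ring S" "h \<in> ring_hom R S" "H \<subseteq> carrier R"
  shows "h ` generate_ring R H = generate_ring S (h ` H)"
proof
  interpret R: ring R by fact
  interpret S: ring S by fact
  note closed = R.generate_ring_in_carrier[OF assms(4)]
  show "h ` generate_ring R H \<subseteq> generate_ring S (h ` H)"
  proof (rule image_subsetI)
    fix x assume "x \<in> generate_ring R H"
    then show "h x \<in> generate_ring S (h ` H)"
    proof (induction rule: generate_ring.induct)
      case one
      then show ?case using ring_hom_one[OF assms(3)] by (simp add: generate_ring.one)
    next
      case (a_inv x)
      then show ?case using closed[of x] by (simp add: ring_hom_a_inv[OF assms(1-3)] generate_ring.a_inv)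
    next
      case (eng_add x y)
      then show ?case using closed by (simp add: ring_hom_add[OF assms(3)] generate_ring.eng_add)
    next
      case (eng_mult x y)
      then show ?case using closed by (simp add: ring_hom_mult[OF assms(3)] generate_ring.eng_mult)
    qed (simp add: generate_ring.incl)
  qed
  show "generate_ring S (h ` H) \<subseteq> h ` generate_ring R H"
  proof
    fix y assume "y \<in> generate_ring S (h ` H)"
    then show "y \<in> h ` generate_ring R H"
    proof (induction rule: generate_ring.induct)
      case one
      then show ?case using ring_hom_one[OF assms(3)] by (metis generate_ring.one imageI)
    next
      case (incl y)
      then show ?case by (auto intro: generate_ring.incl)
    next
      case (a_inv y)
      then obtain x where "x \<in> generate_ring R H" "y = h x" by blast
      then show ?case
        using closed[of x] by (auto simp: ring_hom_a_inv[OF assms(1-3), symmetric] intro!: imageI generate_ring.a_inv)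
    next
      case (eng_add y y')
      then obtain x x' where "x \<in> generate_ring R H" "y = h x" "x' \<in> generate_ring R H" "y' = h x'" by blast
      then show ?case
        using closed by (auto simp: ring_hom_add[OF assms(3), symmetric] intro!: imageI generate_ring.eng_add)
    next
      case (eng_mult y y')
      then obtain x x' where "x \<in> generate_ring R H" "y = h x" "x' \<in> generate_ring R H" "y' = h x'" by blast
      then show ?case
        using closed by (auto simp: ring_hom_mult[OF assms(3), symmetric] intro!: imageI generate_ring.eng_mult)
    qed
  qed
qed

lemma ring_hom_eq_on_generators:
  assumes "ring R" "ring S" "h \<in> ring_hom R S" "h' \<in> ring_hom R S" "H \<subseteq> carrier R"
    and "\<And>x. x \<in> H \<Longrightarrow> h x = h' x" and x: "x \<in> generate_ring R H"
  shows "h x = h' x"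
  using x
proof (induction rule: generate_ring.induct)
  case one
  then show ?case using ring_hom_one[OF assms(3)] ring_hom_one[OF assms(4)] by simp
next
  case (incl x)
  then show ?case by (rule assms(6))
next
  case (a_inv x)
  then show ?case
    using ring.generate_ring_in_carrier[OF assms(1,5), of x]
    by (simp add: ring_hom_a_inv[OF assms(1-3)] ring_hom_a_inv[OF assms(1,2,4)])
next
  case (eng_add x y)
  then show ?case
    using ring.generate_ring_in_carrier[OF assms(1,5)]
    by (simp add: ring_hom_add[OF assms(3)] ring_hom_add[OF assms(4)])
next
  case (eng_mult x y)
  then show ?case
    using ring.generate_ring_in_carrier[OF assms(1,5)]
    by (simp add: ring_hom_mult[OF assms(3)] ring_hom_mult[OF assms(4)])
qed

text \<open>The centralizer of \<open>z\<close> is a subring.\<close>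

lemma (in ring) commutes_generate_ring:
  assumes "H \<subseteq> carrier R" "z \<in> carrier R" "\<And>x. x \<in> H \<Longrightarrow> x \<otimes> z = z \<otimes> x" "x \<in> generate_ring R H"
  shows "x \<otimes> z = z \<otimes> x"
  using assms(4)
proof (induction rule: generate_ring.induct)
  case (a_inv x)
  then show ?case using generate_ring_in_carrier[OF assms(1), of x] assms(2) by (simp add: l_minus r_minus)
next
  case (eng_add x y)
  then show ?case using generate_ring_in_carrier[OF assms(1)] assms(2) by (simp add: l_distr r_distr)
next
  case (eng_mult x y)
  then have c: "x \<in> carrier R" "y \<in> carrier R" using generate_ring_in_carrier[OF assms(1)] by blast+
  have "x \<otimes> y \<otimes> z = x \<otimes> (z \<otimes> y)" using eng_mult c assms(2) by (simp add: m_assoc)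
  also have "\<dots> = (x \<otimes> z) \<otimes> y" using c assms(2) by (simp add: m_assoc)
  also have "\<dots> = z \<otimes> (x \<otimes> y)" using eng_mult c assms(2) by (simp add: m_assoc)
  finally show ?case .
qed (use assms in auto)

section \<open>Maps out of the tensor algebra and its generators\<close>

context tensor_algebras
begin

text \<open>\<open>tensor_lift\<close> provides an additive map only. Multiplicativity is checked on
  pure tensors, which suffices since both sides are additive in \<open>s\<close> and in
  \<open>t\<close>; homogeneity follows from multiplicativity and the value at a scalar.\<close>

lemma tensor_algebra_lift:
  fixes R :: "(complex, 'r) module"
  assumes "complex_algebra R" and f: "f \<in> algebra_hom A R" and g: "g \<in> algebra_hom B R"
    and comm: "\<And>a b. \<lbrakk>a \<in> carrier A; b \<in> carrier B\<rbrakk> \<Longrightarrow> f a \<otimes>\<^bsub>R\<^esub> g b = g b \<otimes>\<^bsub>R\<^esub> f a"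
  obtains h where "h \<in> algebra_hom T R"
    "\<And>a b. \<lbrakk>a \<in> carrier A; b \<in> carrier B\<rbrakk> \<Longrightarrow> h (pure_tensor A B a b) = f a \<otimes>\<^bsub>R\<^esub> g b"
proof -
  interpret R: complex_algebra R by fact
  note fD = algebra_homD[OF f] and gD = algebra_homD[OF g]
  have "\<exists>h. h \<in> hom (tensor_group A B) (add_monoid R) \<and>
    (\<forall>a\<in>carrier A. \<forall>b\<in>carrier B. h (pure_tensor A B a b) = f a \<otimes>\<^bsub>R\<^esub> g b)"
    by (rule tensor_lift[OF R.a_comm_group, of "\<lambda>a b. f a \<otimes>\<^bsub>R\<^esub> g b"])
      (auto simp: fD gD R.l_distr R.r_distr R.scale_mult_left[symmetric] R.scale_mult_right[symmetric])
  then obtain h where h: "h \<in> hom (tensor_group A B) (add_monoid R)"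
    and hp: "\<And>a b. \<lbrakk>a \<in> carrier A; b \<in> carrier B\<rbrakk> \<Longrightarrow> h (pure_tensor A B a b) = f a \<otimes>\<^bsub>R\<^esub> g b"
    by blast
  have h_closed: "h t \<in> carrier R" if "t \<in> carrier T" for t
    using h that by (simp add: hom_def Pi_iff)
  have h_add: "h (s \<oplus>\<^bsub>T\<^esub> t) = h s \<oplus>\<^bsub>R\<^esub> h t" if "s \<in> carrier T" "t \<in> carrier T" for s t
    using h that by (simp add: hom_def)
  have h_mult: "h (s \<otimes>\<^bsub>T\<^esub> t) = h s \<otimes>\<^bsub>R\<^esub> h t" if s: "s \<in> carrier T" and t: "t \<in> carrier T" for s t
    using s[simplified]
  proof (induction s rule: tensor_induct)
    case (add s s')
    then have *: "s \<in> carrier T" "s' \<in> carrier T" by simp_all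
    have "h ((s \<oplus>\<^bsub>T\<^esub> s') \<otimes>\<^bsub>T\<^esub> t) = h (s \<oplus>\<^bsub>T\<^esub> s') \<otimes>\<^bsub>R\<^esub> h t"
      using add * t h_closed T.m_closed by (simp only: T.l_distr h_add R.l_distr)
    then show ?case by simp
  next
    case (pure a b)
    show ?case
      using t[simplified]
    proof (induction t rule: tensor_induct)
      case (add s s')
      then have *: "s \<in> carrier T" "s' \<in> carrier T" "pure_tensor A B a b \<in> carrier T" using pure by simp_all
      have "h (pure_tensor A B a b \<otimes>\<^bsub>T\<^esub> (s \<oplus>\<^bsub>T\<^esub> s')) = h (pure_tensor A B a b) \<otimes>\<^bsub>R\<^esub> h (s \<oplus>\<^bsub>T\<^esub> s')"
        using add * h_closed T.m_closed by (simp only: T.r_distr h_add R.r_distr)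
      then show ?case by simp
    next
      case (pure a' b')
      note ab = \<open>a \<in> carrier A\<close> \<open>b \<in> carrier B\<close> and ab' = pure
      have "f (a \<otimes>\<^bsub>A\<^esub> a') \<otimes>\<^bsub>R\<^esub> g (b \<otimes>\<^bsub>B\<^esub> b') = f a \<otimes>\<^bsub>R\<^esub> (f a' \<otimes>\<^bsub>R\<^esub> g b) \<otimes>\<^bsub>R\<^esub> g b'"
        using ab ab' fD gD by (simp add: R.m_assoc)
      \<comment> \<open>The only place where the commuting images enter: \<open>f a'\<close> has to
        pass \<open>g b\<close>.\<close>
      also have "\<dots> = f a \<otimes>\<^bsub>R\<^esub> (g b \<otimes>\<^bsub>R\<^esub> f a') \<otimes>\<^bsub>R\<^esub> g b'"
        using ab ab' by (simp only: comm)
      also have "\<dots> = (f a \<otimes>\<^bsub>R\<^esub> g b) \<otimes>\<^bsub>R\<^esub> (f a' \<otimes>\<^bsub>R\<^esub> g b')"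
        using ab ab' fD gD by (simp add: R.m_assoc)
      finally show ?case using ab ab' by (simp add: mult_pure hp)
    qed
  qed
  have "h \<in> algebra_hom T R"
    unfolding algebra_hom_def
  proof (intro CollectI conjI ballI allI ring_hom_memI)
    show "h \<one>\<^bsub>T\<^esub> = \<one>\<^bsub>R\<^esub>" using hp[of "\<one>\<^bsub>A\<^esub>" "\<one>\<^bsub>B\<^esub>"] fD gD by simp
    fix t c assume t: "t \<in> carrier T"
    have "h (c \<odot>\<^bsub>T\<^esub> t) = (c \<odot>\<^bsub>R\<^esub> \<one>\<^bsub>R\<^esub>) \<otimes>\<^bsub>R\<^esub> h t"
      unfolding smult_tensor_algebra[OF t] using t h_mult[of "pure_tensor A B (c \<odot>\<^bsub>A\<^esub> \<one>\<^bsub>A\<^esub>) \<one>\<^bsub>B\<^esub>" t]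
      by (simp add: hp fD gD)
    then show "h (c \<odot>\<^bsub>T\<^esub> t) = c \<odot>\<^bsub>R\<^esub> h t" using h_closed[OF t] by (simp add: R.scale_eq_mult[symmetric])
  qed (use h_closed h_mult h_add in auto)
  then show thesis using hp that by blast
qed

lemma scalar_right: "pure_tensor A B \<one>\<^bsub>A\<^esub> (c \<odot>\<^bsub>B\<^esub> \<one>\<^bsub>B\<^esub>) = c \<odot>\<^bsub>T\<^esub> \<one>\<^bsub>T\<^esub>"
  by (simp add: smult_pure pure_balanced)

lemma pure_left_ring_hom: "(\<lambda>a. pure_tensor A B a \<one>\<^bsub>B\<^esub>) \<in> ring_hom A T"
  by (rule ring_hom_memI) (auto simp: mult_pure pure_add_left)

lemma pure_right_ring_hom: "(\<lambda>b. pure_tensor A B \<one>\<^bsub>A\<^esub> b) \<in> ring_hom B T"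
  by (rule ring_hom_memI) (auto simp: mult_pure pure_add_right)

text \<open>A pure tensor factors as \<open>(a \<otimes> 1) (1 \<otimes> b)\<close>. Each factor
  lies in the image of \<open>A\<close> or \<open>B\<close> under a ring homomorphism, and such an
  image is generated by the images of generators.\<close>

lemma tensor_algebra_generated:
  assumes A: "carrier A = generate_ring A (GA \<union> {c \<odot>\<^bsub>A\<^esub> \<one>\<^bsub>A\<^esub> | c. True})" "GA \<subseteq> carrier A"
    and B: "carrier B = generate_ring B (GB \<union> {c \<odot>\<^bsub>B\<^esub> \<one>\<^bsub>B\<^esub> | c. True})" "GB \<subseteq> carrier B"
  shows "carrier T = generate_ring T ((\<lambda>a. pure_tensor A B a \<one>\<^bsub>B\<^esub>) ` GA \<union> (\<lambda>b. pure_tensor A B \<one>\<^bsub>A\<^esub> b) ` GB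
    \<union> {c \<odot>\<^bsub>T\<^esub> \<one>\<^bsub>T\<^esub> | c. True})" (is "_ = generate_ring T ?S")
proof
  have S: "?S \<subseteq> carrier T" using A(2) B(2) T.scale_closed[OF T.one_closed] by auto
  show "generate_ring T ?S \<subseteq> carrier T" by (rule T.generate_ring_incl[OF S])
  let ?l = "\<lambda>a. pure_tensor A B a \<one>\<^bsub>B\<^esub>" and ?r = "\<lambda>b. pure_tensor A B \<one>\<^bsub>A\<^esub> b"
  let ?SA = "GA \<union> {c \<odot>\<^bsub>A\<^esub> \<one>\<^bsub>A\<^esub> | c. True}" and ?SB = "GB \<union> {c \<odot>\<^bsub>B\<^esub> \<one>\<^bsub>B\<^esub> | c. True}"
  have SA: "?SA \<subseteq> carrier A" and SB: "?SB \<subseteq> carrier B" using A(2) B(2) by blast+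
  have "?l ` carrier A = generate_ring T (?l ` ?SA)" "?r ` carrier B = generate_ring T (?r ` ?SB)"
    using generate_ring_image[OF A.ring_axioms T.ring_axioms pure_left_ring_hom SA]
      generate_ring_image[OF B.ring_axioms T.ring_axioms pure_right_ring_hom SB]
    by (simp_all only: A(1)[symmetric] B(1)[symmetric])
  moreover have "?l ` ?SA \<subseteq> ?S" "?r ` ?SB \<subseteq> ?S"
    by (auto simp: smult_pure scalar_right)
  ultimately have left: "?l ` carrier A \<subseteq> generate_ring T ?S" and right: "?r ` carrier B \<subseteq> generate_ring T ?S"
    using T.mono_generate_ring[OF _ S] by (simp_all only:)
  show "carrier T \<subseteq> generate_ring T ?S"
  proof
    fix t assume "t \<in> carrier T"
    then have "t \<in> carrier (tensor_group A B)" by simp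
    then show "t \<in> generate_ring T ?S"
    proof (induction t rule: tensor_induct)
      case (pure a b)
      have "pure_tensor A B a b = pure_tensor A B a \<one>\<^bsub>B\<^esub> \<otimes>\<^bsub>T\<^esub> pure_tensor A B \<one>\<^bsub>A\<^esub> b"
        using pure by (simp add: mult_pure)
      then show ?case using pure left right by (auto intro!: generate_ring.eng_mult)
    next
      case (add s t)
      then show ?case using generate_ring.eng_add[of s T ?S t] by simp
    qed
  qed
qed

end

section \<open>The tensor product of two 0-Hecke algebras inside the larger one\<close>

locale parabolic_setup =
  fixes n m :: nat
  assumes m_le: "m \<le> n"
begin

sublocale Hm: hecke_algebra m .
sublocale Hk: hecke_algebra "n - m" .
sublocale Hn: hecke_algebra n .
sublocale TT: tensor_algebras "hecke m" "hecke (n - m)" by unfold_locales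

abbreviation "A \<equiv> hecke m"
abbreviation "B \<equiv> hecke (n - m)"

lemma left_embedding:
  obtains f where "f \<in> algebra_hom A (hecke n)" "\<And>i. i \<in> {1..<m} \<Longrightarrow> f (hecke_gen m i) = hecke_gen n i"
proof (rule Hm.hecke_lift[OF Hn.H.complex_algebra_axioms, of "hecke_gen n"])
  fix i j assume ij: "i \<in> {1..<m}" "j \<in> {1..<m}" "\<bar>int i - int j\<bar> \<ge> 2"
  show "hecke_gen n i \<otimes>\<^bsub>hecke n\<^esub> hecke_gen n j = hecke_gen n j \<otimes>\<^bsub>hecke n\<^esub> hecke_gen n i"
    by (rule Hn.hecke_gen_rels(3)) (use ij m_le in auto)
next
  fix i assume i: "i \<in> {1..<m}"
  show "hecke_gen n i \<in> carrier (hecke n)" by (rule Hn.hecke_gen_closed) (use i m_le in auto)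
  show "hecke_gen n i \<otimes>\<^bsub>hecke n\<^esub> hecke_gen n i = hecke_gen n i"
    by (rule Hn.hecke_gen_rels(1)) (use i m_le in auto)
  assume i': "i + 1 \<in> {1..<m}"
  show "hecke_gen n i \<otimes>\<^bsub>hecke n\<^esub> hecke_gen n (i + 1) \<otimes>\<^bsub>hecke n\<^esub> hecke_gen n i =
    hecke_gen n (i + 1) \<otimes>\<^bsub>hecke n\<^esub> hecke_gen n i \<otimes>\<^bsub>hecke n\<^esub> hecke_gen n (i + 1)"
    by (rule Hn.hecke_gen_rels(2)) (use i i' m_le in auto)
qed (rule that)

lemma right_embedding:
  obtains g where "g \<in> algebra_hom B (hecke n)" "\<And>i. i \<in> {1..<n - m} \<Longrightarrow> g (hecke_gen (n - m) i) = hecke_gen n (i + m)"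
proof (rule Hk.hecke_lift[OF Hn.H.complex_algebra_axioms, of "\<lambda>i. hecke_gen n (i + m)"])
  fix i j assume ij: "i \<in> {1..<n - m}" "j \<in> {1..<n - m}" "\<bar>int i - int j\<bar> \<ge> 2"
  show "hecke_gen n (i + m) \<otimes>\<^bsub>hecke n\<^esub> hecke_gen n (j + m) = hecke_gen n (j + m) \<otimes>\<^bsub>hecke n\<^esub> hecke_gen n (i + m)"
    by (rule Hn.hecke_gen_rels(3)) (use ij m_le in auto)
next
  fix i assume i: "i \<in> {1..<n - m}"
  show "hecke_gen n (i + m) \<in> carrier (hecke n)" by (rule Hn.hecke_gen_closed) (use i m_le in auto)
  show "hecke_gen n (i + m) \<otimes>\<^bsub>hecke n\<^esub> hecke_gen n (i + m) = hecke_gen n (i + m)"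
    by (rule Hn.hecke_gen_rels(1)) (use i m_le in auto)
  assume i': "i + 1 \<in> {1..<n - m}"
  show "hecke_gen n (i + m) \<otimes>\<^bsub>hecke n\<^esub> hecke_gen n (i + 1 + m) \<otimes>\<^bsub>hecke n\<^esub> hecke_gen n (i + m) =
    hecke_gen n (i + 1 + m) \<otimes>\<^bsub>hecke n\<^esub> hecke_gen n (i + m) \<otimes>\<^bsub>hecke n\<^esub> hecke_gen n (i + 1 + m)"
    using Hn.hecke_gen_rels(2)[of "i + m"] i i' m_le by (simp add: algebra_simps)
qed (rule that)

text \<open>The relations of \<open>hecke n\<close> survive sending \<open>T\<^sub>m\<close> to \<open>0\<close>, which yields a left inverse of the
  map from the tensor product.\<close>

lemma retraction:
  obtains r where "r \<in> algebra_hom (hecke n) TT.T"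
    "\<And>i. i \<in> {1..<m} \<Longrightarrow> r (hecke_gen n i) = pure_tensor A B (hecke_gen m i) \<one>\<^bsub>B\<^esub>"
    "\<And>i. i \<in> {1..<n - m} \<Longrightarrow> r (hecke_gen n (i + m)) = pure_tensor A B \<one>\<^bsub>A\<^esub> (hecke_gen (n - m) i)"
proof -
  define t where "t i = (if i < m then pure_tensor A B (hecke_gen m i) \<one>\<^bsub>B\<^esub>
    else if i = m then \<zero>\<^bsub>TT.T\<^esub> else pure_tensor A B \<one>\<^bsub>A\<^esub> (hecke_gen (n - m) (i - m)))" for i
  have m1: "hecke_gen m i \<in> carrier A" if "1 \<le> i" "i < m" for i
    using that Hm.hecke_gen_closed[of i] by simp
  have k1: "hecke_gen (n - m) (i - m) \<in> carrier B" if "m < i" "i < n" for i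
    using that by (intro Hk.hecke_gen_closed) auto
  have t_closed: "t i \<in> carrier TT.T" if "i \<in> {1..<n}" for i
  proof (cases i m rule: linorder_cases)
    case less
    then show ?thesis using that m1[of i] by (simp add: t_def)
  next
    case equal
    then show ?thesis using TT.T.zero_closed by (simp add: t_def del: TT.tensor_algebra_simps)
  next
    case greater
    then show ?thesis using that k1[of i] by (simp add: t_def)
  qed
  have idem: "t i \<otimes>\<^bsub>TT.T\<^esub> t i = t i" if "i \<in> {1..<n}" for i
  proof (cases i m rule: linorder_cases)
    case less
    then show ?thesis using that m1[of i] Hm.hecke_gen_rels(1)[of i] by (simp add: t_def TT.mult_pure)
  next
    case equal
    then show ?thesis using TT.T.l_null[OF TT.T.zero_closed] by (simp add: t_def del: TT.tensor_algebra_simps)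
  next
    case greater
    then have "i - m \<in> {1..<n - m}" using that by auto
    then show ?thesis using greater that k1[of i] Hk.hecke_gen_rels(1)[of "i - m"] by (simp add: t_def TT.mult_pure)
  qed
  have braid: "t i \<otimes>\<^bsub>TT.T\<^esub> t (i + 1) \<otimes>\<^bsub>TT.T\<^esub> t i = t (i + 1) \<otimes>\<^bsub>TT.T\<^esub> t i \<otimes>\<^bsub>TT.T\<^esub> t (i + 1)"
    if "i \<in> {1..<n}" "i + 1 \<in> {1..<n}" for i
  proof -
    \<comment> \<open>In the middle case one of the two generators is sent to zero, and it is a
      factor of both sides of the braid relation.\<close>
    consider "i + 1 < m" | "i = m \<or> i + 1 = m" | "m < i" by linarith
    then show ?thesis
    proof cases
      case 1
      then show ?thesis using that m1[of i] m1[of "i + 1"] Hm.hecke_gen_rels(2)[of i] by (simp add: t_def TT.mult_pure)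
    next
      case 2
      then have "t i = \<zero>\<^bsub>TT.T\<^esub> \<or> t (i + 1) = \<zero>\<^bsub>TT.T\<^esub>" by (auto simp: t_def)
      then show ?thesis
      proof
        assume z: "t i = \<zero>\<^bsub>TT.T\<^esub>"
        show ?thesis unfolding z using t_closed[OF that(2)]
          by (simp only: TT.T.l_null TT.T.r_null TT.T.zero_closed)
      next
        assume z: "t (i + 1) = \<zero>\<^bsub>TT.T\<^esub>"
        show ?thesis unfolding z using t_closed[OF that(1)]
          by (simp only: TT.T.l_null TT.T.r_null TT.T.zero_closed)
      qed
    next
      case 3
      then have i: "i - m \<in> {1..<n - m}" "i - m + 1 \<in> {1..<n - m}" "i + 1 - m = i - m + 1" using that by auto
      show ?thesis
        using 3 that k1[of i] k1[of "i + 1"] Hk.hecke_gen_rels(2)[OF i(1,2)] unfolding t_def i(3)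
        by (simp add: TT.mult_pure)
    qed
  qed
  have comm: "t i \<otimes>\<^bsub>TT.T\<^esub> t j = t j \<otimes>\<^bsub>TT.T\<^esub> t i"
    if "i \<in> {1..<n}" "j \<in> {1..<n}" "\<bar>int i - int j\<bar> \<ge> 2" "i < j" for i j
  proof -
    \<comment> \<open>In the last case the two elements lie in different tensor factors and
      therefore commute without any Hecke relation.\<close>
    consider "j < m" | "i = m \<or> j = m" | "m < i" | "i < m" "m < j" using that by linarith
    then show ?thesis
    proof cases
      case 1
      then show ?thesis using that m1[of i] m1[of j] Hm.hecke_gen_rels(3)[of i j] by (simp add: t_def TT.mult_pure)
    next
      case 2
      then have "t i = \<zero>\<^bsub>TT.T\<^esub> \<or> t j = \<zero>\<^bsub>TT.T\<^esub>" by (auto simp: t_def)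
      then show ?thesis
        using t_closed[OF that(1)] t_closed[OF that(2)] TT.T.l_null TT.T.r_null by metis
    next
      case 3
      then have i: "i - m \<in> {1..<n - m}" "j - m \<in> {1..<n - m}" "\<bar>int (i - m) - int (j - m)\<bar> \<ge> 2" using that by auto
      show ?thesis
        using 3 that k1[of i] k1[of j] Hk.hecke_gen_rels(3)[OF i] by (simp add: t_def TT.mult_pure)
    next
      case 4
      then show ?thesis using that m1[of i] k1[of j] by (simp add: t_def TT.mult_pure)
    qed
  qed
  have comm': "t i \<otimes>\<^bsub>TT.T\<^esub> t j = t j \<otimes>\<^bsub>TT.T\<^esub> t i"
    if "i \<in> {1..<n}" "j \<in> {1..<n}" "\<bar>int i - int j\<bar> \<ge> 2" for i j
  proof (cases "i < j")
    case True
    then show ?thesis using comm that by blast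
  next
    case False
    then have "j < i" "\<bar>int j - int i\<bar> \<ge> 2" using that by auto
    then show ?thesis using comm[of j i] that by simp
  qed
  obtain r where r: "r \<in> algebra_hom (hecke n) TT.T" "\<And>i. i \<in> {1..<n} \<Longrightarrow> r (hecke_gen n i) = t i"
    by (rule Hn.hecke_lift[where t = t, OF TT.T.complex_algebra_axioms t_closed idem braid comm']) (assumption+, rule that)
  show thesis
  proof (rule that[OF r(1)])
    show "r (hecke_gen n i) = pure_tensor A B (hecke_gen m i) \<one>\<^bsub>B\<^esub>" if "i \<in> {1..<m}" for i
      using r(2)[of i] that m_le by (simp add: t_def)
    show "r (hecke_gen n (i + m)) = pure_tensor A B \<one>\<^bsub>A\<^esub> (hecke_gen (n - m) i)" if "i \<in> {1..<n - m}" for i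
    proof -
      have "i + m \<in> {1..<n}" using that by auto
      then show ?thesis using r(2)[of "i + m"] that by (simp add: t_def)
    qed
  qed
qed

definition tensor_gens where
  "tensor_gens = (\<lambda>a. pure_tensor A B a \<one>\<^bsub>B\<^esub>) ` hecke_gen m ` {1..<m} \<union>
    (\<lambda>b. pure_tensor A B \<one>\<^bsub>A\<^esub> b) ` hecke_gen (n - m) ` {1..<n - m}"

lemma tensor_gens_closed: "tensor_gens \<union> {c \<odot>\<^bsub>TT.T\<^esub> \<one>\<^bsub>TT.T\<^esub> | c. True} \<subseteq> carrier TT.T"
  unfolding tensor_gens_def
  using Hm.hecke_gen_closed Hk.hecke_gen_closed TT.T.scale_closed[OF TT.T.one_closed] by auto

lemma tensor_generated: "carrier TT.T = generate_ring TT.T (tensor_gens \<union> {c \<odot>\<^bsub>TT.T\<^esub> \<one>\<^bsub>TT.T\<^esub> | c. True})"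
  unfolding tensor_gens_def
  by (rule TT.tensor_algebra_generated[OF Hm.hecke_generated _ Hk.hecke_generated])
    (use Hm.hecke_gen_closed Hk.hecke_gen_closed in auto)

text \<open>Surjectivity is a comparison of generators; injectivity comes from the left inverse
  \<open>r\<close>. The values on generators are exported with the index \<open>i + m\<close> for
  the second factor, the form in which equivariance is checked later.\<close>

lemma parabolic_identification_exists:
  obtains \<iota> where "parabolic_identification n m \<iota>" "\<iota> \<in> algebra_hom TT.T (hecke n)"
    "\<And>i. i \<in> {1..<m} \<Longrightarrow> \<iota> (pure_tensor A B (hecke_gen m i) \<one>\<^bsub>B\<^esub>) = hecke_gen n i"
    "\<And>i. i \<in> {1..<n - m} \<Longrightarrow> \<iota> (pure_tensor A B \<one>\<^bsub>A\<^esub> (hecke_gen (n - m) i)) = hecke_gen n (i + m)"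
proof -
  obtain f where f: "f \<in> algebra_hom A (hecke n)" "\<And>i. i \<in> {1..<m} \<Longrightarrow> f (hecke_gen m i) = hecke_gen n i"
    by (rule left_embedding) (rule that)
  obtain g where g: "g \<in> algebra_hom B (hecke n)"
    "\<And>i. i \<in> {1..<n - m} \<Longrightarrow> g (hecke_gen (n - m) i) = hecke_gen n (i + m)"
    by (rule right_embedding) (rule that)
  obtain r where r: "r \<in> algebra_hom (hecke n) TT.T"
    "\<And>i. i \<in> {1..<m} \<Longrightarrow> r (hecke_gen n i) = pure_tensor A B (hecke_gen m i) \<one>\<^bsub>B\<^esub>"
    "\<And>i. i \<in> {1..<n - m} \<Longrightarrow> r (hecke_gen n (i + m)) = pure_tensor A B \<one>\<^bsub>A\<^esub> (hecke_gen (n - m) i)"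
    by (rule retraction) (rule that)
  note fD = algebra_homD[OF f(1)] and gD = algebra_homD[OF g(1)] and rD = algebra_homD[OF r(1)]
  let ?SA = "hecke_gen m ` {1..<m} \<union> {c \<odot>\<^bsub>A\<^esub> \<one>\<^bsub>A\<^esub> | c. True}"
  let ?SB = "hecke_gen (n - m) ` {1..<n - m} \<union> {c \<odot>\<^bsub>B\<^esub> \<one>\<^bsub>B\<^esub> | c. True}"
  have SA: "?SA \<subseteq> carrier A" using Hm.hecke_gen_closed by auto
  have SB: "?SB \<subseteq> carrier B" using Hk.hecke_gen_closed by auto
  have scalar_comm: "(c \<odot>\<^bsub>hecke n\<^esub> \<one>\<^bsub>hecke n\<^esub>) \<otimes>\<^bsub>hecke n\<^esub> x = x \<otimes>\<^bsub>hecke n\<^esub> (c \<odot>\<^bsub>hecke n\<^esub> \<one>\<^bsub>hecke n\<^esub>)"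
    if "x \<in> carrier (hecke n)" for c x
    using that Hn.H.scale_mult_left[of "\<one>\<^bsub>hecke n\<^esub>" x c] Hn.H.scale_mult_right[of x "\<one>\<^bsub>hecke n\<^esub>" c] by simp
  have gens_comm: "x \<otimes>\<^bsub>hecke n\<^esub> y = y \<otimes>\<^bsub>hecke n\<^esub> x" if x: "x \<in> f ` ?SA" and y: "y \<in> g ` ?SB" for x y
  proof -
    have xc: "x \<in> carrier (hecke n)" and yc: "y \<in> carrier (hecke n)"
      using x y SA SB fD(2) gD(2) by blast+
    consider c where "x = c \<odot>\<^bsub>hecke n\<^esub> \<one>\<^bsub>hecke n\<^esub>" | c where "y = c \<odot>\<^bsub>hecke n\<^esub> \<one>\<^bsub>hecke n\<^esub>"
      | i j where "i \<in> {1..<m}" "j \<in> {1..<n - m}" "x = hecke_gen n i" "y = hecke_gen n (j + m)"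
      using x y f(2) g(2) fD(5,6) gD(5,6) by auto
    then show ?thesis
    proof cases
      case 1
      then show ?thesis using scalar_comm yc by simp
    next
      case 2
      then show ?thesis using scalar_comm[OF xc] by simp
    next
      \<comment> \<open>Here \<open>i < m\<close> and \<open>j + m > m\<close>, so the indices
        differ by at least 2. Leaving out \<open>T\<^sub>m\<close> is what makes the two halves
        commute.\<close>
      case 3
      then show ?thesis
        by (simp only:) (rule Hn.hecke_gen_rels(3), use m_le in auto)
    qed
  qed
  have fSA: "f ` ?SA \<subseteq> carrier (hecke n)" and gSB: "g ` ?SB \<subseteq> carrier (hecke n)"
    using SA SB fD(2) gD(2) by blast+
  \<comment> \<open>Commutation spreads from generators in two rounds: a fixed generator
    \<open>x\<close> of the left image commutes with every \<open>g b\<close>, and then a fixed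
    \<open>g b\<close> commutes with every \<open>f a\<close>.\<close>
  have comm: "f a \<otimes>\<^bsub>hecke n\<^esub> g b = g b \<otimes>\<^bsub>hecke n\<^esub> f a" if a: "a \<in> carrier A" and b: "b \<in> carrier B" for a b
  proof (rule Hn.H.commutes_generate_ring[OF fSA])
    show "g b \<in> carrier (hecke n)" using b gD by blast
    show "f a \<in> generate_ring (hecke n) (f ` ?SA)"
      using generate_ring_image[OF Hm.H.ring_axioms Hn.H.ring_axioms fD(1) SA] Hm.hecke_generated a by blast
    fix x assume x: "x \<in> f ` ?SA"
    have "g b \<otimes>\<^bsub>hecke n\<^esub> x = x \<otimes>\<^bsub>hecke n\<^esub> g b"
    proof (rule Hn.H.commutes_generate_ring[OF gSB])
      show "x \<in> carrier (hecke n)" using x fSA by blast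
      show "g b \<in> generate_ring (hecke n) (g ` ?SB)"
        using generate_ring_image[OF Hk.H.ring_axioms Hn.H.ring_axioms gD(1) SB] Hk.hecke_generated b by blast
      show "y \<otimes>\<^bsub>hecke n\<^esub> x = x \<otimes>\<^bsub>hecke n\<^esub> y" if "y \<in> g ` ?SB" for y
        using gens_comm[OF x that] by simp
    qed
    then show "x \<otimes>\<^bsub>hecke n\<^esub> g b = g b \<otimes>\<^bsub>hecke n\<^esub> x" by simp
  qed
  obtain \<iota> where \<iota>: "\<iota> \<in> algebra_hom TT.T (hecke n)"
    and \<iota>_pure: "\<And>a b. \<lbrakk>a \<in> carrier A; b \<in> carrier B\<rbrakk> \<Longrightarrow> \<iota> (pure_tensor A B a b) = f a \<otimes>\<^bsub>hecke n\<^esub> g b"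
    by (rule TT.tensor_algebra_lift[OF Hn.H.complex_algebra_axioms f(1) g(1) comm]) (assumption+, rule that)
  note \<iota>D = algebra_homD[OF \<iota>]
  have \<iota>1: "\<iota> (pure_tensor A B (hecke_gen m i) \<one>\<^bsub>B\<^esub>) = hecke_gen n i" if "i \<in> {1..<m}" for i
    using \<iota>_pure[OF Hm.hecke_gen_closed[OF that] Hk.H.one_closed] f(2)[OF that] gD(5) fD(2)[OF Hm.hecke_gen_closed[OF that]]
    by simp
  have \<iota>2: "\<iota> (pure_tensor A B \<one>\<^bsub>A\<^esub> (hecke_gen (n - m) i)) = hecke_gen n (i + m)" if "i \<in> {1..<n - m}" for i
    using \<iota>_pure[OF Hm.H.one_closed Hk.hecke_gen_closed[OF that]] g(2)[OF that] fD(5) gD(2)[OF Hk.hecke_gen_closed[OF that]]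
    by simp
  have gens_image: "\<iota> ` tensor_gens = hecke_gen n ` ({1..<n} - {m})"
  proof -
    have "\<iota> ` tensor_gens = hecke_gen n ` {1..<m} \<union> hecke_gen n ` (\<lambda>i. i + m) ` {1..<n - m}"
      unfolding tensor_gens_def image_Un image_image
      by (intro arg_cong2[where f = "(\<union>)"] image_cong refl \<iota>1 \<iota>2)
    also have "(\<lambda>i. i + m) ` {1..<n - m} = {m<..<n}"
    proof
      show "{m<..<n} \<subseteq> (\<lambda>i. i + m) ` {1..<n - m}"
      proof
        fix i assume "i \<in> {m<..<n}"
        then show "i \<in> (\<lambda>i. i + m) ` {1..<n - m}" by (intro image_eqI[of _ _ "i - m"]) auto
      qed
    qed auto
    also have "hecke_gen n ` {1..<m} \<union> hecke_gen n ` {m<..<n} = hecke_gen n ` ({1..<n} - {m})"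
      unfolding image_Un[symmetric] using m_le by (intro arg_cong[where f = "image _"]) auto
    finally show ?thesis .
  qed
  have "\<iota> ` {c \<odot>\<^bsub>TT.T\<^esub> \<one>\<^bsub>TT.T\<^esub> | c. True} = (\<lambda>c. \<iota> (c \<odot>\<^bsub>TT.T\<^esub> \<one>\<^bsub>TT.T\<^esub>)) ` UNIV" by blast
  also have "\<dots> = {c \<odot>\<^bsub>hecke n\<^esub> \<one>\<^bsub>hecke n\<^esub> | c. True}"
    using \<iota>D(6)[OF TT.T.one_closed] \<iota>D(5) by auto
  finally have image: "\<iota> ` carrier TT.T = carrier (parabolic n m)"
    using generate_ring_image[OF TT.T.ring_axioms Hn.H.ring_axioms \<iota>D(1) tensor_gens_closed]
    by (simp only: tensor_generated[symmetric] image_Un gens_image)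
      (simp add: parabolic_def generated_subalgebra_def)
  have "r \<circ> \<iota> \<in> ring_hom TT.T TT.T" using \<iota>D(1) rD(1) by (rule ring_hom_trans)
  \<comment> \<open>\<open>r \<circ> \<iota>\<close> and the identity are ring homomorphisms, so it
    is enough that they agree on the generators, among them the scalar multiples of the
    unit.\<close>
  have inv: "r (\<iota> t) = t" if t: "t \<in> carrier TT.T" for t
  proof -
    have "(r \<circ> \<iota>) t = id t"
    proof (rule ring_hom_eq_on_generators[where h = "r \<circ> \<iota>" and h' = id, OF TT.T.ring_axioms TT.T.ring_axioms _ _ tensor_gens_closed])
      show "r \<circ> \<iota> \<in> ring_hom TT.T TT.T" by fact
      show "id \<in> ring_hom TT.T TT.T" by (simp add: ring_hom_def)
      show "t \<in> generate_ring TT.T (tensor_gens \<union> {c \<odot>\<^bsub>TT.T\<^esub> \<one>\<^bsub>TT.T\<^esub> | c. True})" using t tensor_generated by simp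
      fix x assume "x \<in> tensor_gens \<union> {c \<odot>\<^bsub>TT.T\<^esub> \<one>\<^bsub>TT.T\<^esub> | c. True}"
      then consider "x \<in> tensor_gens" | c where "x = c \<odot>\<^bsub>TT.T\<^esub> \<one>\<^bsub>TT.T\<^esub>" by blast
      then show "(r \<circ> \<iota>) x = id x"
      proof cases
        case 1
        then show ?thesis unfolding tensor_gens_def using \<iota>1 \<iota>2 r(2,3) by auto
      next
        case 2
        have "\<iota> x = c \<odot>\<^bsub>hecke n\<^esub> \<one>\<^bsub>hecke n\<^esub>" unfolding 2 \<iota>D(6)[OF TT.T.one_closed] \<iota>D(5) ..
        then have "r (\<iota> x) = c \<odot>\<^bsub>TT.T\<^esub> \<one>\<^bsub>TT.T\<^esub>" using rD(6)[OF Hn.H.one_closed] rD(5) by metis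
        then show ?thesis using 2 by simp
      qed
    qed
    then show ?thesis by simp
  qed
  have "inj_on \<iota> (carrier TT.T)" by (rule inj_on_inverseI[of _ r]) (rule inv)
  then have bij: "bij_betw \<iota> (carrier TT.T) (carrier (parabolic n m))"
    using image by (simp add: bij_betw_def)
  have "\<iota> \<in> ring_hom TT.T (parabolic n m)"
    unfolding ring_hom_def
    using \<iota>D bij_betwE[OF bij]
    by (auto simp: parabolic_def generated_subalgebra_def simp del: TT.tensor_algebra_simps)
  then have "\<iota> \<in> algebra_iso TT.T (parabolic n m)"
    using bij \<iota>D(6) unfolding algebra_iso_def ring_iso_def
    by (simp add: parabolic_def generated_subalgebra_def del: TT.tensor_algebra_simps)
  moreover have "\<iota> (pure_tensor A B \<one>\<^bsub>A\<^esub> (hecke_gen (n - m) (i - m))) = hecke_gen n i" if "i \<in> {m<..<n}" for i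
  proof -
    have "i - m \<in> {1..<n - m}" "i - m + m = i" using that by auto
    then show ?thesis using \<iota>2[of "i - m"] by simp
  qed
  ultimately have "parabolic_identification n m \<iota>"
    using \<iota>1 by (auto simp: parabolic_identification_def)
  then show thesis using \<iota> \<iota>1 \<iota>2 that by blast
qed

end

section \<open>The modules of reverse composition tableaux\<close>

lemma SRCT_I:
  assumes "\<tau> \<in> extensional (skew_cells \<alpha> \<beta>)"
    and "bij_betw \<tau> (skew_cells \<alpha> \<beta>) {1..skew_size \<alpha> \<beta>}"
    and "\<And>i j j'. \<lbrakk>(i, j) \<in> skew_cells \<alpha> \<beta>; (i, j') \<in> skew_cells \<alpha> \<beta>; j < j'\<rbrakk> \<Longrightarrow> \<tau> (i, j) > \<tau> (i, j')"
    and "\<And>i i'. \<lbrakk>(i, 1) \<in> skew_cells \<alpha> \<beta>; (i', 1) \<in> skew_cells \<alpha> \<beta>; i < i'\<rbrakk> \<Longrightarrow> \<tau> (i, 1) < \<tau> (i', 1)"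
    and "\<And>i j k. \<lbrakk>i < j; (j, k + 1) \<in> skew_cells \<alpha> \<beta>; (i, k) \<in> cells \<alpha>;
        entry \<alpha> \<beta> \<tau> (i, k) > entry \<alpha> \<beta> \<tau> (j, k + 1)\<rbrakk> \<Longrightarrow>
      (i, k + 1) \<in> cells \<alpha> \<and> entry \<alpha> \<beta> \<tau> (i, k + 1) > entry \<alpha> \<beta> \<tau> (j, k + 1)"
  shows "\<tau> \<in> SRCT \<alpha> \<beta>"
  using assms unfolding SRCT_def by blast

lemma SRCT_D:
  assumes "\<tau> \<in> SRCT \<alpha> \<beta>"
  shows "\<tau> \<in> extensional (skew_cells \<alpha> \<beta>)"
    and "bij_betw \<tau> (skew_cells \<alpha> \<beta>) {1..skew_size \<alpha> \<beta>}"
    and "\<And>i j j'. \<lbrakk>(i, j) \<in> skew_cells \<alpha> \<beta>; (i, j') \<in> skew_cells \<alpha> \<beta>; j < j'\<rbrakk> \<Longrightarrow> \<tau> (i, j) > \<tau> (i, j')"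
    and "\<And>i i'. \<lbrakk>(i, 1) \<in> skew_cells \<alpha> \<beta>; (i', 1) \<in> skew_cells \<alpha> \<beta>; i < i'\<rbrakk> \<Longrightarrow> \<tau> (i, 1) < \<tau> (i', 1)"
    and "\<And>i j k. \<lbrakk>i < j; (j, k + 1) \<in> skew_cells \<alpha> \<beta>; (i, k) \<in> cells \<alpha>;
        entry \<alpha> \<beta> \<tau> (i, k) > entry \<alpha> \<beta> \<tau> (j, k + 1)\<rbrakk> \<Longrightarrow>
      (i, k + 1) \<in> cells \<alpha> \<and> entry \<alpha> \<beta> \<tau> (i, k + 1) > entry \<alpha> \<beta> \<tau> (j, k + 1)"
  using assms unfolding SRCT_def by blast+

text \<open>An adjacent transposition reverses exactly one pair of values; every tableau condition
  is an inequality between entries, so only comparisons of \<open>i\<close> with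
  \<open>i + 1\<close> are at risk.\<close>

lemma transpose_less:
  fixes a b i :: nat
  assumes "a < b" "\<not> (a = i \<and> b = i + 1)"
  shows "transpose i (i + 1) a < transpose i (i + 1) b"
  using assms by (auto simp: transpose_def)

text \<open>\<open>x\<close> is meant as the cell of \<open>i\<close> and \<open>y\<close> as the
  cell of \<open>i + 1\<close>. Stated for cells and not for a tableau, the condition can be
  followed through swaps of entries and shifts of the diagram.\<close>

definition attacking_cells :: "nat \<times> nat \<Rightarrow> nat \<times> nat \<Rightarrow> bool"
  where "attacking_cells x y \<longleftrightarrow> snd x = snd y \<or> (snd y = snd x + 1 \<and> fst x < fst y)"

lemma attacking_iff: "attacking \<alpha> \<beta> \<tau> i \<longleftrightarrow> attacking_cells (position \<alpha> \<beta> \<tau> i) (position \<alpha> \<beta> \<tau> (i + 1))"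
  unfolding attacking_def attacking_cells_def by (auto simp: Let_def case_prod_unfold)

section \<open>The operators on fillings and their relations\<close>

locale skew_shape =
  fixes \<alpha> \<beta> :: "nat list"
begin

abbreviation "X \<equiv> skew_cells \<alpha> \<beta>"
abbreviation "N \<equiv> skew_size \<alpha> \<beta>"
abbreviation "pos \<equiv> position \<alpha> \<beta>"
abbreviation "sw \<equiv> swap_entries \<alpha> \<beta>"
abbreviation "opr \<equiv> pi_op \<alpha> \<beta>"

definition fillings :: "(nat \<times> nat \<Rightarrow> nat) set"
  where "fillings = {\<tau> \<in> extensional X. bij_betw \<tau> X {1..N}}"

lemma SRCT_fillings: "\<tau> \<in> SRCT \<alpha> \<beta> \<Longrightarrow> \<tau> \<in> fillings"
  using SRCT_D(1,2)[of \<tau> \<alpha> \<beta>] by (simp add: fillings_def)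

lemma pos_mem: "\<lbrakk>\<tau> \<in> fillings; k \<in> {1..N}\<rbrakk> \<Longrightarrow> pos \<tau> k \<in> X"
  unfolding fillings_def position_def by (auto simp: bij_betw_def intro: inv_into_into)

lemma pos_val: "\<lbrakk>\<tau> \<in> fillings; k \<in> {1..N}\<rbrakk> \<Longrightarrow> \<tau> (pos \<tau> k) = k"
  unfolding fillings_def position_def by (auto simp: bij_betw_def f_inv_into_f)

lemma pos_eqI: "\<lbrakk>\<tau> \<in> fillings; x \<in> X; \<tau> x = k\<rbrakk> \<Longrightarrow> pos \<tau> k = x"
  unfolding fillings_def position_def by (auto simp: bij_betw_def)

lemma sw_apply: "x \<in> X \<Longrightarrow> sw i \<tau> x = transpose i (i + 1) (\<tau> x)"
  by (simp add: swap_entries_def)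

lemma sw_fillings:
  assumes "\<tau> \<in> fillings" "i \<in> {1..<N}"
  shows "sw i \<tau> \<in> fillings"
proof -
  have "bij_betw \<tau> X {1..N}" using assms by (simp add: fillings_def)
  moreover have "bij_betw (transpose i (i + 1)) {1..N} {1..N}"
    using assms(2) by (intro bij_betw_byWitness[where f' = "transpose i (i + 1)"]) (auto simp: transpose_def)
  ultimately have "bij_betw (transpose i (i + 1) \<circ> \<tau>) X {1..N}" by (rule bij_betw_trans)
  then have "bij_betw (sw i \<tau>) X {1..N}"
    by (rule iffD1[OF bij_betw_cong, rotated]) (simp add: sw_apply)
  then show ?thesis by (simp add: fillings_def swap_entries_def)
qed

lemma pos_sw:
  assumes \<tau>: "\<tau> \<in> fillings" and i: "i \<in> {1..<N}" and k: "k \<in> {1..N}"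
  shows "pos (sw i \<tau>) k = pos \<tau> (transpose i (i + 1) k)"
proof -
  define k' where "k' = transpose i (i + 1) k"
  have k': "k' \<in> {1..N}" "transpose i (i + 1) k' = k" using i k by (auto simp: k'_def transpose_def)
  show ?thesis
    unfolding k'_def[symmetric]
    by (rule pos_eqI[OF sw_fillings[OF \<tau> i] pos_mem[OF \<tau> k'(1)]])
      (simp only: sw_apply pos_mem[OF \<tau> k'(1)] pos_val[OF \<tau> k'(1)] k'(2))
qed

lemma pos_sw_cases:
  assumes "\<tau> \<in> fillings" "i \<in> {1..<N}" "j = i + 1"
  shows "pos (sw i \<tau>) i = pos \<tau> j" "pos (sw i \<tau>) j = pos \<tau> i"
    "\<lbrakk>k \<in> {1..N}; k \<noteq> i; k \<noteq> j\<rbrakk> \<Longrightarrow> pos (sw i \<tau>) k = pos \<tau> k"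
  using pos_sw[OF assms(1,2), of i] pos_sw[OF assms(1,2), of j] pos_sw[OF assms(1,2), of k] assms(2,3)
  by auto

text \<open>The outcome depends only on the cells of the two entries. Naming
  \<open>j = i + 1\<close> keeps arithmetic out of the case analyses for the relations.\<close>

lemma pi_op_cells:
  assumes "i \<in> {1..<N}" "j = i + 1"
  shows "opr i \<tau> = (if snd (pos \<tau> j) < snd (pos \<tau> i) then Poly_Mapping.single \<tau> 1
    else if attacking_cells (pos \<tau> i) (pos \<tau> j) then 0 else Poly_Mapping.single (sw i \<tau>) 1)"
  using assms by (auto simp: pi_op_def Des_def attacking_iff)

text \<open>Only the comparison of the cells of \<open>i\<close> and \<open>i + 1\<close> changes. A
  non-attacking descent has \<open>i\<close> in a strictly smaller column than \<open>i + 1\<close>,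
  so the reversed pair cannot be one that the row condition, the first column or the conclusion of
  the triple rule asks for. In the premise of the triple rule it could occur only as an attacking
  pair.\<close>

lemma swap_SRCT:
  assumes \<tau>: "\<tau> \<in> SRCT \<alpha> \<beta>" and i: "i \<in> Des \<alpha> \<beta> \<tau>" and na: "\<not> attacking \<alpha> \<beta> \<tau> i"
  shows "sw i \<tau> \<in> SRCT \<alpha> \<beta>"
proof -
  note D = SRCT_D[OF \<tau>] and F = SRCT_fillings[OF \<tau>]
  have iN: "i \<in> {1..<N}" and cols: "snd (pos \<tau> i) < snd (pos \<tau> (i + 1))"
    and nx: "\<not> (snd (pos \<tau> (i + 1)) = snd (pos \<tau> i) + 1 \<and> fst (pos \<tau> i) < fst (pos \<tau> (i + 1)))"
    using i na by (auto simp: Des_def attacking_iff attacking_cells_def)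
  have less: "sw i \<tau> x < sw i \<tau> y"
    if "x \<in> X" "y \<in> X" "\<tau> x < \<tau> y" "\<not> (x = pos \<tau> i \<and> y = pos \<tau> (i + 1))" for x y
  proof -
    have "\<not> (\<tau> x = i \<and> \<tau> y = i + 1)"
    proof
      assume e: "\<tau> x = i \<and> \<tau> y = i + 1"
      show False
        using that(4) pos_eqI[OF F that(1) conjunct1[OF e]] pos_eqI[OF F that(2) conjunct2[OF e]] by simp
    qed
    then show ?thesis using that transpose_less[of "\<tau> x" "\<tau> y" i] by (simp add: sw_apply)
  qed
  have less': "\<tau> x < \<tau> y"
    if "x \<in> X" "y \<in> X" "sw i \<tau> x < sw i \<tau> y" "\<not> (x = pos \<tau> (i + 1) \<and> y = pos \<tau> i)" for x y
  proof -
    have "\<not> (\<tau> x = i + 1 \<and> \<tau> y = i)"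
    proof
      assume e: "\<tau> x = i + 1 \<and> \<tau> y = i"
      show False
        using that(4) pos_eqI[OF F that(1) conjunct1[OF e]] pos_eqI[OF F that(2) conjunct2[OF e]] by simp
    qed
    then have "\<not> (transpose i (i + 1) (\<tau> x) = i \<and> transpose i (i + 1) (\<tau> y) = i + 1)"
      by (auto simp: transpose_def split: if_splits)
    then show ?thesis
      using that(1-3) transpose_less[of "transpose i (i + 1) (\<tau> x)" "transpose i (i + 1) (\<tau> y)" i]
      by (simp add: sw_apply)
  qed
  show ?thesis
  proof (rule SRCT_I)
    show "sw i \<tau> \<in> extensional X" "bij_betw (sw i \<tau>) X {1..N}"
      using sw_fillings[OF F iN] by (simp_all add: fillings_def)
    show "sw i \<tau> (r, j) > sw i \<tau> (r, j')" if "(r, j) \<in> X" "(r, j') \<in> X" "j < j'" for r j j'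
    proof (rule less[OF that(2,1) D(3)[OF that]])
      show "\<not> ((r, j') = pos \<tau> i \<and> (r, j) = pos \<tau> (i + 1))"
      proof
        assume e: "(r, j') = pos \<tau> i \<and> (r, j) = pos \<tau> (i + 1)"
        show False using cols that unfolding conjunct1[OF e, symmetric] conjunct2[OF e, symmetric] by simp
      qed
    qed
    show "sw i \<tau> (r, 1) < sw i \<tau> (r', 1)" if "(r, 1) \<in> X" "(r', 1) \<in> X" "r < r'" for r r'
    proof (rule less[OF that(1,2) D(4)[OF that]])
      show "\<not> ((r, 1) = pos \<tau> i \<and> (r', 1) = pos \<tau> (i + 1))" using cols by (metis less_irrefl snd_conv)
    qed
    fix a b k
    assume ab: "a < b" and bX: "(b, k + 1) \<in> X" and aX: "(a, k) \<in> cells \<alpha>"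
      and e: "entry \<alpha> \<beta> (sw i \<tau>) (a, k) > entry \<alpha> \<beta> (sw i \<tau>) (b, k + 1)"
    have b_in: "(b, k + 1) \<notin> inner_cells \<alpha> \<beta>" using bX by (simp add: skew_cells_def)
    \<comment> \<open>The premise is given for the swapped filling and has to be pulled back to
      \<open>\<tau>\<close>. This would fail only with \<open>i\<close> at \<open>(a, k)\<close> and
      \<open>i + 1\<close> at \<open>(b, k + 1)\<close>, and since \<open>a < b\<close> these cells
      attack.\<close>
    have "entry \<alpha> \<beta> \<tau> (a, k) > entry \<alpha> \<beta> \<tau> (b, k + 1)"
    proof (cases "(a, k) \<in> inner_cells \<alpha> \<beta>")
      case True
      then show ?thesis using b_in by (simp add: entry_def)
    next
      case False
      then have aX': "(a, k) \<in> X" using aX by (simp add: skew_cells_def)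
      have "sw i \<tau> (b, k + 1) < sw i \<tau> (a, k)" using e False b_in by (simp add: entry_def)
      then have "\<tau> (b, k + 1) < \<tau> (a, k)"
      proof (rule less'[OF bX aX'])
        show "\<not> ((b, k + 1) = pos \<tau> (i + 1) \<and> (a, k) = pos \<tau> i)"
        proof
          assume e: "(b, k + 1) = pos \<tau> (i + 1) \<and> (a, k) = pos \<tau> i"
          show False using nx ab unfolding conjunct1[OF e, symmetric] conjunct2[OF e, symmetric] by simp
        qed
      qed
      then show ?thesis using False b_in by (simp add: entry_def)
    qed
    from D(5)[OF ab bX aX this] have c: "(a, k + 1) \<in> cells \<alpha>"
      and e': "entry \<alpha> \<beta> \<tau> (a, k + 1) > entry \<alpha> \<beta> \<tau> (b, k + 1)" by blast+
    have "entry \<alpha> \<beta> (sw i \<tau>) (a, k + 1) > entry \<alpha> \<beta> (sw i \<tau>) (b, k + 1)"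
    proof (cases "(a, k + 1) \<in> inner_cells \<alpha> \<beta>")
      case True
      then show ?thesis using b_in by (simp add: entry_def)
    next
      case False
      then have aX': "(a, k + 1) \<in> X" using c by (simp add: skew_cells_def)
      have "\<tau> (b, k + 1) < \<tau> (a, k + 1)" using e' False b_in by (simp add: entry_def)
      then have "sw i \<tau> (b, k + 1) < sw i \<tau> (a, k + 1)"
      proof (rule less[OF bX aX'])
        show "\<not> ((b, k + 1) = pos \<tau> i \<and> (a, k + 1) = pos \<tau> (i + 1))" using cols by (metis less_irrefl snd_conv)
      qed
      then show ?thesis using False b_in by (simp add: entry_def)
    qed
    with c show "(a, k + 1) \<in> cells \<alpha> \<and> entry \<alpha> \<beta> (sw i \<tau>) (a, k + 1) > entry \<alpha> \<beta> (sw i \<tau>) (b, k + 1)" by blast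
  qed
qed

lemma keys_pi_op: "\<tau> \<in> SRCT \<alpha> \<beta> \<Longrightarrow> Poly_Mapping.keys (opr i \<tau>) \<subseteq> SRCT \<alpha> \<beta>"
  using swap_SRCT[of \<tau> i] by (auto simp: pi_op_def)

text \<open>The relations already hold on arbitrary bijective fillings: \<open>\<pi>\<^sub>i\<close> is a sorting step on the columns of
  consecutive entries in which the attacking pairs are killed instead of exchanged.\<close>

lemma pi_op_idem:
  assumes "\<tau> \<in> fillings" "i \<in> {1..<N}"
  shows "linear_extend (opr i) (opr i \<tau>) = opr i \<tau>"
proof -
  define j where "j = i + 1"
  show ?thesis
    by (auto simp: pi_op_cells[OF assms(2) j_def] pos_sw_cases[OF assms j_def] attacking_cells_def)
qed

lemma pi_op_commute:
  assumes "\<tau> \<in> fillings" "i \<in> {1..<N}" "k \<in> {1..<N}" "\<bar>int i - int k\<bar> \<ge> 2"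
  shows "linear_extend (opr i) (opr k \<tau>) = linear_extend (opr k) (opr i \<tau>)"
proof -
  define j l where j: "j = i + 1" and l: "l = k + 1"
  have ne: "i \<noteq> k" "i \<noteq> l" "j \<noteq> k" "j \<noteq> l" "k \<noteq> i" "l \<noteq> i" "k \<noteq> j" "l \<noteq> j"
    "i \<in> {1..N}" "j \<in> {1..N}" "k \<in> {1..N}" "l \<in> {1..N}"
    using assms by (auto simp: j l)
  have s: "sw i (sw k \<tau>) = sw k (sw i \<tau>)"
    using ne unfolding j l by (intro ext) (simp add: swap_entries_def transpose_def)
  show ?thesis
    using ne
    by (simp add: pi_op_cells[OF assms(2) j] pi_op_cells[OF assms(3) l] s
        pos_sw_cases[OF assms(1,2) j] pos_sw_cases[OF assms(1,3) l])
qed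

text \<open>Both sides are a bubble sort on the columns of three consecutive entries, with the
  adjacent exchanges performed in the two possible orders. If all three exchanges happen,
  \<open>s\<close> identifies the results; the remaining cases compare which pairs are left alone or
  killed.\<close>

lemma pi_op_braid:
  assumes \<tau>: "\<tau> \<in> fillings" and i: "i \<in> {1..<N}" and i': "i + 1 \<in> {1..<N}"
  shows "linear_extend (opr i) (linear_extend (opr (i + 1)) (opr i \<tau>)) =
    linear_extend (opr (i + 1)) (linear_extend (opr i) (opr (i + 1) \<tau>))"
proof -
  define j k where j: "j = i + 1" and k: "k = j + 1"
  have ne: "i \<noteq> j" "i \<noteq> k" "j \<noteq> k" "k \<noteq> i" "k \<in> {1..N}" "i \<in> {1..N}" and jN: "j \<in> {1..<N}"
    using assms by (auto simp: j k)
  have p: "pos (sw i \<sigma>) i = pos \<sigma> j" "pos (sw i \<sigma>) j = pos \<sigma> i" "pos (sw i \<sigma>) k = pos \<sigma> k"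
    "pos (sw j \<sigma>) i = pos \<sigma> i" "pos (sw j \<sigma>) j = pos \<sigma> k" "pos (sw j \<sigma>) k = pos \<sigma> j"
    "sw i \<sigma> \<in> fillings" "sw j \<sigma> \<in> fillings"
    if "\<sigma> \<in> fillings" for \<sigma>
    using ne pos_sw_cases[OF that i j] pos_sw_cases[OF that jN k] sw_fillings[OF that i] sw_fillings[OF that jN]
    by blast+
  have s: "sw i (sw j (sw i \<tau>)) = sw j (sw i (sw j \<tau>))"
    unfolding j by (intro ext) (auto simp: swap_entries_def transpose_def)
  let ?x = "pos \<tau> i" and ?y = "pos \<tau> j" and ?z = "pos \<tau> k"
  \<comment> \<open>All that the case split has to know about attacks: columns of an attacking pair
    weakly increase, and cells in one column always attack. The exact southeast condition is
    irrelevant for the braid relation.\<close>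
  have col: "attacking_cells u v \<Longrightarrow> snd u \<le> snd v" "\<not> attacking_cells u v \<Longrightarrow> snd u \<noteq> snd v" for u v
    by (auto simp: attacking_cells_def)
  show ?thesis
    unfolding j[symmetric]
    using col(1)[of ?x ?y] col(1)[of ?y ?z] col(1)[of ?x ?z] col(2)[of ?x ?y] col(2)[of ?y ?z] col(2)[of ?x ?z]
    by (cases "snd ?y < snd ?x"; cases "snd ?z < snd ?y"; cases "snd ?z < snd ?x";
        cases "attacking_cells ?x ?y"; cases "attacking_cells ?y ?z"; cases "attacking_cells ?x ?z";
        simp add: pi_op_cells[OF i j] pi_op_cells[OF jN k] p[OF \<tau>] p[OF p(7)[OF \<tau>]] p[OF p(8)[OF \<tau>]] s)
qed

definition act where "act i = linear_extend (opr i)"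

abbreviation "V \<equiv> {v. Poly_Mapping.keys v \<subseteq> SRCT \<alpha> \<beta>}"

lemma act_closed: "v \<in> V \<Longrightarrow> act i v \<in> V"
  using keys_linear_extend[of v "SRCT \<alpha> \<beta>" "opr i" "SRCT \<alpha> \<beta>"] keys_pi_op by (simp add: act_def)

lemma act_relations:
  assumes "v \<in> V"
  shows "i \<in> {1..<N} \<Longrightarrow> act i (act i v) = act i v"
    and "\<lbrakk>i \<in> {1..<N}; i + 1 \<in> {1..<N}\<rbrakk> \<Longrightarrow> act i (act (i + 1) (act i v)) = act (i + 1) (act i (act (i + 1) v))"
    and "\<lbrakk>i \<in> {1..<N}; j \<in> {1..<N}; \<bar>int i - int j\<bar> \<ge> 2\<rbrakk> \<Longrightarrow> act i (act j v) = act j (act i v)"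
proof -
  have v: "Poly_Mapping.keys v \<subseteq> SRCT \<alpha> \<beta>" using assms by simp
  show "act i (act i v) = act i v" if "i \<in> {1..<N}"
    using v
    by (induction v rule: finsupp_induct)
      (auto simp: act_def linear_extend_add linear_extend_scale pi_op_idem[OF SRCT_fillings that])
  show "act i (act (i + 1) (act i v)) = act (i + 1) (act i (act (i + 1) v))" if "i \<in> {1..<N}" "i + 1 \<in> {1..<N}"
    using v
    by (induction v rule: finsupp_induct)
      (auto simp: act_def linear_extend_add linear_extend_scale pi_op_braid[OF SRCT_fillings that, simplified])
  show "act i (act j v) = act j (act i v)" if "i \<in> {1..<N}" "j \<in> {1..<N}" "\<bar>int i - int j\<bar> \<ge> 2"
    using v
  proof (induction v rule: finsupp_induct)
    case (single x a)
    then show ?case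
      by (simp only: act_def linear_extend_single linear_extend_scale pi_op_commute[OF SRCT_fillings that])
  qed (simp_all add: act_def linear_extend_add)
qed

section \<open>The action of words and the module over the 0-Hecke algebra\<close>

abbreviation "wa \<equiv> word_action \<alpha> \<beta>"

lemma foldr_act_linear:
  "foldr (\<lambda>i. linear_extend (opr i)) w (v + v') = foldr (\<lambda>i. linear_extend (opr i)) w v + foldr (\<lambda>i. linear_extend (opr i)) w v'"
  "foldr (\<lambda>i. linear_extend (opr i)) w (scale c v) = scale c (foldr (\<lambda>i. linear_extend (opr i)) w v)"
  "foldr (\<lambda>i. linear_extend (opr i)) w 0 = 0"
  by (induction w) (simp_all add: linear_extend_add linear_extend_scale)

lemma wa_add_right: "wa p (v + v') = wa p v + wa p v'"
  by (simp add: word_action_def foldr_act_linear linear_extend_fun_add)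

lemma wa_0_right [simp]: "wa p 0 = 0"
  by (simp add: word_action_def foldr_act_linear)

lemma wa_add_left: "wa (p + q) v = wa p v + wa q v"
  by (simp add: word_action_def linear_extend_add)

lemma wa_scale_left: "wa (scale c p) v = scale c (wa p v)"
  by (simp add: word_action_def linear_extend_scale)

lemma wa_0_left [simp]: "wa 0 v = 0"
  by (simp add: word_action_def)

lemma wa_diff_left: "wa (p - q) v = wa p v - wa q v"
  using wa_add_left[of "p - q" q v] by simp

lemma wa_single: "wa (Poly_Mapping.single w c) v = scale c (foldr (\<lambda>i. linear_extend (opr i)) w v)"
  by (simp add: word_action_def)

lemma wa_gen: "wa (gen i) v = act i v"
  by (simp add: gen_def wa_single act_def)

lemma wa_one: "wa 1 v = v"
  by (simp add: wa_single zero_list_def flip: single_one)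

lemma wa_mult: "wa (p * q) v = wa p (wa q v)"
proof -
  have "Poly_Mapping.keys p \<subseteq> UNIV" by simp
  then show ?thesis
  proof (induction p rule: finsupp_induct)
    case (single u a)
    have "Poly_Mapping.keys q \<subseteq> UNIV" by simp
    then show ?case
    proof (induction q rule: finsupp_induct)
      case (single v b)
      then show ?case
        by (simp add: mult_single wa_single plus_list_def foldr_act_linear scale_mult)
    qed (simp_all add: distrib_left wa_add_left wa_add_right)
  qed (simp_all add: distrib_right wa_add_left)
qed

lemma wa_closed:
  assumes "v \<in> V"
  shows "wa p v \<in> V"
proof -
  have w: "foldr (\<lambda>i. linear_extend (opr i)) w v \<in> V" for w
    using assms act_closed by (induction w) (auto simp: act_def)
  have "Poly_Mapping.keys p \<subseteq> UNIV" by simp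
  then have "Poly_Mapping.keys (wa p v) \<subseteq> SRCT \<alpha> \<beta>"
    unfolding word_action_def by (rule keys_linear_extend) (use w in auto)
  then show ?thesis by simp
qed

sublocale hecke_algebra N .

text \<open>The annihilator \<open>J\<close> of the space \<open>V\<close> in the free algebra is a
  two-sided ideal; it absorbs factors on the right because the action preserves \<open>V\<close>. It
  contains the Hecke relations by \<open>act_relations\<close>, hence the ideal they
  generate.\<close>

lemma ideal_acts_zero:
  assumes p: "p \<in> hecke_ideal N" and v: "v \<in> V"
  shows "wa p v = 0"
proof -
  define J where "J = {p \<in> C. \<forall>v\<in>V. wa p v = 0}"
  have C: "p + q \<in> C" "p * q \<in> C" "- p \<in> C" if "p \<in> C" "q \<in> C" for p q
    using that FA.a_closed[of p q] FA.m_closed[of p q] by auto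
  have minv: "\<ominus>\<^bsub>free_algebra {1..<N}\<^esub> p = - p" if "p \<in> C" for p
    by (rule FA.minus_equality) (use that in auto)
  have "ideal J (free_algebra {1..<N})"
  proof (rule idealI[OF FA.ring_axioms])
    show "subgroup J (add_monoid (free_algebra {1..<N}))"
    proof (rule FA.add.subgroupI)
      show "J \<subseteq> carrier (free_algebra {1..<N})" unfolding J_def by blast
      have "0 \<in> J" using FA.zero_closed by (simp add: J_def)
      then show "J \<noteq> {}" by blast
      fix p assume p: "p \<in> J"
      have "wa (- p) v = 0" if "v \<in> V" for v
        using p that wa_diff_left[of 0 p v] by (simp add: J_def)
      then show "\<ominus>\<^bsub>free_algebra {1..<N}\<^esub> p \<in> J"
        using p minv[of p] by (simp add: J_def)
      fix q assume q: "q \<in> J"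
      show "p \<oplus>\<^bsub>free_algebra {1..<N}\<^esub> q \<in> J"
        using p q C(1)[of p q] by (simp add: J_def wa_add_left)
    qed
    fix p x assume p: "p \<in> J" and x: "x \<in> carrier (free_algebra {1..<N})"
    show "x \<otimes>\<^bsub>free_algebra {1..<N}\<^esub> p \<in> J"
      using p x C(2)[of x p] by (simp add: J_def wa_mult)
    have "wa (p * x) v = 0" if "v \<in> V" for v
      using p wa_closed[OF that, of x] by (simp add: J_def wa_mult)
    then show "p \<otimes>\<^bsub>free_algebra {1..<N}\<^esub> x \<in> J"
      using p x C(2)[of p x] by (simp add: J_def)
  qed
  moreover have "hecke_rels N \<subseteq> J"
  proof
    fix r assume r: "r \<in> hecke_rels N"
    have "wa r v = 0" if v: "v \<in> V" for v
    proof -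
      from r consider (1) i where "i \<in> {1..<N}" "r = gen i * gen i - gen i"
        | (2) i where "i \<in> {1..<N}" "i + 1 \<in> {1..<N}"
          "r = gen i * gen (i + 1) * gen i - gen (i + 1) * gen i * gen (i + 1)"
        | (3) i j where "i \<in> {1..<N}" "j \<in> {1..<N}" "\<bar>int i - int j\<bar> \<ge> 2" "r = gen i * gen j - gen j * gen i"
        unfolding hecke_rels_def by blast
      then show ?thesis
      proof cases
        case 1
        then show ?thesis by (simp only: wa_diff_left wa_mult wa_gen act_relations(1)[OF v] diff_self)
      next
        case 2
        then show ?thesis by (simp only: wa_diff_left wa_mult wa_gen act_relations(2)[OF v] diff_self)
      next
        case 3
        show ?thesis
          unfolding 3(4) wa_diff_left wa_mult wa_gen act_relations(3)[OF v 3(1-3)] by simp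
      qed
    qed
    then show "r \<in> J" using r hecke_rels_subset by (auto simp: J_def simp del: free_algebra_simps)
  qed
  ultimately have "hecke_ideal N \<subseteq> J"
    unfolding hecke_ideal_def by (rule FA.genideal_minimal)
  then show ?thesis using p v by (auto simp: J_def)
qed

abbreviation "S \<equiv> srct_module \<alpha> \<beta>"

lemma srct_module_simps [simp]:
  "carrier S = V" "add S = (+)" "\<zero>\<^bsub>S\<^esub> = 0"
  by (simp_all add: srct_module_def)

text \<open>Representatives of one class differ by an element of the ideal, which acts as zero. So
  the image in the definition of \<open>srct_module\<close> is a singleton and
  \<open>the_elem\<close> is well defined.\<close>

lemma smult_cls:
  assumes "v \<in> V"
  shows "cls p \<odot>\<^bsub>S\<^esub> v = wa p v"
proof -
  have "wa q v = wa p v" if "q \<in> cls p" for q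
    using ideal_acts_zero[of "q - p" v] that assms by (simp add: mem_cls wa_diff_left)
  moreover have "p \<in> cls p" using I.zero_closed by (simp add: mem_cls)
  ultimately have "(\<lambda>p. wa p v) ` cls p = {wa p v}" by blast
  then show ?thesis by (simp add: srct_module_def)
qed

lemma left_module_srct: "left_module (hecke N) S"
proof (rule left_module.intro[OF ring_hecke])
  have "v + w \<in> V" "- v \<in> V" if "v \<in> V" "w \<in> V" for v w
    using that keys_add_subset[of v "SRCT \<alpha> \<beta>" w] by auto
  then show "abelian_group S"
    by (intro abelian_groupI) (auto simp: algebra_simps keys_add_subset intro!: exI[of _ "- _"])
  show "left_module_axioms (hecke N) S"
  proof
    fix v assume "v \<in> carrier S"
    then have v: "v \<in> V" by simp
    show "\<one>\<^bsub>hecke N\<^esub> \<odot>\<^bsub>S\<^esub> v = v" using v by (simp only: cls_hom smult_cls wa_one)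
    fix a assume "a \<in> carrier (hecke N)"
    then obtain p where p: "p \<in> C" "a = cls p" by (rule hecke_cases)
    show "a \<odot>\<^bsub>S\<^esub> v \<in> carrier S" using p wa_closed[OF v] by (simp only: smult_cls[OF v] srct_module_simps)
    {
      fix b assume "b \<in> carrier (hecke N)"
      then obtain q where q: "q \<in> C" "b = cls q" by (rule hecke_cases)
      show "(a \<oplus>\<^bsub>hecke N\<^esub> b) \<odot>\<^bsub>S\<^esub> v = a \<odot>\<^bsub>S\<^esub> v \<oplus>\<^bsub>S\<^esub> b \<odot>\<^bsub>S\<^esub> v"
        using p q v by (simp only: cls_hom smult_cls wa_add_left srct_module_simps)
      show "(a \<otimes>\<^bsub>hecke N\<^esub> b) \<odot>\<^bsub>S\<^esub> v = a \<odot>\<^bsub>S\<^esub> (b \<odot>\<^bsub>S\<^esub> v)"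
        using p q v wa_closed[OF v] by (simp only: cls_hom smult_cls wa_mult)
    }
    fix w assume "w \<in> carrier S"
    then have w: "w \<in> V" by simp
    then have "v + w \<in> V" using v keys_add_subset[of v "SRCT \<alpha> \<beta>" w] by simp
    then show "a \<odot>\<^bsub>S\<^esub> (v \<oplus>\<^bsub>S\<^esub> w) = a \<odot>\<^bsub>S\<^esub> v \<oplus>\<^bsub>S\<^esub> a \<odot>\<^bsub>S\<^esub> w"
      using p v w by (simp only: smult_cls wa_add_right srct_module_simps)
  qed
qed

lemma gen_smult: "\<lbrakk>i \<in> {1..<N}; v \<in> V\<rbrakk> \<Longrightarrow> hecke_gen N i \<odot>\<^bsub>S\<^esub> v = act i v"
  by (simp only: hecke_gen_eq smult_cls wa_gen)

lemma scalar_smult: "v \<in> V \<Longrightarrow> (c \<odot>\<^bsub>hecke N\<^esub> \<one>\<^bsub>hecke N\<^esub>) \<odot>\<^bsub>S\<^esub> v = scale c v"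
  using FA.one_closed by (simp only: cls_hom cls_smult smult_cls wa_scale_left wa_one free_algebra_simps)

end

section \<open>Cutting a tableau at an entry\<close>

lemma pair_set_eqI: "(\<And>i j. (i, j) \<in> A \<longleftrightarrow> (i, j) \<in> B) \<Longrightarrow> A = B"
  by auto

lemma mem_cells: "(i, j) \<in> cells \<alpha> \<longleftrightarrow> 1 \<le> i \<and> i \<le> length \<alpha> \<and> 1 \<le> j \<and> j \<le> \<alpha> ! (i - 1)"
  by (auto simp: cells_def)

lemma mem_inner_cells:
  "(i, j) \<in> inner_cells \<alpha> \<beta> \<longleftrightarrow>
    length \<alpha> - length \<beta> < i \<and> (i - (length \<alpha> - length \<beta>), j) \<in> cells \<beta>"
proof
  assume "(i, j) \<in> inner_cells \<alpha> \<beta>"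
  then obtain i' where "(i', j) \<in> cells \<beta>" "i = i' + (length \<alpha> - length \<beta>)"
    by (auto simp: inner_cells_def)
  then show "length \<alpha> - length \<beta> < i \<and> (i - (length \<alpha> - length \<beta>), j) \<in> cells \<beta>"
    by (auto simp: mem_cells)
next
  assume "length \<alpha> - length \<beta> < i \<and> (i - (length \<alpha> - length \<beta>), j) \<in> cells \<beta>"
  then show "(i, j) \<in> inner_cells \<alpha> \<beta>"
    unfolding inner_cells_def by (intro image_eqI[of _ _ "(i - (length \<alpha> - length \<beta>), j)"]) auto
qed

lemma inner_cells_empty [simp]: "inner_cells \<alpha> [] = {}"
  by (auto simp: inner_cells_def cells_def)

lemma skew_cells_empty [simp]: "skew_cells \<alpha> [] = cells \<alpha>"
  by (simp add: skew_cells_def)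

lemma skew_size_empty [simp]: "skew_size \<alpha> [] = sum_list \<alpha>"
  by (simp add: skew_size_def)

lemma entry_empty [simp]: "entry \<alpha> [] \<tau> x = enat (\<tau> x)"
  by (simp add: entry_def)

text \<open>Along a chain of covers, prepending a row raises the bottom-aligned offset by one and so
  keeps old rows facing the same rows, while an increment only lengthens a row of the larger
  diagram.\<close>

lemma comp_le_contained:
  assumes "\<beta> \<le>\<^sub>c \<alpha>"
  shows "length \<beta> \<le> length \<alpha>" "r < length \<beta> \<Longrightarrow> \<beta> ! r \<le> \<alpha> ! (r + (length \<alpha> - length \<beta>))"
proof -
  have "length \<beta> \<le> length \<alpha> \<and> (\<forall>r<length \<beta>. \<beta> ! r \<le> \<alpha> ! (r + (length \<alpha> - length \<beta>)))"
    using assms unfolding comp_le_def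
  proof (induction rule: rtranclp_induct)
    case base
    then show ?case by simp
  next
    case (step \<gamma> \<delta>)
    show ?case
      using step(2)
    proof cases
      case prepend
      then show ?thesis using step(3) by (auto simp: Suc_diff_le)
    next
      case (increment k)
      then show ?thesis using step(3) by (auto simp: nth_list_update intro: le_SucI)
    qed
  qed
  then show "length \<beta> \<le> length \<alpha>" "r < length \<beta> \<Longrightarrow> \<beta> ! r \<le> \<alpha> ! (r + (length \<alpha> - length \<beta>))"
    by blast+
qed

lemma comp_le_inner_subset:
  assumes "\<beta> \<le>\<^sub>c \<alpha>"
  shows "inner_cells \<alpha> \<beta> \<subseteq> cells \<alpha>"
proof
  fix x assume x: "x \<in> inner_cells \<alpha> \<beta>"
  obtain i j where ij: "x = (i, j)" by force
  define d where "d = length \<alpha> - length \<beta>"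
  have "d < i" "1 \<le> i - d" "i - d \<le> length \<beta>" "1 \<le> j" "j \<le> \<beta> ! (i - d - 1)"
    using x unfolding ij mem_inner_cells mem_cells d_def by auto
  moreover have "\<beta> ! (i - d - 1) \<le> \<alpha> ! (i - d - 1 + d)"
    unfolding d_def by (rule comp_le_contained(2)[OF assms]) (use calculation in \<open>auto simp: d_def\<close>)
  moreover have "i - d - 1 + d = i - 1" using \<open>d < i\<close> by simp
  moreover have "length \<alpha> = length \<beta> + d" using comp_le_contained(1)[OF assms] by (simp add: d_def)
  ultimately show "x \<in> cells \<alpha>" by (auto simp: ij mem_cells)
qed

text \<open>Positive parts leave a trace in the diagram: the topmost cell of column 1 reveals the
  number of rows, and the last cell of each row reveals its length.\<close>

lemma inner_cells_inj:
  assumes "inner_cells \<alpha> \<beta> = inner_cells \<alpha> \<gamma>" "length \<beta> \<le> length \<alpha>" "length \<gamma> \<le> length \<alpha>"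
    and "\<forall>b\<in>set \<beta>. 0 < b" "\<forall>c\<in>set \<gamma>. 0 < c"
  shows "\<beta> = \<gamma>"
proof -
  have len: "length \<gamma>' \<le> length \<beta>'"
    if eq: "inner_cells \<alpha> \<beta>' = inner_cells \<alpha> \<gamma>'" and l: "length \<gamma>' \<le> length \<alpha>" and p: "\<forall>c\<in>set \<gamma>'. 0 < c" for \<beta>' \<gamma>'
  proof (rule ccontr)
    assume a: "\<not> length \<gamma>' \<le> length \<beta>'"
    then have "0 < length \<gamma>'" by linarith
    then have "0 < \<gamma>' ! 0" using p by simp
    moreover have "1 \<le> length \<gamma>'" using \<open>0 < length \<gamma>'\<close> by linarith
    ultimately have "(length \<alpha> - length \<gamma>' + 1, 1) \<in> inner_cells \<alpha> \<gamma>'"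
      by (simp add: mem_inner_cells mem_cells Suc_le_eq)
    then show False using a l unfolding eq[symmetric] mem_inner_cells by auto
  qed
  have l: "length \<beta> = length \<gamma>"
    using len[OF assms(1,3,5)] len[OF assms(1)[symmetric] assms(2,4)] by simp
  have le: "\<beta>' ! r \<le> \<gamma>' ! r"
    if eq: "inner_cells \<alpha> \<beta>' = inner_cells \<alpha> \<gamma>'" and l: "length \<beta>' = length \<gamma>'" and r: "r < length \<beta>'"
      and p: "\<forall>b\<in>set \<beta>'. 0 < b" for \<beta>' \<gamma>' r
  proof -
    have "0 < \<beta>' ! r" using p r by (simp add: nth_mem)
    then have "(r + 1 + (length \<alpha> - length \<beta>'), \<beta>' ! r) \<in> inner_cells \<alpha> \<beta>'"
      using r by (simp add: mem_inner_cells mem_cells)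
    then show ?thesis unfolding eq using l by (simp add: mem_inner_cells mem_cells)
  qed
  show ?thesis
    using l le[OF assms(1) l _ assms(4)] le[OF assms(1)[symmetric] l[symmetric] _ assms(5)]
    by (intro nth_equalityI) (auto intro: antisym)
qed

text \<open>Passing from \<open>m\<close> to \<open>m + 1\<close> removes the cell of entry
  \<open>m + 1\<close>, the least one left. Decreasing rows put it at the end of its row. In column
  1, the increase down that column makes it the top row of \<open>\<beta>\<close>, and its removal
  undoes \<open>prepend\<close>. In a column \<open>c > 1\<close>, the triple rule forbids a row of
  length \<open>c - 1\<close> above it, which is the side condition of
  \<open>increment\<close>.\<close>

lemma exists_cut_shape:
  assumes T: "T \<in> SRCT \<alpha> []" and \<alpha>: "is_composition \<alpha> n" and "m \<le> n"
  shows "\<exists>\<beta>. is_composition \<beta> (n - m) \<and> \<beta> \<le>\<^sub>c \<alpha> \<and> inner_cells \<alpha> \<beta> = {x \<in> cells \<alpha>. m < T x}"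
  using \<open>m \<le> n\<close>
proof (induction m)
  note D = SRCT_D[OF T, simplified]
  have n: "sum_list \<alpha> = n" using \<alpha> by (simp add: is_composition_def)
  have bij: "bij_betw T (cells \<alpha>) {1..n}" using D(2) n by simp
  case 0
  have "inner_cells \<alpha> \<alpha> = cells \<alpha>" by (force simp: inner_cells_def)
  moreover have "0 < T x" if "x \<in> cells \<alpha>" for x using bij_betwE[OF bij] that by force
  ultimately show ?case using \<alpha> by (intro exI[of _ \<alpha>]) (auto simp: comp_le_def)
next
  note D = SRCT_D[OF T, simplified]
  have n: "sum_list \<alpha> = n" using \<alpha> by (simp add: is_composition_def)
  have bij: "bij_betw T (cells \<alpha>) {1..n}" using D(2) n by simp
  case (Suc m)
  then obtain \<beta> where \<beta>: "is_composition \<beta> (n - m)" "\<beta> \<le>\<^sub>c \<alpha>"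
    and inner: "inner_cells \<alpha> \<beta> = {x \<in> cells \<alpha>. m < T x}" by auto
  define d where "d = length \<alpha> - length \<beta>"
  have len: "length \<alpha> = length \<beta> + d" using comp_le_contained(1)[OF \<beta>(2)] by (simp add: d_def)
  have pos: "0 < \<beta> ! r" if "r < length \<beta>" for r
    using \<beta>(1) that by (simp add: is_composition_def)
  have up: "(i + d, j) \<in> cells \<alpha> \<and> m < T (i + d, j)" if "(i, j) \<in> cells \<beta>" for i j
  proof -
    have "(i + d, j) \<in> inner_cells \<alpha> \<beta>" using that by (auto simp: mem_inner_cells d_def mem_cells)
    then show ?thesis unfolding inner by simp
  qed
  have down: "(i, j) \<in> cells \<beta>" if "(i + d, j) \<in> cells \<alpha>" "m < T (i + d, j)" for i j
  proof -
    have "(i + d, j) \<in> inner_cells \<alpha> \<beta>" using that unfolding inner by simp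
    then show ?thesis by (auto simp: mem_inner_cells d_def)
  qed
  have "m + 1 \<in> T ` cells \<alpha>" using bij Suc.prems by (simp add: bij_betw_def)
  then obtain x where x: "x \<in> cells \<alpha>" "T x = m + 1" by auto
  have "x \<in> inner_cells \<alpha> \<beta>" using x by (simp add: inner)
  then obtain r c where rc: "(r, c) \<in> cells \<beta>" "x = (r + d, c)"
    by (auto simp: inner_cells_def d_def)
  have xs: "m + 1 < T y" if "y \<in> cells \<alpha>" "m < T y" "y \<noteq> x" for y
  proof -
    have "T y \<noteq> T x" using bij that x by (auto simp: bij_betw_def inj_on_def)
    then show ?thesis using x that by simp
  qed
  \<comment> \<open>A cell of \<open>\<beta>\<close> to the right of \<open>x\<close> would hold an
    entry strictly between \<open>m\<close> and \<open>m + 1\<close>.\<close>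
  have c: "c = \<beta> ! (r - 1)"
  proof (rule ccontr)
    assume "c \<noteq> \<beta> ! (r - 1)"
    then have "(r, c + 1) \<in> cells \<beta>" using rc by (auto simp: mem_cells)
    from up[OF this] up[OF rc(1)] have "T (r + d, c + 1) < T (r + d, c)" "m < T (r + d, c + 1)"
      using D(3)[of "r + d" c "c + 1"] by auto
    then show False using x rc by simp
  qed
  have minus: "{y \<in> cells \<alpha>. Suc m < T y} = inner_cells \<alpha> \<beta> - {x}"
    using xs x by (auto simp: inner)
  show ?case
  proof (cases "c = 1")
    case True
    \<comment> \<open>Otherwise the first cell of the top row of \<open>\<beta>\<close> would hold
      an entry above \<open>m\<close> but below \<open>T x\<close>.\<close>
    have "r = 1"
    proof (rule ccontr)
      assume "r \<noteq> 1"
      then have r: "1 < r" "r \<le> length \<beta>" using rc by (auto simp: mem_cells)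
      then have "0 < length \<beta>" by linarith
      then have "0 < \<beta> ! 0" by (rule pos)
      then have "(1, 1) \<in> cells \<beta>" using \<open>0 < length \<beta>\<close> by (simp add: mem_cells Suc_le_eq)
      from up[OF this] have u: "(1 + d, 1) \<in> cells \<alpha>" "m < T (1 + d, 1)" by blast+
      moreover have "T (1 + d, 1) < T (r + d, 1)"
        using D(4)[of "1 + d" "r + d"] u up[OF rc(1)] r True by simp
      ultimately show False using x rc True by simp
    qed
    then obtain \<gamma> where \<gamma>: "\<beta> = 1 # \<gamma>"
      using rc c True by (cases \<beta>) (auto simp: mem_cells)
    have "is_composition \<gamma> (n - Suc m)" using \<beta>(1) by (auto simp: is_composition_def \<gamma>)
    moreover have "\<gamma> \<le>\<^sub>c \<alpha>"
      using \<beta>(2) comp_cover.prepend[of \<gamma>] unfolding comp_le_def \<gamma> by (rule converse_rtranclp_into_rtranclp[rotated])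
    moreover have "inner_cells \<alpha> \<gamma> = inner_cells \<alpha> \<beta> - {x}"
    proof (rule pair_set_eqI)
      fix i j
      have d: "length \<alpha> - length \<gamma> = d + 1" "length \<alpha> - length \<beta> = d" using len by (simp_all add: \<gamma>)
      show "(i, j) \<in> inner_cells \<alpha> \<gamma> \<longleftrightarrow> (i, j) \<in> inner_cells \<alpha> \<beta> - {x}"
      proof (cases "i \<le> d + 1")
        case True
        then show ?thesis
          using rc \<open>r = 1\<close> \<open>c = 1\<close> unfolding Diff_iff mem_inner_cells mem_cells d
          by (auto simp: \<gamma> le_Suc_eq)
      next
        case False
        then have "\<beta> ! (i - d - 1) = \<gamma> ! (i - (d + 1) - 1)" by (simp add: \<gamma> nth_Cons' )
        then show ?thesis
          using rc \<open>r = 1\<close> False unfolding Diff_iff mem_inner_cells mem_cells d by (auto simp: \<gamma>)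
      qed
    qed
    ultimately show ?thesis using minus by (intro exI[of _ \<gamma>]) simp
  next
    case False
    then have c2: "2 \<le> c" and r: "1 \<le> r" "r - 1 < length \<beta>" using rc by (auto simp: mem_cells)
    define \<gamma> where "\<gamma> = \<beta>[r - 1 := c - 1]"
    have \<beta>\<gamma>: "\<beta> = \<gamma>[r - 1 := \<gamma> ! (r - 1) + 1]" using r c2 c by (simp add: \<gamma>_def)
    have "set \<gamma> \<subseteq> insert (c - 1) (set \<beta>)" unfolding \<gamma>_def by (rule set_update_subset_insert)
    moreover have "sum_list \<gamma> = n - Suc m"
      using \<beta>(1) r c2 c by (simp add: \<gamma>_def sum_list_update is_composition_def)
    ultimately have "is_composition \<gamma> (n - Suc m)"
      using \<beta>(1) c2 by (auto simp: is_composition_def)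
    moreover have "comp_cover \<gamma> \<beta>"
      unfolding \<beta>\<gamma>[symmetric]
    proof (subst \<beta>\<gamma>, rule comp_cover.increment)
      show "r - 1 < length \<gamma>" using r by (simp add: \<gamma>_def)
      show "\<forall>i<r - 1. \<gamma> ! i \<noteq> \<gamma> ! (r - 1)"
      proof (intro allI impI notI)
        \<comment> \<open>A higher row of length \<open>c - 1\<close> ends in an entry larger than
          \<open>T x\<close>. The triple rule then requires a cell in column \<open>c\<close> of
          that row with an entry above \<open>T x\<close>, hence a cell of \<open>\<beta>\<close>
          beyond the end of the row.\<close>
        fix i assume i: "i < r - 1" and eq: "\<gamma> ! i = \<gamma> ! (r - 1)"
        then have bi: "\<beta> ! i = c - 1" using r by (simp add: \<gamma>_def)
        then have cell: "(i + 1, c - 1) \<in> cells \<beta>" using i r c2 by (simp add: mem_cells)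
        note u = up[OF cell]
        have "(i + 1 + d, c - 1) \<noteq> x" using rc c2 by auto
        then have "T x < T (i + 1 + d, c - 1)" using xs u x by simp
        moreover have "i + 1 + d < r + d" using i by simp
        moreover have "(r + d, c - 1 + 1) \<in> cells \<alpha>" "T (r + d, c - 1 + 1) = T x" using x rc c2 by simp_all
        ultimately have "(i + 1 + d, c - 1 + 1) \<in> cells \<alpha> \<and> T x < T (i + 1 + d, c - 1 + 1)"
          using D(5)[of "i + 1 + d" "r + d" "c - 1"] u by simp
        then have "(i + 1, c) \<in> cells \<beta>" using down[of "i + 1" c] x c2 by simp
        then have "c \<le> c - 1" using bi by (simp add: mem_cells)
        then show False using c2 by linarith
      qed
    qed
    then have "\<gamma> \<le>\<^sub>c \<alpha>" using \<beta>(2) unfolding comp_le_def by (rule converse_rtranclp_into_rtranclp)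
    moreover have "inner_cells \<alpha> \<gamma> = inner_cells \<alpha> \<beta> - {x}"
    proof (rule pair_set_eqI)
      fix i j
      have d: "length \<alpha> - length \<gamma> = d" "length \<alpha> - length \<beta> = d" "length \<gamma> = length \<beta>" by (simp_all add: d_def \<gamma>_def)
      show "(i, j) \<in> inner_cells \<alpha> \<gamma> \<longleftrightarrow> (i, j) \<in> inner_cells \<alpha> \<beta> - {x}"
      proof (cases "i - d = r \<and> d < i")
        case True
        then have "i = r + d" by auto
        then show ?thesis
          using rc c c2 r unfolding Diff_iff mem_inner_cells mem_cells d by (auto simp: \<gamma>_def)
      next
        case False
        have "\<gamma> ! (i - d - 1) = \<beta> ! (i - d - 1)" if "d < i"
          using False that r unfolding \<gamma>_def by (intro nth_list_update_neq) auto
        then show ?thesis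
          using rc False unfolding Diff_iff mem_inner_cells mem_cells d by auto
      qed
    qed
    ultimately show ?thesis using minus by (intro exI[of _ \<gamma>]) simp
  qed
qed

section \<open>The two pieces of a tableau cut along an inner shape\<close>

locale cut =
  fixes \<alpha> \<beta> :: "nat list" and n m :: nat
  assumes \<alpha>: "is_composition \<alpha> n" and m_le: "m \<le> n"
    and \<beta>: "is_composition \<beta> (n - m)" and le: "\<beta> \<le>\<^sub>c \<alpha>"
begin

sublocale full: skew_shape \<alpha> "[]" .
sublocale skew: skew_shape \<alpha> \<beta> .
sublocale inner: skew_shape \<beta> "[]" .

lemma sizes: "sum_list \<alpha> = n" "skew_size \<alpha> \<beta> = m" "sum_list \<beta> = n - m"
  using \<alpha> \<beta> m_le by (simp_all add: is_composition_def skew_size_def)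

definition "offset = length \<alpha> - length \<beta>"
definition "shift_up x = (fst x + offset, snd x)" for x :: "nat \<times> nat"
definition "shift_down x = (fst x - offset, snd x)" for x :: "nat \<times> nat"

lemma up_simp [simp]: "shift_up (i, j) = (i + offset, j)"
  by (simp add: shift_up_def)

lemma inner_eq: "inner_cells \<alpha> \<beta> = shift_up ` cells \<beta>"
  by (simp add: inner_cells_def shift_up_def offset_def case_prod_unfold)

lemma down_up [simp]: "shift_down (shift_up x) = x"
  by (simp add: shift_up_def shift_down_def)

lemma up_inj: "inj shift_up"
  by (metis down_up injI)

lemma up_mem: "shift_up x \<in> inner_cells \<alpha> \<beta> \<longleftrightarrow> x \<in> cells \<beta>"
  unfolding inner_eq by (rule inj_image_mem_iff[OF up_inj])

lemma up_mem': "(i + offset, j) \<in> inner_cells \<alpha> \<beta> \<longleftrightarrow> (i, j) \<in> cells \<beta>"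
  using up_mem[of "(i, j)"] by simp

lemma up_down: "x \<in> inner_cells \<alpha> \<beta> \<Longrightarrow> shift_up (shift_down x) = x"
  unfolding inner_eq by (erule imageE) (simp only: down_up)

lemma down_mem: "x \<in> inner_cells \<alpha> \<beta> \<Longrightarrow> shift_down x \<in> cells \<beta>"
  unfolding inner_eq by (erule imageE) (simp only: down_up)

lemma inner_subset: "inner_cells \<alpha> \<beta> \<subseteq> cells \<alpha>"
  by (rule comp_le_inner_subset[OF le])

lemma mem_skew: "x \<in> skew_cells \<alpha> \<beta> \<longleftrightarrow> x \<in> cells \<alpha> \<and> x \<notin> inner_cells \<alpha> \<beta>"
  by (simp add: skew_cells_def)

definition "shaped = {T \<in> SRCT \<alpha> []. inner_cells \<alpha> \<beta> = {x \<in> cells \<alpha>. m < T x}}"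
text \<open>The names refer to the place in the diagram, not to the size of the entries: for
  \<open>T\<close> in \<open>shaped\<close>, \<open>upper\<close> holds the entries up to
  \<open>m\<close> outside the bottom left corner, and \<open>lower\<close> holds the entries above
  \<open>m\<close> in the corner, reduced by \<open>m\<close>.\<close>

definition "upper T = restrict T (skew_cells \<alpha> \<beta>)" for T :: "nat \<times> nat \<Rightarrow> nat"
definition "lower T = (\<lambda>x\<in>cells \<beta>. T (shift_up x) - m)" for T :: "nat \<times> nat \<Rightarrow> nat"
definition "glue \<tau> \<sigma> = (\<lambda>x\<in>cells \<alpha>. if x \<in> inner_cells \<alpha> \<beta> then \<sigma> (shift_down x) + m else \<tau> x)"
  for \<tau> \<sigma> :: "nat \<times> nat \<Rightarrow> nat"

context
  fixes T assumes T: "T \<in> shaped"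
begin

lemma T_SRCT: "T \<in> SRCT \<alpha> []"
  using T by (simp add: shaped_def)

lemmas T_D = SRCT_D[OF T_SRCT, unfolded skew_cells_empty skew_size_empty entry_empty sizes enat_ord_simps]

lemma T_inner: "x \<in> inner_cells \<alpha> \<beta> \<Longrightarrow> m < T x" "x \<in> inner_cells \<alpha> \<beta> \<Longrightarrow> x \<in> cells \<alpha>"
  using T by (auto simp: shaped_def)

lemma T_inner': "\<lbrakk>x \<in> cells \<alpha>; m < T x\<rbrakk> \<Longrightarrow> x \<in> inner_cells \<alpha> \<beta>"
  using T by (auto simp: shaped_def)

lemma T_skew: "x \<in> skew_cells \<alpha> \<beta> \<Longrightarrow> T x \<le> m" "x \<in> skew_cells \<alpha> \<beta> \<Longrightarrow> x \<in> cells \<alpha>"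
  using T_inner'[of x] by (auto simp: mem_skew not_less[symmetric])

lemma upper_apply: "x \<in> skew_cells \<alpha> \<beta> \<Longrightarrow> upper T x = T x"
  by (simp add: upper_def)

lemma lower_apply: "x \<in> cells \<beta> \<Longrightarrow> lower T x + m = T (shift_up x)"
  using T_inner(1)[of "shift_up x"] by (simp add: lower_def up_mem)

lemma upper_SRCT: "upper T \<in> SRCT \<alpha> \<beta>"
proof (rule SRCT_I)
  show "upper T \<in> extensional (skew_cells \<alpha> \<beta>)" by (simp add: upper_def)
  have "T ` skew_cells \<alpha> \<beta> = {1..m}"
  proof
    show "T ` skew_cells \<alpha> \<beta> \<subseteq> {1..m}"
      using T_skew bij_betwE[OF T_D(2)] by fastforce
    show "{1..m} \<subseteq> T ` skew_cells \<alpha> \<beta>"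
    proof
      fix k assume k: "k \<in> {1..m}"
      then have "k \<in> T ` cells \<alpha>" using T_D(2) m_le by (auto simp: bij_betw_def)
      then obtain x where "x \<in> cells \<alpha>" "T x = k" by blast
      then show "k \<in> T ` skew_cells \<alpha> \<beta>" using k T_inner(1)[of x] by (force simp: mem_skew)
    qed
  qed
  moreover have "inj_on T (skew_cells \<alpha> \<beta>)"
    using T_D(2) T_skew(2) by (meson bij_betw_def inj_on_subset subsetI)
  ultimately show "bij_betw (upper T) (skew_cells \<alpha> \<beta>) {1..skew_size \<alpha> \<beta>}"
    by (auto simp: bij_betw_def upper_def sizes inj_on_def)
  show "upper T (i, j) > upper T (i, j')" if "(i, j) \<in> skew_cells \<alpha> \<beta>" "(i, j') \<in> skew_cells \<alpha> \<beta>" "j < j'" for i j j'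
    using that T_D(3)[of i j j'] T_skew(2) by (simp add: upper_apply)
  show "upper T (i, 1) < upper T (i', 1)" if "(i, 1) \<in> skew_cells \<alpha> \<beta>" "(i', 1) \<in> skew_cells \<alpha> \<beta>" "i < i'" for i i'
    using that T_D(4)[of i i'] T_skew(2) by (simp add: upper_apply)
  fix i j k
  assume ij: "i < j" and jX: "(j, k + 1) \<in> skew_cells \<alpha> \<beta>" and iX: "(i, k) \<in> cells \<alpha>"
    and gt: "entry \<alpha> \<beta> (upper T) (i, k) > entry \<alpha> \<beta> (upper T) (j, k + 1)"
  \<comment> \<open>Reading inner cells as \<open>\<infinity>\<close> changes no comparison with a
    skew cell, since the inner entries exceed \<open>m\<close> and the skew entries do not.\<close>
  have e: "entry \<alpha> \<beta> (upper T) x > entry \<alpha> \<beta> (upper T) (j, k + 1) \<longleftrightarrow> T x > T (j, k + 1)"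
    if "x \<in> cells \<alpha>" for x
  proof (cases "x \<in> inner_cells \<alpha> \<beta>")
    case True
    then have "T (j, k + 1) < T x" using T_skew(1)[OF jX] T_inner(1)[OF True] by simp
    then show ?thesis using True jX by (simp add: entry_def mem_skew)
  next
    case False
    then show ?thesis using that jX upper_apply[OF jX] upper_apply[of x] by (simp add: entry_def mem_skew)
  qed
  have "T (i, k) > T (j, k + 1)" using gt e[OF iX] by simp
  then have *: "(i, k + 1) \<in> cells \<alpha> \<and> T (j, k + 1) < T (i, k + 1)"
    by (rule T_D(5)[OF ij T_skew(2)[OF jX] iX])
  then show "(i, k + 1) \<in> cells \<alpha> \<and> entry \<alpha> \<beta> (upper T) (i, k + 1) > entry \<alpha> \<beta> (upper T) (j, k + 1)"
    using e[of "(i, k + 1)"] by simp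
qed

lemma lower_SRCT: "lower T \<in> SRCT \<beta> []"
proof (rule SRCT_I, unfold skew_cells_empty skew_size_empty entry_empty sizes enat_ord_simps)
  show "lower T \<in> extensional (cells \<beta>)" by (simp add: lower_def)
  have inj: "inj_on (lower T) (cells \<beta>)"
  proof (rule inj_onI)
    fix x y assume xy: "x \<in> cells \<beta>" "y \<in> cells \<beta>" "lower T x = lower T y"
    then have "T (shift_up x) = T (shift_up y)" using lower_apply[of x] lower_apply[of y] by simp
    moreover have "shift_up x \<in> cells \<alpha>" "shift_up y \<in> cells \<alpha>" using xy T_inner(2) by (simp_all add: up_mem)
    ultimately have "shift_up x = shift_up y" using T_D(2) by (auto simp: bij_betw_def inj_on_def)
    then show "x = y" by (rule injD[OF up_inj])
  qed
  have "lower T ` cells \<beta> = {1..n - m}"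
  proof
    show "lower T ` cells \<beta> \<subseteq> {1..n - m}"
    proof (rule image_subsetI)
      fix x assume x: "x \<in> cells \<beta>"
      then have "shift_up x \<in> cells \<alpha>" "m < T (shift_up x)" using T_inner by (simp_all add: up_mem)
      then have "T (shift_up x) \<le> n" "m < T (shift_up x)" using bij_betwE[OF T_D(2)] by auto
      then show "lower T x \<in> {1..n - m}" using lower_apply[OF x] by simp
    qed
    show "{1..n - m} \<subseteq> lower T ` cells \<beta>"
    proof
      fix k assume k: "k \<in> {1..n - m}"
      then have "k + m \<in> T ` cells \<alpha>" using T_D(2) by (auto simp: bij_betw_def)
      then obtain x where x: "x \<in> cells \<alpha>" "T x = k + m" by (metis imageE)
      then have "x \<in> inner_cells \<alpha> \<beta>" using T_inner' k by simp
      then have "shift_up (shift_down x) = x" "shift_down x \<in> cells \<beta>" using up_down up_mem[of "shift_down x"] by simp_all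
      then show "k \<in> lower T ` cells \<beta>" using lower_apply[of "shift_down x"] x by (intro image_eqI[of _ _ "shift_down x"]) auto
    qed
  qed
  with inj show "bij_betw (lower T) (cells \<beta>) {1..n - m}" by (simp add: bij_betw_def)
  have less: "lower T x < lower T y \<longleftrightarrow> T (shift_up x) < T (shift_up y)" if "x \<in> cells \<beta>" "y \<in> cells \<beta>" for x y
    using lower_apply[OF that(1)] lower_apply[OF that(2)] by linarith
  have upc: "shift_up x \<in> cells \<alpha>" if "x \<in> cells \<beta>" for x using that T_inner(2) by (simp add: up_mem)
  show "lower T (i, j) > lower T (i, j')" if "(i, j) \<in> cells \<beta>" "(i, j') \<in> cells \<beta>" "j < j'" for i j j'
    using that T_D(3)[of "i + offset" j j'] upc[of "(i, j)"] upc[of "(i, j')"] by (simp add: less)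
  show "lower T (i, 1) < lower T (i', 1)" if "(i, 1) \<in> cells \<beta>" "(i', 1) \<in> cells \<beta>" "i < i'" for i i'
    using that T_D(4)[of "i + offset" "i' + offset"] upc[of "(i, 1)"] upc[of "(i', 1)"] by (simp add: less)
  fix i j k
  assume ij: "i < j" and jX: "(j, k + 1) \<in> cells \<beta>" and iX: "(i, k) \<in> cells \<beta>"
    and gt: "lower T (j, k + 1) < lower T (i, k)"
  have u: "(j + offset, k + 1) \<in> cells \<alpha>" "(i + offset, k) \<in> cells \<alpha>" using upc[OF jX] upc[OF iX] by simp_all
  have "T (j + offset, k + 1) < T (i + offset, k)" using gt less[OF jX iX] by simp
  then have c: "(i + offset, k + 1) \<in> cells \<alpha>" "T (j + offset, k + 1) < T (i + offset, k + 1)"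
    using T_D(5)[of "i + offset" "j + offset" k, OF _ u] ij by simp_all
  \<comment> \<open>The triple rule of \<open>T\<close> only yields a cell of
    \<open>\<alpha>\<close>. That cell belongs to the corner because its entry is larger than one
    that already exceeds \<open>m\<close>.\<close>
  have "m < T (j + offset, k + 1)" using T_inner(1)[of "shift_up (j, k + 1)"] jX unfolding up_mem by simp
  then have "(i + offset, k + 1) \<in> inner_cells \<alpha> \<beta>" using c T_inner' by simp
  then have "(i, k + 1) \<in> cells \<beta>" by (simp add: up_mem')
  then show "(i, k + 1) \<in> cells \<beta> \<and> lower T (j, k + 1) < lower T (i, k + 1)"
    using c less[OF jX] by simp
qed

lemma glue_split: "glue (upper T) (lower T) = T"
proof
  fix x
  show "glue (upper T) (lower T) x = T x"
  proof (cases "x \<in> cells \<alpha>")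
    case False
    then show ?thesis using extensional_arb[OF T_D(1) False] by (simp add: glue_def)
  next
    case True
    show ?thesis
    proof (cases "x \<in> inner_cells \<alpha> \<beta>")
      case inn: True
      then have "shift_up (shift_down x) = x" "shift_down x \<in> cells \<beta>" using up_down up_mem[of "shift_down x"] by simp_all
      then show ?thesis using True inn lower_apply[of "shift_down x"] by (simp add: glue_def)
    next
      case False
      then show ?thesis using True by (simp add: glue_def upper_def mem_skew)
    qed
  qed
qed

lemma position_upper:
  assumes "k \<in> {1..m}"
  shows "position \<alpha> [] T k = position \<alpha> \<beta> (upper T) k"
proof (rule full.pos_eqI[OF full.SRCT_fillings[OF T_SRCT]])
  note F = skew.SRCT_fillings[OF upper_SRCT]
  have k: "k \<in> {1..skew_size \<alpha> \<beta>}" using assms by (simp add: sizes)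
  have p: "position \<alpha> \<beta> (upper T) k \<in> skew_cells \<alpha> \<beta>" by (rule skew.pos_mem[OF F k])
  then show "position \<alpha> \<beta> (upper T) k \<in> skew_cells \<alpha> []" by (simp add: T_skew(2))
  show "T (position \<alpha> \<beta> (upper T) k) = k"
    using skew.pos_val[OF F k] upper_apply[OF p] by simp
qed

lemma position_lower:
  assumes "k \<in> {1..n - m}"
  shows "position \<alpha> [] T (k + m) = shift_up (position \<beta> [] (lower T) k)"
proof (rule full.pos_eqI[OF full.SRCT_fillings[OF T_SRCT]])
  note F = inner.SRCT_fillings[OF lower_SRCT]
  have k: "k \<in> {1..skew_size \<beta> []}" using assms by (simp add: sizes)
  have p: "position \<beta> [] (lower T) k \<in> cells \<beta>" using inner.pos_mem[OF F k] by simp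
  then show "shift_up (position \<beta> [] (lower T) k) \<in> skew_cells \<alpha> []" using T_inner(2) by (simp add: up_mem)
  show "T (shift_up (position \<beta> [] (lower T) k)) = k + m"
    using inner.pos_val[OF F k] lower_apply[OF p] by simp
qed

text \<open>Entries up to \<open>m\<close> occupy the same cells in \<open>T\<close> and
  \<open>upper T\<close>, so both operators take the same branch. \<open>T'\<close> is
  \<open>T\<close> itself or the swapped tableau, which covers the fixing and the swapping branch
  together; a swap among values up to \<open>m\<close> affects neither the set of cells above
  \<open>m\<close> nor \<open>lower T\<close>.\<close>

lemma pi_op_upper:
  assumes i: "i \<in> {1..<m}"
  shows "(pi_op \<alpha> [] i T = 0 \<and> pi_op \<alpha> \<beta> i (upper T) = 0) \<or>
    (\<exists>T'\<in>shaped. pi_op \<alpha> [] i T = Poly_Mapping.single T' 1 \<and>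
      pi_op \<alpha> \<beta> i (upper T) = Poly_Mapping.single (upper T') 1 \<and> lower T' = lower T)"
proof -
  define j where "j = i + 1"
  have im: "i \<in> {1..m}" "j \<in> {1..m}" and i1: "i \<in> {1..<skew_size \<alpha> []}" and i2: "i \<in> {1..<skew_size \<alpha> \<beta>}"
    using i m_le by (auto simp: j_def sizes)
  note p = position_upper[OF im(1)] position_upper[OF im(2)]
  note op = full.pi_op_cells[OF i1 j_def, of T, unfolded p] skew.pi_op_cells[OF i2 j_def, of "upper T"]
  consider (a) "snd (position \<alpha> \<beta> (upper T) j) < snd (position \<alpha> \<beta> (upper T) i)"
    | (b) "\<not> snd (position \<alpha> \<beta> (upper T) j) < snd (position \<alpha> \<beta> (upper T) i)"
      "attacking_cells (position \<alpha> \<beta> (upper T) i) (position \<alpha> \<beta> (upper T) j)"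
    | (c) "\<not> snd (position \<alpha> \<beta> (upper T) j) < snd (position \<alpha> \<beta> (upper T) i)"
      "\<not> attacking_cells (position \<alpha> \<beta> (upper T) i) (position \<alpha> \<beta> (upper T) j)" by blast
  then show ?thesis
  proof cases
    case a
    then show ?thesis unfolding op using T by auto
  next
    case b
    then show ?thesis unfolding op by auto
  next
    case c
    define T' where "T' = swap_entries \<alpha> [] i T"
    have "T' \<in> SRCT \<alpha> []"
      unfolding T'_def
    proof (rule full.swap_SRCT[OF T_SRCT])
      show "i \<in> Des \<alpha> [] T" using c(1) i1 p by (simp add: Des_def j_def)
      show "\<not> attacking \<alpha> [] T i" using c(2) p by (simp add: attacking_iff j_def)
    qed
    moreover have val: "T' x = transpose i j (T x)" if "x \<in> cells \<alpha>" for x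
      using that by (simp add: T'_def swap_entries_def j_def)
    moreover have big: "m < transpose i j t \<longleftrightarrow> m < t" for t
      using im by (auto simp: transpose_def)
    ultimately have "T' \<in> shaped"
      using T by (auto simp: shaped_def)
    moreover have "upper T' = swap_entries \<alpha> \<beta> i (upper T)"
      using T_skew(2) val by (auto simp: fun_eq_iff upper_def swap_entries_def j_def)
    moreover have "lower T' = lower T"
    proof
      fix x
      show "lower T' x = lower T x"
      proof (cases "x \<in> cells \<beta>")
        case True
        then have "shift_up x \<in> cells \<alpha>" "m < T (shift_up x)" using T_inner by (simp_all add: up_mem)
        then have "T' (shift_up x) = T (shift_up x)" using im val by (auto simp: transpose_def)
        then show ?thesis by (simp add: lower_def)
      qed (simp add: lower_def)
    qed
    ultimately show ?thesis unfolding op using c by (auto simp: T'_def)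
  qed
qed

text \<open>Moving both cells down by \<open>offset\<close> rows keeps their columns and the order
  of their rows, hence descents and attacks. This time the swap is among values above
  \<open>m\<close>, so \<open>upper T\<close> is untouched.\<close>

lemma pi_op_lower:
  assumes i: "i \<in> {1..<n - m}"
  shows "(pi_op \<alpha> [] (i + m) T = 0 \<and> pi_op \<beta> [] i (lower T) = 0) \<or>
    (\<exists>T'\<in>shaped. pi_op \<alpha> [] (i + m) T = Poly_Mapping.single T' 1 \<and>
      pi_op \<beta> [] i (lower T) = Poly_Mapping.single (lower T') 1 \<and> upper T' = upper T)"
proof -
  define j where "j = i + 1"
  have jm: "j + m = i + m + 1" by (simp add: j_def)
  have im: "i \<in> {1..n - m}" "j \<in> {1..n - m}" and i1: "i + m \<in> {1..<skew_size \<alpha> []}" and i2: "i \<in> {1..<skew_size \<beta> []}"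
    using i by (auto simp: j_def sizes)
  note p = position_lower[OF im(1)] position_lower[OF im(2)]
  have att: "attacking_cells (shift_up x) (shift_up y) \<longleftrightarrow> attacking_cells x y" "snd (shift_up x) = snd x" for x y
    by (simp_all add: attacking_cells_def shift_up_def)
  note op = full.pi_op_cells[OF i1 jm, of T, unfolded p att] inner.pi_op_cells[OF i2 j_def, of "lower T"]
  consider (a) "snd (position \<beta> [] (lower T) j) < snd (position \<beta> [] (lower T) i)"
    | (b) "\<not> snd (position \<beta> [] (lower T) j) < snd (position \<beta> [] (lower T) i)"
      "attacking_cells (position \<beta> [] (lower T) i) (position \<beta> [] (lower T) j)"
    | (c) "\<not> snd (position \<beta> [] (lower T) j) < snd (position \<beta> [] (lower T) i)"
      "\<not> attacking_cells (position \<beta> [] (lower T) i) (position \<beta> [] (lower T) j)" by blast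
  then show ?thesis
  proof cases
    case a
    then show ?thesis unfolding op using T by auto
  next
    case b
    then show ?thesis unfolding op by auto
  next
    case c
    define T' where "T' = swap_entries \<alpha> [] (i + m) T"
    have "T' \<in> SRCT \<alpha> []"
      unfolding T'_def
    proof (rule full.swap_SRCT[OF T_SRCT])
      show "i + m \<in> Des \<alpha> [] T" using c(1) i1 p jm by (simp add: Des_def att)
      show "\<not> attacking \<alpha> [] T (i + m)" using c(2) p unfolding attacking_iff jm[symmetric] by (simp add: att)
    qed
    moreover have val: "T' x = transpose (i + m) (j + m) (T x)" if "x \<in> cells \<alpha>" for x
      using that by (simp add: T'_def swap_entries_def j_def)
    moreover have big: "m < transpose (i + m) (j + m) t \<longleftrightarrow> m < t" for t
      using im by (auto simp: transpose_def)
    ultimately have "T' \<in> shaped"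
      using T by (auto simp: shaped_def)
    moreover have "lower T' = swap_entries \<beta> [] i (lower T)"
    proof
      fix x
      show "lower T' x = swap_entries \<beta> [] i (lower T) x"
      proof (cases "x \<in> cells \<beta>")
        case True
        then have "shift_up x \<in> cells \<alpha>" "m < T (shift_up x)" using T_inner by (simp_all add: up_mem)
        \<comment> \<open>Truncated subtraction is harmless here: the entry exceeds
          \<open>m\<close>, so reducing by \<open>m\<close> intertwines the two
          transpositions.\<close>
        then have "T' (shift_up x) - m = transpose i j (T (shift_up x) - m)" using val by (auto simp: transpose_def)
        then show ?thesis using True by (simp add: lower_def swap_entries_def j_def)
      qed (simp add: lower_def swap_entries_def)
    qed
    moreover have "upper T' = upper T"
    proof
      fix x
      show "upper T' x = upper T x"
      proof (cases "x \<in> skew_cells \<alpha> \<beta>")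
        case True
        then have "x \<in> cells \<alpha>" "T x \<le> m" using T_skew by simp_all
        then have "T' x = T x" using im val by (auto simp: transpose_def)
        then show ?thesis by (simp add: upper_def)
      qed (simp add: upper_def)
    qed
    ultimately show ?thesis unfolding op using c by (auto simp: T'_def)
  qed
qed

end

text \<open>Every corner entry exceeds every skew entry, so mixed comparisons come out right: within
  a row the corner cells come first, and in column 1 they lie below the skew cells because
  \<open>\<beta>\<close> fills the last rows with positive parts. The triple rule is that of
  \<open>\<sigma>\<close> or that of \<open>\<tau>\<close>, according to the piece containing
  \<open>(b, k + 1)\<close>.\<close>

lemma glue_shaped:
  assumes \<tau>: "\<tau> \<in> SRCT \<alpha> \<beta>" and \<sigma>: "\<sigma> \<in> SRCT \<beta> []"
  shows "glue \<tau> \<sigma> \<in> shaped" "upper (glue \<tau> \<sigma>) = \<tau>" "lower (glue \<tau> \<sigma>) = \<sigma>"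
proof -
  note D = SRCT_D[OF \<tau>, unfolded sizes]
    and E = SRCT_D[OF \<sigma>, unfolded skew_cells_empty skew_size_empty entry_empty sizes enat_ord_simps]
  have low: "glue \<tau> \<sigma> (shift_up x) = \<sigma> x + m" if "x \<in> cells \<beta>" for x
    using that inner_subset up_mem[of x] by (auto simp: glue_def)
  have upp: "glue \<tau> \<sigma> x = \<tau> x" if "x \<in> skew_cells \<alpha> \<beta>" for x
    using that by (simp add: glue_def mem_skew)
  have \<tau>_le: "\<tau> x \<le> m" "1 \<le> \<tau> x" if "x \<in> skew_cells \<alpha> \<beta>" for x
    using bij_betwE[OF D(2)] that by auto
  have \<sigma>_ge: "1 \<le> \<sigma> x" "\<sigma> x \<le> n - m" if "x \<in> cells \<beta>" for x
    using bij_betwE[OF E(2)] that by auto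
  have cell: "(\<exists>y\<in>cells \<beta>. x = shift_up y) \<or> x \<in> skew_cells \<alpha> \<beta>" if "x \<in> cells \<alpha>" for x
    using that inner_eq by (auto simp: mem_skew)
  have gt: "m < glue \<tau> \<sigma> (shift_up x)" if "x \<in> cells \<beta>" for x
    using low[OF that] \<sigma>_ge[OF that] by simp
  have inner: "inner_cells \<alpha> \<beta> = {x \<in> cells \<alpha>. m < glue \<tau> \<sigma> x}"
  proof
    show "inner_cells \<alpha> \<beta> \<subseteq> {x \<in> cells \<alpha>. m < glue \<tau> \<sigma> x}"
      using inner_subset gt inner_eq by auto
    show "{x \<in> cells \<alpha>. m < glue \<tau> \<sigma> x} \<subseteq> inner_cells \<alpha> \<beta>"
    proof clarify
      fix i j assume ij: "(i, j) \<in> cells \<alpha>" "m < glue \<tau> \<sigma> (i, j)"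
      then have "(i, j) \<notin> skew_cells \<alpha> \<beta>" using upp[of "(i, j)"] \<tau>_le(1)[of "(i, j)"] by auto
      then show "(i, j) \<in> inner_cells \<alpha> \<beta>" using ij by (simp add: mem_skew)
    qed
  qed
  have not_skew: "x \<notin> skew_cells \<alpha> \<beta>" if "m < glue \<tau> \<sigma> x" for x
    using that upp[of x] \<tau>_le(1)[of x] by auto
  have G: "glue \<tau> \<sigma> \<in> SRCT \<alpha> []"
  proof (rule SRCT_I, unfold skew_cells_empty skew_size_empty entry_empty sizes enat_ord_simps)
    show "glue \<tau> \<sigma> \<in> extensional (cells \<alpha>)" by (simp add: glue_def)
    have "bij_betw (\<sigma> \<circ> shift_down) (inner_cells \<alpha> \<beta>) {1..n - m}"
    proof (rule bij_betw_trans[OF _ E(2)])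
      show "bij_betw shift_down (inner_cells \<alpha> \<beta>) (cells \<beta>)"
        by (rule bij_betw_byWitness[where f' = shift_up]) (simp_all add: up_down down_mem up_mem image_subset_iff)
    qed
    moreover have "bij_betw (\<lambda>k. k + m) {1..n - m} {m + 1..n}"
      by (rule bij_betw_byWitness[where f' = "\<lambda>k. k - m"]) (use m_le in auto)
    ultimately have "bij_betw ((\<lambda>k. k + m) \<circ> (\<sigma> \<circ> shift_down)) (inner_cells \<alpha> \<beta>) {m + 1..n}"
      by (rule bij_betw_trans)
    then have b1: "bij_betw (glue \<tau> \<sigma>) (inner_cells \<alpha> \<beta>) {m + 1..n}"
      by (rule iffD1[OF bij_betw_cong, rotated]) (use inner_subset in \<open>auto simp: glue_def\<close>)
    have b2: "bij_betw (glue \<tau> \<sigma>) (skew_cells \<alpha> \<beta>) {1..m}"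
      using D(2) by (rule iffD1[OF bij_betw_cong, rotated]) (simp add: upp)
    have "bij_betw (glue \<tau> \<sigma>) (inner_cells \<alpha> \<beta> \<union> skew_cells \<alpha> \<beta>) ({m + 1..n} \<union> {1..m})"
      by (rule bij_betw_combine[OF b1 b2]) auto
    moreover have "inner_cells \<alpha> \<beta> \<union> skew_cells \<alpha> \<beta> = cells \<alpha>" using inner_subset by (auto simp: skew_cells_def)
    moreover have "{m + 1..n} \<union> {1..m} = {1..n}" using m_le by auto
    ultimately show "bij_betw (glue \<tau> \<sigma>) (cells \<alpha>) {1..n}" by simp
    show "glue \<tau> \<sigma> (i, j') < glue \<tau> \<sigma> (i, j)" if ij: "(i, j) \<in> cells \<alpha>" "(i, j') \<in> cells \<alpha>" "j < j'" for i j j'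
      using cell[OF ij(2)]
    proof
      assume "\<exists>y\<in>cells \<beta>. (i, j') = shift_up y"
      then obtain i' where i': "(i', j') \<in> cells \<beta>" "i = i' + offset" by (auto simp: shift_up_def)
      moreover have "(i', j) \<in> cells \<beta>" using i' ij by (auto simp: mem_cells)
      ultimately show ?thesis
        using E(3)[of i' j j'] ij low[of "(i', j)"] low[of "(i', j')"] by simp
    next
      assume s: "(i, j') \<in> skew_cells \<alpha> \<beta>"
      show ?thesis
        using cell[OF ij(1)]
      proof
        assume "\<exists>y\<in>cells \<beta>. (i, j) = shift_up y"
        then have "m < glue \<tau> \<sigma> (i, j)" using gt by metis
        then show ?thesis using upp[OF s] \<tau>_le(1)[OF s] by simp
      next
        assume "(i, j) \<in> skew_cells \<alpha> \<beta>"
        then show ?thesis using D(3)[of i j j'] s ij(3) upp by simp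
      qed
    qed
    show "glue \<tau> \<sigma> (i, 1) < glue \<tau> \<sigma> (i', 1)" if ij: "(i, 1) \<in> cells \<alpha>" "(i', 1) \<in> cells \<alpha>" "i < i'" for i i'
      using cell[OF ij(1)]
    proof
      assume "\<exists>y\<in>cells \<beta>. (i, 1) = shift_up y"
      then obtain r where r: "(r, 1) \<in> cells \<beta>" "i = r + offset" by (auto simp: shift_up_def)
      define r' where "r' = i' - offset"
      have r': "i' = r' + offset" "r < r'" using r ij by (simp_all add: r'_def)
      have "length \<alpha> = length \<beta> + offset" using comp_le_contained(1)[OF le] by (simp add: offset_def)
      then have "1 \<le> r'" "r' \<le> length \<beta>" using r r' ij(2) by (auto simp: mem_cells)
      moreover then have "0 < \<beta> ! (r' - 1)" using \<beta> by (simp add: is_composition_def)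
      ultimately have "(r', 1) \<in> cells \<beta>" by (simp add: mem_cells Suc_le_eq)
      then show ?thesis
        using E(4)[of r r'] r r' low[of "(r, 1)"] low[of "(r', 1)"] by simp
    next
      assume s: "(i, 1) \<in> skew_cells \<alpha> \<beta>"
      show ?thesis
        using cell[OF ij(2)]
      proof
        assume "\<exists>y\<in>cells \<beta>. (i', 1) = shift_up y"
        then have "m < glue \<tau> \<sigma> (i', 1)" using gt by metis
        then show ?thesis using upp[OF s] \<tau>_le(1)[OF s] by simp
      next
        assume "(i', 1) \<in> skew_cells \<alpha> \<beta>"
        then show ?thesis using D(4)[of i i'] s ij(3) upp by simp
      qed
    qed
    fix a b k
    assume ab: "a < b" and bX: "(b, k + 1) \<in> cells \<alpha>" and aX: "(a, k) \<in> cells \<alpha>"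
      and less: "glue \<tau> \<sigma> (b, k + 1) < glue \<tau> \<sigma> (a, k)"
    show "(a, k + 1) \<in> cells \<alpha> \<and> glue \<tau> \<sigma> (b, k + 1) < glue \<tau> \<sigma> (a, k + 1)"
      using cell[OF bX]
    proof
      assume "\<exists>y\<in>cells \<beta>. (b, k + 1) = shift_up y"
      then obtain b' where b': "(b', k + 1) \<in> cells \<beta>" "b = b' + offset" by (auto simp: shift_up_def)
      then have "m < glue \<tau> \<sigma> (a, k)" using gt[OF b'(1)] less by simp
      then have "(a, k) \<notin> skew_cells \<alpha> \<beta>" by (rule not_skew)
      \<comment> \<open>The larger entry at \<open>(a, k)\<close> also exceeds \<open>m\<close>, so
        it lies in the corner as well and the rule takes place entirely inside
        \<open>\<sigma>\<close>.\<close>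
      then obtain a' where a': "(a', k) \<in> cells \<beta>" "a = a' + offset" using cell[OF aX] by (auto simp: shift_up_def)
      have "\<sigma> (b', k + 1) < \<sigma> (a', k)"
        using less low[OF b'(1)] low[OF a'(1)] a' b' by simp
      with E(5)[of a' b' k] a' b' ab
      have c: "(a', k + 1) \<in> cells \<beta>" "\<sigma> (b', k + 1) < \<sigma> (a', k + 1)" by simp_all
      then have "shift_up (a', k + 1) \<in> cells \<alpha>" using inner_subset up_mem by blast
      then show ?thesis using c low[OF c(1)] low[OF b'(1)] a' b' by simp
    next
      assume s: "(b, k + 1) \<in> skew_cells \<alpha> \<beta>"
      have e: "entry \<alpha> \<beta> \<tau> x > entry \<alpha> \<beta> \<tau> (b, k + 1) \<longleftrightarrow> glue \<tau> \<sigma> x > glue \<tau> \<sigma> (b, k + 1)"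
        if "x \<in> cells \<alpha>" for x
      proof (cases "x \<in> inner_cells \<alpha> \<beta>")
        case True
        then have "m < glue \<tau> \<sigma> x" using inner by blast
        then show ?thesis using True s upp[OF s] \<tau>_le(1)[OF s] by (simp add: entry_def mem_skew)
      next
        case False
        then show ?thesis using that s upp[OF s] upp[of x] by (simp add: entry_def mem_skew)
      qed
      have "entry \<alpha> \<beta> \<tau> (a, k) > entry \<alpha> \<beta> \<tau> (b, k + 1)" using less e[OF aX] by simp
      from D(5)[OF ab s aX this] show ?thesis using e[of "(a, k + 1)"] by blast
    qed
  qed
  with inner show "glue \<tau> \<sigma> \<in> shaped" by (simp add: shaped_def)
  show "upper (glue \<tau> \<sigma>) = \<tau>"
    using D(1) upp by (auto simp: fun_eq_iff upper_def extensional_def restrict_def)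
  show "lower (glue \<tau> \<sigma>) = \<sigma>"
    using E(1) low by (auto simp: fun_eq_iff lower_def extensional_def restrict_def)
qed

end

section \<open>Direct sums and restriction of scalars\<close>

lemma (in left_module) smult_r_null: "a \<in> carrier R \<Longrightarrow> a \<odot>\<^bsub>M\<^esub> \<zero>\<^bsub>M\<^esub> = \<zero>\<^bsub>M\<^esub>"
proof -
  assume a: "a \<in> carrier R"
  have "a \<odot>\<^bsub>M\<^esub> \<zero>\<^bsub>M\<^esub> = a \<odot>\<^bsub>M\<^esub> \<zero>\<^bsub>M\<^esub> \<oplus>\<^bsub>M\<^esub> a \<odot>\<^bsub>M\<^esub> \<zero>\<^bsub>M\<^esub>"
    using smult_r_distr[OF a M.zero_closed M.zero_closed] by simp
  then show ?thesis
    using smult_closed[OF a M.zero_closed] by (metis M.add.r_cancel_one')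
qed

text \<open>Lets the case of additive inverses in an induction over \<open>generate_ring\<close> be
  treated as a product with a scalar.\<close>

lemma (in complex_space) minus_scale: "x \<in> carrier U \<Longrightarrow> \<ominus> x = (- 1) \<odot> x"
proof -
  assume x: "x \<in> carrier U"
  have "0 \<odot> x = 0 \<odot> x \<oplus> 0 \<odot> x" using scale_add_left[OF x, of 0 0] by simp
  then have "0 \<odot> x = \<zero>" using scale_closed[OF x, of 0] by (metis add.r_cancel_one')
  then have "(- 1) \<odot> x \<oplus> x = \<zero>" using scale_add_left[OF x, of "- 1" 1] x by simp
  then show ?thesis using x by (intro minus_equality) auto
qed

lemma left_module_restrict_scalars:
  assumes "ring S" "left_module R M" "h \<in> ring_hom S R"
  shows "left_module S (restrict_scalars h M)"
proof -
  interpret M: left_module R M by fact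
  interpret S: ring S by fact
  have f: "carrier (restrict_scalars h M) = carrier M" "add (restrict_scalars h M) = add M"
    "\<zero>\<^bsub>restrict_scalars h M\<^esub> = \<zero>\<^bsub>M\<^esub>" "a \<odot>\<^bsub>restrict_scalars h M\<^esub> x = h a \<odot>\<^bsub>M\<^esub> x" for a x
    by (simp_all add: restrict_scalars_def)
  note h = ring_hom_closed[OF assms(3)] ring_hom_mult[OF assms(3)] ring_hom_add[OF assms(3)] ring_hom_one[OF assms(3)]
  show ?thesis
  proof (rule left_module.intro[OF assms(1)])
    show "abelian_group (restrict_scalars h M)"
      by (rule comm_group_abelian_groupI, rule comm_group_cong[OF M.a_comm_group]) (simp_all add: f)
    show "left_module_axioms S (restrict_scalars h M)"
      by unfold_locales
        (simp_all add: f h M.smult_closed M.smult_l_distr M.smult_r_distr M.smult_assoc M.smult_one)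
  qed
qed

lemma left_module_direct_sum:
  assumes "ring R" and M: "\<And>i. i \<in> I \<Longrightarrow> left_module R (M i)"
  shows "left_module R (direct_sum_module I M)"
    and "carrier (direct_sum_module I M) = {x \<in> \<Pi>\<^sub>E i\<in>I. carrier (M i). finite {i \<in> I. x i \<noteq> \<zero>\<^bsub>M i\<^esub>}}"
    and "x \<oplus>\<^bsub>direct_sum_module I M\<^esub> y = (\<lambda>i\<in>I. x i \<oplus>\<^bsub>M i\<^esub> y i)"
    and "a \<odot>\<^bsub>direct_sum_module I M\<^esub> x = (\<lambda>i\<in>I. a \<odot>\<^bsub>M i\<^esub> x i)"
proof -
  have ag: "abelian_group (M i)" if "i \<in> I" for i
    using M[OF that] by (simp add: left_module_def)
  have cg: "comm_group (add_monoid (M i))" if "i \<in> I" for i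
    using ag[OF that] by (rule abelian_group.a_comm_group)
  have g: "group (add_monoid (M i))" if "i \<in> I" for i
    using cg[OF that] by (simp add: comm_group_def)
  let ?D = "direct_sum_module I M" and ?G = "sum_group I (\<lambda>i. add_monoid (M i))"
  have G: "carrier ?G = {x \<in> \<Pi>\<^sub>E i\<in>I. carrier (M i). finite {i \<in> I. x i \<noteq> \<zero>\<^bsub>M i\<^esub>}}"
    using carrier_sum_group[of I "\<lambda>i. add_monoid (M i)"] g by simp
  show c: "carrier ?D = {x \<in> \<Pi>\<^sub>E i\<in>I. carrier (M i). finite {i \<in> I. x i \<noteq> \<zero>\<^bsub>M i\<^esub>}}"
    unfolding G[symmetric] by (simp add: direct_sum_module_def Let_def)
  show add: "x \<oplus>\<^bsub>?D\<^esub> y = (\<lambda>i\<in>I. x i \<oplus>\<^bsub>M i\<^esub> y i)" for x y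
    by (simp add: direct_sum_module_def Let_def)
  show sm: "a \<odot>\<^bsub>?D\<^esub> x = (\<lambda>i\<in>I. a \<odot>\<^bsub>M i\<^esub> x i)" for a x
    by (simp add: direct_sum_module_def Let_def)
  show "left_module R ?D"
  proof (rule left_module.intro[OF assms(1)])
    have "comm_group ?G"
    proof (rule group.group_comm_groupI)
      show "group ?G" by (rule sum_group) (rule g)
      fix x y assume "x \<in> carrier ?G" "y \<in> carrier ?G"
      then show "x \<otimes>\<^bsub>?G\<^esub> y = y \<otimes>\<^bsub>?G\<^esub> x"
        unfolding G by (auto simp: fun_eq_iff PiE_iff intro: abelian_monoid.a_comm abelian_group.axioms ag)
    qed
    then show "abelian_group ?D"
      by (intro comm_group_abelian_groupI) (erule comm_group_cong, simp_all add: direct_sum_module_def Let_def)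
    show "left_module_axioms R ?D"
    proof
      fix a x assume a: "a \<in> carrier R" and x: "x \<in> carrier ?D"
      have xi: "x i \<in> carrier (M i)" if "i \<in> I" for i using x that by (auto simp: c)
      have "{i \<in> I. a \<odot>\<^bsub>M i\<^esub> x i \<noteq> \<zero>\<^bsub>M i\<^esub>} \<subseteq> {i \<in> I. x i \<noteq> \<zero>\<^bsub>M i\<^esub>}"
        using left_module.smult_r_null[OF M a] by force
      then have "finite {i \<in> I. a \<odot>\<^bsub>M i\<^esub> x i \<noteq> \<zero>\<^bsub>M i\<^esub>}"
        using x finite_subset by (auto simp: c)
      then show "a \<odot>\<^bsub>?D\<^esub> x \<in> carrier ?D"
        using left_module.smult_closed[OF M a xi] by (simp add: c sm cong: conj_cong)
      {
        fix b assume b: "b \<in> carrier R"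
        show "(a \<oplus>\<^bsub>R\<^esub> b) \<odot>\<^bsub>?D\<^esub> x = a \<odot>\<^bsub>?D\<^esub> x \<oplus>\<^bsub>?D\<^esub> b \<odot>\<^bsub>?D\<^esub> x"
          using left_module.smult_l_distr[OF M a b xi] by (simp add: sm add fun_eq_iff)
        show "(a \<otimes>\<^bsub>R\<^esub> b) \<odot>\<^bsub>?D\<^esub> x = a \<odot>\<^bsub>?D\<^esub> (b \<odot>\<^bsub>?D\<^esub> x)"
          using left_module.smult_assoc[OF M a b xi] by (simp add: sm fun_eq_iff)
      }
      fix y assume y: "y \<in> carrier ?D"
      have yi: "y i \<in> carrier (M i)" if "i \<in> I" for i using y that by (auto simp: c)
      show "a \<odot>\<^bsub>?D\<^esub> (x \<oplus>\<^bsub>?D\<^esub> y) = a \<odot>\<^bsub>?D\<^esub> x \<oplus>\<^bsub>?D\<^esub> a \<odot>\<^bsub>?D\<^esub> y"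
        using left_module.smult_r_distr[OF M a xi yi] by (simp add: sm add fun_eq_iff)
    next
      fix x assume x: "x \<in> carrier ?D"
      have xi: "x i \<in> carrier (M i)" if "i \<in> I" for i using x that by (auto simp: c)
      show "\<one>\<^bsub>R\<^esub> \<odot>\<^bsub>?D\<^esub> x = x"
        using x left_module.smult_one[OF M xi] by (auto simp: sm fun_eq_iff c PiE_iff extensional_def)
    qed
  qed
qed

section \<open>The restriction rule\<close>

text \<open>With finitely many summands the support condition of the direct sum is automatic, and a
  family of components has a preimage obtained by a finite sum.\<close>

lemma finite_compositions: "finite {\<beta>. is_composition \<beta> k}"
proof (rule finite_subset)
  show "{\<beta>. is_composition \<beta> k} \<subseteq> {xs. set xs \<subseteq> {..k} \<and> length xs \<le> k}"
  proof clarify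
    fix \<beta> assume "is_composition \<beta> k"
    then have pos: "\<forall>b\<in>set \<beta>. 0 < b" and sum: "sum_list \<beta> = k" by (auto simp: is_composition_def)
    have "length \<beta> \<le> sum_list \<beta>" using pos by (induction \<beta>) auto
    moreover have "b \<le> sum_list \<beta>" if "b \<in> set \<beta>" for b using that by (intro member_le_sum_list) simp_all
    ultimately show "set \<beta> \<subseteq> {..k} \<and> length \<beta> \<le> k" using sum by auto
  qed
qed (simp add: finite_lists_length_le)

locale restriction_rule = parabolic_setup n m for n m +
  fixes \<alpha> :: "nat list"
  assumes \<alpha>: "is_composition \<alpha> n"
begin

sublocale full: skew_shape \<alpha> "[]" .

definition "I = {\<beta>. is_composition \<beta> (n - m) \<and> \<beta> \<le>\<^sub>c \<alpha>}"

abbreviation "U \<beta> \<equiv> underlying_space A (srct_module \<alpha> \<beta>)"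
abbreviation "V \<beta> \<equiv> underlying_space B (srct_module \<beta> [])"
abbreviation "W \<beta> \<equiv> tensor_module A B (srct_module \<alpha> \<beta>) (srct_module \<beta> [])"
abbreviation "shaped \<beta> \<equiv> cut.shaped \<alpha> \<beta> m"
abbreviation "upper \<beta> \<equiv> cut.upper \<alpha> \<beta>"
abbreviation "lower \<beta> \<equiv> cut.lower \<alpha> \<beta> m"
abbreviation "pure \<beta> \<equiv> pure_tensor (U \<beta>) (V \<beta>)"

lemma sum_\<alpha>: "sum_list \<alpha> = n"
  using \<alpha> by (simp add: is_composition_def)

lemma full_module: "left_module (hecke n) (srct_module \<alpha> [])"
  using full.left_module_srct by (simp add: sum_\<alpha>)

lemma finite_I: "finite I"
  unfolding I_def by (rule finite_subset[OF _ finite_compositions[of "n - m"]]) auto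

lemma cut: "\<beta> \<in> I \<Longrightarrow> cut \<alpha> \<beta> n m"
  using \<alpha> m_le by unfold_locales (auto simp: I_def)

lemma shape_exists:
  assumes "T \<in> SRCT \<alpha> []"
  obtains \<beta> where "\<beta> \<in> I" "T \<in> shaped \<beta>"
proof -
  obtain \<beta> where \<beta>: "is_composition \<beta> (n - m)" "\<beta> \<le>\<^sub>c \<alpha>" "inner_cells \<alpha> \<beta> = {x \<in> cells \<alpha>. m < T x}"
    using exists_cut_shape[OF assms \<alpha> m_le] by blast
  then have "\<beta> \<in> I" by (simp add: I_def)
  with \<beta> assms show thesis using that cut.shaped_def[OF cut] by blast
qed

text \<open>\<open>T\<close> determines its set of cells with entries above \<open>m\<close>, and
  that set determines the composition. Together with \<open>shape_exists\<close>, the sets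
  \<open>shaped \<beta>\<close> for \<open>\<beta>\<close> in \<open>I\<close> partition the
  tableaux of shape \<open>\<alpha>\<close>.\<close>

lemma shape_unique:
  assumes "\<beta> \<in> I" "\<gamma> \<in> I" "T \<in> shaped \<beta>" "T \<in> shaped \<gamma>"
  shows "\<beta> = \<gamma>"
proof (rule inner_cells_inj[of \<alpha>])
  show "inner_cells \<alpha> \<beta> = inner_cells \<alpha> \<gamma>"
    using assms(3,4) cut.shaped_def[OF cut[OF assms(1)]] cut.shaped_def[OF cut[OF assms(2)]] by simp
qed (use assms(1,2) comp_le_contained(1) in \<open>auto simp: I_def is_composition_def\<close>)

lemma shaped_SRCT: "\<lbrakk>\<beta> \<in> I; T \<in> shaped \<beta>\<rbrakk> \<Longrightarrow> T \<in> SRCT \<alpha> []"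
  using cut.shaped_def[OF cut] by simp

section \<open>The projection to the summand of one composition\<close>

context
  fixes \<beta> assumes \<beta>: "\<beta> \<in> I"
begin

interpretation Q: cut \<alpha> \<beta> n m by (rule cut[OF \<beta>])

lemma modules: "left_module A (srct_module \<alpha> \<beta>)" "left_module B (srct_module \<beta> [])"
  using Q.skew.left_module_srct Q.inner.left_module_srct by (simp_all only: Q.sizes skew_size_empty)

interpretation SU: left_module A "srct_module \<alpha> \<beta>" by (rule modules)
interpretation SV: left_module B "srct_module \<beta> []" by (rule modules)

lemma carriers: "carrier (U \<beta>) = {v. Poly_Mapping.keys v \<subseteq> SRCT \<alpha> \<beta>}"
  "carrier (V \<beta>) = {v. Poly_Mapping.keys v \<subseteq> SRCT \<beta> []}"
  "add (U \<beta>) = (+)" "add (V \<beta>) = (+)" "\<zero>\<^bsub>U \<beta>\<^esub> = 0" "\<zero>\<^bsub>V \<beta>\<^esub> = 0"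
  by (simp_all add: underlying_space_def restrict_scalars_def)

lemma scalings:
  "u \<in> carrier (U \<beta>) \<Longrightarrow> c \<odot>\<^bsub>U \<beta>\<^esub> u = scale c u"
  "v \<in> carrier (V \<beta>) \<Longrightarrow> c \<odot>\<^bsub>V \<beta>\<^esub> v = scale c v"
  using Q.skew.scalar_smult[of u c] Q.inner.scalar_smult[of v c] unfolding Q.sizes skew_size_empty carriers
  by (simp_all only: underlying_space_def restrict_scalars_def module.simps)

lemma spaces: "tensor_spaces (U \<beta>) (V \<beta>)"
  using modules Hm.H.complex_algebra_axioms Hk.H.complex_algebra_axioms
  by (intro tensor_spaces.intro complex_space_underlying_space)

interpretation UV: tensor_spaces "U \<beta>" "V \<beta>" by (rule spaces)

lemma left_module_W: "left_module TT.T (W \<beta>)"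
  by (rule TT.left_module_tensor_module(1)[OF modules])

interpretation W: left_module TT.T "W \<beta>" by (rule left_module_W)

lemma W_fields: "carrier (W \<beta>) = carrier (tensor_group (U \<beta>) (V \<beta>))"
  "add (W \<beta>) = monoid.mult (tensor_group (U \<beta>) (V \<beta>))" "\<zero>\<^bsub>W \<beta>\<^esub> = \<one>\<^bsub>tensor_group (U \<beta>) (V \<beta>)\<^esub>"
  by (simp_all add: tensor_module_def Let_def)

lemma smult_pure_W:
  assumes "a \<in> carrier A" "b \<in> carrier B" "u \<in> carrier (U \<beta>)" "v \<in> carrier (V \<beta>)"
  shows "pure_tensor A B a b \<odot>\<^bsub>W \<beta>\<^esub> pure \<beta> u v = pure \<beta> (a \<odot>\<^bsub>srct_module \<alpha> \<beta>\<^esub> u) (b \<odot>\<^bsub>srct_module \<beta> []\<^esub> v)"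
  using assms TT.left_module_tensor_module(2)[OF modules, of a b u v]
  by (simp add: carriers)

text \<open>The component in summand \<open>\<beta>\<close> of the image of \<open>c\<close> times
  \<open>T\<close>: the coefficient is put into the left tensor factor, and tableaux cut along
  another composition go to zero.\<close>

definition "part_single T c =
  (if T \<in> shaped \<beta> then pure \<beta> (Poly_Mapping.single (upper \<beta> T) c) (Poly_Mapping.single (lower \<beta> T) 1) else \<zero>\<^bsub>W \<beta>\<^esub>)"
  for c :: complex

definition "part v = additive_extend (W \<beta>) part_single v"

lemma single_closed:
  assumes "T \<in> shaped \<beta>"
  shows "Poly_Mapping.single (upper \<beta> T) c \<in> carrier (U \<beta>)" "Poly_Mapping.single (lower \<beta> T) c \<in> carrier (V \<beta>)"
  using Q.upper_SRCT[OF assms] Q.lower_SRCT[OF assms] by (simp_all add: carriers)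

lemma part_single_closed: "part_single T c \<in> carrier (W \<beta>)"
  unfolding part_single_def using single_closed W.M.zero_closed UV.pure_closed
  by (simp add: W_fields)

interpretation part: additive_family "W \<beta>" part_single "SRCT \<alpha> []"
proof unfold_locales
  fix T a b
  show "part_single T (a + b) = part_single T a \<oplus>\<^bsub>W \<beta>\<^esub> part_single T b"
  proof (cases "T \<in> shaped \<beta>")
    case True
    have "Poly_Mapping.single (upper \<beta> T) (a + b) =
        Poly_Mapping.single (upper \<beta> T) a \<oplus>\<^bsub>U \<beta>\<^esub> Poly_Mapping.single (upper \<beta> T) b"
      by (simp add: carriers single_add)
    then show ?thesis
      using True UV.pure_add_left[OF single_closed(1)[OF True] single_closed(1)[OF True] single_closed(2)[OF True]]
      by (simp add: part_single_def W_fields)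
  next
    case False
    then show ?thesis using W.M.l_zero[OF W.M.zero_closed] by (simp only: part_single_def if_False)
  qed
qed (rule part_single_closed)

lemma part_closed: "Poly_Mapping.keys v \<subseteq> SRCT \<alpha> [] \<Longrightarrow> part v \<in> carrier (W \<beta>)"
  unfolding part_def by (rule part.additive_extend_closed)

lemma part_add: "\<lbrakk>Poly_Mapping.keys v \<subseteq> SRCT \<alpha> []; Poly_Mapping.keys w \<subseteq> SRCT \<alpha> []\<rbrakk> \<Longrightarrow>
    part (v + w) = part v \<oplus>\<^bsub>W \<beta>\<^esub> part w"
  unfolding part_def by (rule part.additive_extend_add)

lemma part_of_single: "T \<in> SRCT \<alpha> [] \<Longrightarrow> part (Poly_Mapping.single T c) = part_single T c"
  unfolding part_def by (rule part.additive_extend_single)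

lemma part_zero: "part 0 = \<zero>\<^bsub>W \<beta>\<^esub>"
  unfolding part_def by (rule part.additive_extend_0)

lemma part_other_shape:
  assumes "\<gamma> \<in> I" "\<gamma> \<noteq> \<beta>" "Poly_Mapping.keys v \<subseteq> shaped \<gamma>"
  shows "part v = \<zero>\<^bsub>W \<beta>\<^esub>"
  using assms(3)
proof (induction v rule: finsupp_induct)
  case (single T c)
  then have "T \<notin> shaped \<beta>" using shape_unique[OF \<beta> assms(1)] assms(2) by blast
  then show ?case using shaped_SRCT[OF assms(1) single] by (simp add: part_of_single part_single_def)
next
  case (add v w)
  then have "Poly_Mapping.keys v \<subseteq> SRCT \<alpha> []" "Poly_Mapping.keys w \<subseteq> SRCT \<alpha> []"
    using shaped_SRCT[OF assms(1)] by blast+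
  then show ?case using add W.M.l_zero[OF W.M.zero_closed] by (simp only: part_add)
qed (rule part_zero)

text \<open>The presentation of the tensor product does not exhibit a basis, so independence is
  shown by a functional: the product of the coordinates at \<open>upper \<beta> T\<close> and
  \<open>lower \<beta> T\<close> is balanced, lifts by \<open>tensor_lift\<close>, and reads the
  coefficient of \<open>T\<close> off \<open>part v\<close>.\<close>

lemma part_coefficient:
  assumes T: "T \<in> shaped \<beta>" and v: "Poly_Mapping.keys v \<subseteq> SRCT \<alpha> []" and w: "Poly_Mapping.keys w \<subseteq> SRCT \<alpha> []"
    and eq: "part v = part w"
  shows "Poly_Mapping.lookup v T = Poly_Mapping.lookup w T"
proof -
  \<comment> \<open>The additive group of the complex numbers, written as the multiplicative record
    that \<open>tensor_lift\<close> expects.\<close>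
  define G :: "complex monoid" where "G = \<lparr>carrier = UNIV, monoid.mult = (+), one = 0\<rparr>"
  have G: "comm_group G"
    by (rule comm_groupI) (auto simp: G_def intro: exI[of _ "- _"])
  let ?f = "\<lambda>u v. Poly_Mapping.lookup u (upper \<beta> T) * Poly_Mapping.lookup v (lower \<beta> T)"
  have "\<exists>h. h \<in> hom (tensor_group (U \<beta>) (V \<beta>)) G \<and>
    (\<forall>u\<in>carrier (U \<beta>). \<forall>v\<in>carrier (V \<beta>). h (pure \<beta> u v) = ?f u v)"
    by (rule UV.tensor_lift[OF G, of ?f])
      (auto simp: G_def carriers scalings[unfolded carriers] lookup_add algebra_simps)
  then obtain h where h: "h \<in> hom (tensor_group (U \<beta>) (V \<beta>)) G"
    and hp: "\<And>u v. \<lbrakk>u \<in> carrier (U \<beta>); v \<in> carrier (V \<beta>)\<rbrakk> \<Longrightarrow> h (pure \<beta> u v) = ?f u v" by blast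
  have h_add: "h (s \<oplus>\<^bsub>W \<beta>\<^esub> t) = h s + h t" if "s \<in> carrier (W \<beta>)" "t \<in> carrier (W \<beta>)" for s t
    using h that by (simp add: hom_def W_fields G_def)
  have h_zero: "h \<zero>\<^bsub>W \<beta>\<^esub> = 0"
    using h_add[OF W.M.zero_closed W.M.zero_closed] W.M.l_zero[OF W.M.zero_closed] by simp
  have coeff: "h (part v) = Poly_Mapping.lookup v T" if "Poly_Mapping.keys v \<subseteq> SRCT \<alpha> []" for v
    using that
  proof (induction v rule: finsupp_induct)
    case zero
    then show ?case by (simp add: part_zero h_zero)
  next
    case (add v w)
    then show ?case by (simp add: part_add h_add part_closed lookup_add)
  next
    case (single T' c)
    show ?case
    proof (cases "T' \<in> shaped \<beta>")
      case True
      \<comment> \<open>Gluing recovers a tableau from its two pieces, so the functional vanishes on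
        all other tableaux of this block.\<close>
      have "upper \<beta> T' = upper \<beta> T \<and> lower \<beta> T' = lower \<beta> T \<longleftrightarrow> T' = T"
        using Q.glue_split[OF True] Q.glue_split[OF T] by metis
      then show ?thesis
        using single True hp[OF single_closed[OF True]]
        by (auto simp: part_of_single part_single_def lookup_single when_def)
    next
      case False
      then have "T' \<noteq> T" using T by blast
      then show ?thesis using single False by (simp add: part_of_single part_single_def h_zero lookup_single)
    qed
  qed
  show ?thesis using coeff[OF v] coeff[OF w] eq by simp
qed

text \<open>A pure tensor expands into tensors of two tableaux, and \<open>glue\<close> turns each
  such pair into a tableau of shape \<open>\<alpha>\<close>. The support inside
  \<open>shaped \<beta>\<close> makes the preimage invisible to the other components.\<close>

lemma part_surj:
  assumes "y \<in> carrier (W \<beta>)"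
  shows "\<exists>v. Poly_Mapping.keys v \<subseteq> shaped \<beta> \<and> part v = y"
proof -
  have sub: "Poly_Mapping.keys v \<subseteq> SRCT \<alpha> []" if "Poly_Mapping.keys v \<subseteq> shaped \<beta>" for v :: "_ \<Rightarrow>\<^sub>0 complex"
    using that shaped_SRCT[OF \<beta>] by blast
  let ?R = "\<lambda>y. \<exists>v. Poly_Mapping.keys v \<subseteq> shaped \<beta> \<and> part v = y"
  have zero: "?R \<zero>\<^bsub>W \<beta>\<^esub>" by (intro exI[of _ 0]) (simp add: part_zero)
  have add: "?R (s \<oplus>\<^bsub>W \<beta>\<^esub> t)" if st: "?R s" "?R t" for s t
  proof -
    obtain v w where vw: "Poly_Mapping.keys v \<subseteq> shaped \<beta>" "part v = s" "Poly_Mapping.keys w \<subseteq> shaped \<beta>" "part w = t"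
      using st by blast
    then show ?thesis
      using part_add[OF sub[OF vw(1)] sub[OF vw(3)]] keys_add_subset[OF vw(1,3)] by blast
  qed
  have pure_zero_right: "pure \<beta> u 0 = \<zero>\<^bsub>W \<beta>\<^esub>" if "u \<in> carrier (U \<beta>)" for u
  proof -
    have z: "0 \<in> carrier (V \<beta>)" by (simp add: carriers)
    have "pure \<beta> u 0 = pure \<beta> u 0 \<oplus>\<^bsub>W \<beta>\<^esub> pure \<beta> u 0"
      using UV.pure_add_right[OF that z z] by (simp add: W_fields carriers)
    moreover have "pure \<beta> u 0 \<in> carrier (W \<beta>)" using that z by (simp add: W_fields)
    ultimately show ?thesis by (metis W.M.add.r_cancel_one')
  qed
  have "y \<in> carrier (tensor_group (U \<beta>) (V \<beta>))" using assms by (simp add: W_fields)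
  then show ?thesis
  proof (induction y rule: UV.tensor_induct)
    case (add s t)
    then show ?case using \<open>\<And>s t. ?R s \<Longrightarrow> ?R t \<Longrightarrow> ?R (s \<oplus>\<^bsub>W \<beta>\<^esub> t)\<close>[of s t] by (simp add: W_fields)
  next
    case (pure u w)
    then have u: "Poly_Mapping.keys u \<subseteq> SRCT \<alpha> \<beta>" and w: "Poly_Mapping.keys w \<subseteq> SRCT \<beta> []"
      by (simp_all add: carriers)
    show ?case
      using u
    proof (induction u rule: finsupp_induct)
      case zero
      then show ?case using \<open>?R \<zero>\<^bsub>W \<beta>\<^esub>\<close> UV.pure_zero_left[OF pure(2)] by (simp add: carriers W_fields)
    next
      case (add u u')
      then show ?case
        using UV.pure_add_left[of u u' w] pure(2) \<open>\<And>s t. ?R s \<Longrightarrow> ?R t \<Longrightarrow> ?R (s \<oplus>\<^bsub>W \<beta>\<^esub> t)\<close>[of "pure \<beta> u w" "pure \<beta> u' w"]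
        by (simp add: carriers W_fields)
    next
      case (single \<tau> a)
      have ua: "Poly_Mapping.single \<tau> a \<in> carrier (U \<beta>)" for a using single by (simp add: carriers)
      show ?case
        using w
      proof (induction w rule: finsupp_induct)
        case zero
        then show ?case using \<open>?R \<zero>\<^bsub>W \<beta>\<^esub>\<close> pure_zero_right[OF ua] by simp
      next
        case (add w w')
        then show ?case
          using UV.pure_add_right[OF ua[of a], of w' w]
            \<open>\<And>s t. ?R s \<Longrightarrow> ?R t \<Longrightarrow> ?R (s \<oplus>\<^bsub>W \<beta>\<^esub> t)\<close>[of "pure \<beta> (Poly_Mapping.single \<tau> a) w" "pure \<beta> (Poly_Mapping.single \<tau> a) w'"]
          by (simp add: carriers W_fields)
      next
        case (single \<sigma> b)
        note g = Q.glue_shaped[OF \<open>\<tau> \<in> _\<close> \<open>\<sigma> \<in> _\<close>]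
        have vb: "Poly_Mapping.single \<sigma> 1 \<in> carrier (V \<beta>)" using single by (simp add: carriers)
        \<comment> \<open>\<open>part_single\<close> keeps the coefficient on the left, so
          \<open>b\<close> is first collected there and then moved to the right factor by
          balancedness.\<close>
        have "part (Poly_Mapping.single (Q.glue \<tau> \<sigma>) (b * a)) =
            pure \<beta> (Poly_Mapping.single \<tau> (b * a)) (Poly_Mapping.single \<sigma> 1)"
          using shaped_SRCT[OF \<beta> g(1)] g by (simp add: part_of_single part_single_def)
        also have "\<dots> = pure \<beta> (b \<odot>\<^bsub>U \<beta>\<^esub> Poly_Mapping.single \<tau> a) (Poly_Mapping.single \<sigma> 1)"
          by (simp add: scalings(1)[OF ua])
        also have "\<dots> = pure \<beta> (Poly_Mapping.single \<tau> a) (Poly_Mapping.single \<sigma> b)"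
          by (simp add: UV.pure_balanced[OF ua vb] scalings(2)[OF vb])
        finally show ?case
          using g(1) by (intro exI[of _ "Poly_Mapping.single (Q.glue \<tau> \<sigma>) (b * a)"]) simp
      qed
    qed
  qed
qed

section \<open>Equivariance of the projection\<close>

context
  fixes \<iota>
  assumes \<iota>: "\<iota> \<in> algebra_hom TT.T (hecke n)"
    and \<iota>_left: "\<And>i. i \<in> {1..<m} \<Longrightarrow> \<iota> (pure_tensor A B (hecke_gen m i) \<one>\<^bsub>B\<^esub>) = hecke_gen n i"
    and \<iota>_right: "\<And>i. i \<in> {1..<n - m} \<Longrightarrow> \<iota> (pure_tensor A B \<one>\<^bsub>A\<^esub> (hecke_gen (n - m) i)) = hecke_gen n (i + m)"
begin

interpretation FM: left_module "hecke n" "srct_module \<alpha> []" by (rule full_module)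

lemmas \<iota>D = algebra_homD[OF \<iota>]

lemma full_closed: "\<lbrakk>a \<in> carrier TT.T; Poly_Mapping.keys v \<subseteq> SRCT \<alpha> []\<rbrakk> \<Longrightarrow>
    Poly_Mapping.keys (\<iota> a \<odot>\<^bsub>srct_module \<alpha> []\<^esub> v) \<subseteq> SRCT \<alpha> []"
  using FM.smult_closed[of "\<iota> a" v] \<iota>D(2)[of a] by simp

lemma part_equivariant_single:
  assumes a: "a \<in> carrier TT.T"
    and single: "\<And>T c. T \<in> SRCT \<alpha> [] \<Longrightarrow> part (\<iota> a \<odot>\<^bsub>srct_module \<alpha> []\<^esub> Poly_Mapping.single T c) = a \<odot>\<^bsub>W \<beta>\<^esub> part_single T c"
    and v: "Poly_Mapping.keys v \<subseteq> SRCT \<alpha> []"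
  shows "part (\<iota> a \<odot>\<^bsub>srct_module \<alpha> []\<^esub> v) = a \<odot>\<^bsub>W \<beta>\<^esub> part v"
  using v
proof (induction v rule: finsupp_induct)
  case zero
  then show ?case
    using FM.smult_r_null[OF \<iota>D(2)[OF a]] W.smult_r_null[OF a] by (simp add: part_zero)
next
  case (single T c)
  then show ?case using assms(2) by (simp add: part_of_single)
next
  case (add v w)
  have "\<iota> a \<odot>\<^bsub>srct_module \<alpha> []\<^esub> (v + w) = \<iota> a \<odot>\<^bsub>srct_module \<alpha> []\<^esub> v + \<iota> a \<odot>\<^bsub>srct_module \<alpha> []\<^esub> w"
    using FM.smult_r_distr[OF \<iota>D(2)[OF a], of v w] add by simp
  then show ?case
    using add full_closed[OF a] W.smult_r_distr[OF a] part_closed by (simp add: part_add)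
qed

text \<open>By \<open>pi_op_upper\<close> the operator stays inside the block of the composition
  \<open>\<gamma>\<close> that belongs to \<open>T\<close>. For
  \<open>\<gamma> \<noteq> \<beta>\<close> both sides vanish; for \<open>\<gamma> = \<beta>\<close>
  the outcome on \<open>T\<close> matches the outcome on \<open>upper \<beta> T\<close>, while the
  right factor is fixed by the unit.\<close>

lemma part_equivariant_left:
  assumes i: "i \<in> {1..<m}" and T: "T \<in> SRCT \<alpha> []"
  shows "part (hecke_gen n i \<odot>\<^bsub>srct_module \<alpha> []\<^esub> Poly_Mapping.single T c) =
    pure_tensor A B (hecke_gen m i) \<one>\<^bsub>B\<^esub> \<odot>\<^bsub>W \<beta>\<^esub> part_single T c"
proof -
  let ?a = "pure_tensor A B (hecke_gen m i) \<one>\<^bsub>B\<^esub>"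
  have gm: "hecke_gen m i \<in> carrier A" by (rule Hm.hecke_gen_closed[OF i])
  then have a: "?a \<in> carrier TT.T" by simp
  have i': "i \<in> {1..<skew_size \<alpha> []}" "i \<in> {1..<skew_size \<alpha> \<beta>}" using i m_le by (auto simp: sum_\<alpha> Q.sizes)
  have lhs: "hecke_gen n i \<odot>\<^bsub>srct_module \<alpha> []\<^esub> Poly_Mapping.single T c = scale c (pi_op \<alpha> [] i T)"
    using full.gen_smult[OF i'(1), of "Poly_Mapping.single T c"] T by (simp add: sum_\<alpha> full.act_def)
  obtain \<gamma> where \<gamma>: "\<gamma> \<in> I" "T \<in> shaped \<gamma>" using T by (rule shape_exists)
  note cases = cut.pi_op_upper[OF cut[OF \<gamma>(1)] \<gamma>(2) i]
  show ?thesis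
  proof (cases "\<gamma> = \<beta>")
    case False
    then have "T \<notin> shaped \<beta>" using shape_unique[OF \<beta> \<gamma>(1)] \<gamma>(2) by blast
    then have r: "?a \<odot>\<^bsub>W \<beta>\<^esub> part_single T c = \<zero>\<^bsub>W \<beta>\<^esub>"
      using W.smult_r_null[OF a] by (simp add: part_single_def)
    have "Poly_Mapping.keys (scale c (pi_op \<alpha> [] i T)) \<subseteq> shaped \<gamma>"
      using cases keys_scale[of c "pi_op \<alpha> [] i T"] by auto
    then show ?thesis unfolding lhs r by (rule part_other_shape[OF \<gamma>(1) False])
  next
    case True
    then have Ts: "T \<in> shaped \<beta>" using \<gamma> by simp
    have act: "hecke_gen m i \<odot>\<^bsub>srct_module \<alpha> \<beta>\<^esub> Poly_Mapping.single (upper \<beta> T) c = scale c (pi_op \<alpha> \<beta> i (upper \<beta> T))"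
      using Q.skew.gen_smult[OF i'(2), of "Poly_Mapping.single (upper \<beta> T) c"] Q.upper_SRCT[OF Ts]
      by (simp add: Q.sizes Q.skew.act_def)
    have one: "\<one>\<^bsub>B\<^esub> \<odot>\<^bsub>srct_module \<beta> []\<^esub> Poly_Mapping.single (lower \<beta> T) 1 = Poly_Mapping.single (lower \<beta> T) 1"
      using SV.smult_one[of "Poly_Mapping.single (lower \<beta> T) 1"] Q.lower_SRCT[OF Ts] by simp
    have rhs: "?a \<odot>\<^bsub>W \<beta>\<^esub> part_single T c =
        pure \<beta> (scale c (pi_op \<alpha> \<beta> i (upper \<beta> T))) (Poly_Mapping.single (lower \<beta> T) 1)"
      using Ts smult_pure_W[OF gm Hk.H.one_closed single_closed[OF Ts]] by (simp add: part_single_def act one)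
    from cases[unfolded True] show ?thesis
    proof (elim disjE conjE bexE)
      assume "pi_op \<alpha> [] i T = 0" "pi_op \<alpha> \<beta> i (upper \<beta> T) = 0"
      then show ?thesis
        unfolding lhs rhs using UV.pure_zero_left[OF single_closed(2)[OF Ts, of 1]]
        by (simp add: part_zero W_fields carriers)
    next
      fix T' assume T': "T' \<in> shaped \<beta>" "pi_op \<alpha> [] i T = Poly_Mapping.single T' 1"
        "pi_op \<alpha> \<beta> i (upper \<beta> T) = Poly_Mapping.single (upper \<beta> T') 1" "lower \<beta> T' = lower \<beta> T"
      then show ?thesis
        unfolding lhs rhs using shaped_SRCT[OF \<beta> T'(1)] by (simp add: part_of_single part_single_def)
    qed
  qed
qed

lemma part_equivariant_right:
  assumes i: "i \<in> {1..<n - m}" and T: "T \<in> SRCT \<alpha> []"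
  shows "part (hecke_gen n (i + m) \<odot>\<^bsub>srct_module \<alpha> []\<^esub> Poly_Mapping.single T c) =
    pure_tensor A B \<one>\<^bsub>A\<^esub> (hecke_gen (n - m) i) \<odot>\<^bsub>W \<beta>\<^esub> part_single T c"
proof -
  let ?a = "pure_tensor A B \<one>\<^bsub>A\<^esub> (hecke_gen (n - m) i)"
  have gm: "hecke_gen (n - m) i \<in> carrier B" by (rule Hk.hecke_gen_closed[OF i])
  then have a: "?a \<in> carrier TT.T" by simp
  have i': "i + m \<in> {1..<skew_size \<alpha> []}" "i \<in> {1..<skew_size \<beta> []}" using i by (auto simp: sum_\<alpha> Q.sizes)
  have lhs: "hecke_gen n (i + m) \<odot>\<^bsub>srct_module \<alpha> []\<^esub> Poly_Mapping.single T c = scale c (pi_op \<alpha> [] (i + m) T)"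
    using full.gen_smult[OF i'(1), of "Poly_Mapping.single T c"] T by (simp add: sum_\<alpha> full.act_def)
  obtain \<gamma> where \<gamma>: "\<gamma> \<in> I" "T \<in> shaped \<gamma>" using T by (rule shape_exists)
  note cases = cut.pi_op_lower[OF cut[OF \<gamma>(1)] \<gamma>(2) i]
  show ?thesis
  proof (cases "\<gamma> = \<beta>")
    case False
    then have "T \<notin> shaped \<beta>" using shape_unique[OF \<beta> \<gamma>(1)] \<gamma>(2) by blast
    then have r: "?a \<odot>\<^bsub>W \<beta>\<^esub> part_single T c = \<zero>\<^bsub>W \<beta>\<^esub>"
      using W.smult_r_null[OF a] by (simp add: part_single_def)
    have "Poly_Mapping.keys (scale c (pi_op \<alpha> [] (i + m) T)) \<subseteq> shaped \<gamma>"
      using cases keys_scale[of c "pi_op \<alpha> [] (i + m) T"] by auto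
    then show ?thesis unfolding lhs r by (rule part_other_shape[OF \<gamma>(1) False])
  next
    case True
    then have Ts: "T \<in> shaped \<beta>" using \<gamma> by simp
    let ?u = "Poly_Mapping.single (upper \<beta> T) c"
    have act: "hecke_gen (n - m) i \<odot>\<^bsub>srct_module \<beta> []\<^esub> Poly_Mapping.single (lower \<beta> T) 1 = pi_op \<beta> [] i (lower \<beta> T)"
      using Q.inner.gen_smult[OF i'(2), of "Poly_Mapping.single (lower \<beta> T) 1"] Q.lower_SRCT[OF Ts]
      by (simp add: Q.sizes Q.inner.act_def)
    have one: "\<one>\<^bsub>A\<^esub> \<odot>\<^bsub>srct_module \<alpha> \<beta>\<^esub> ?u = ?u"
      using SU.smult_one[of ?u] Q.upper_SRCT[OF Ts] by simp
    have rhs: "?a \<odot>\<^bsub>W \<beta>\<^esub> part_single T c = pure \<beta> ?u (pi_op \<beta> [] i (lower \<beta> T))"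
      using Ts smult_pure_W[OF Hm.H.one_closed gm single_closed[OF Ts]] by (simp add: part_single_def act one)
    from cases[unfolded True] show ?thesis
    proof (elim disjE conjE bexE)
      assume z: "pi_op \<alpha> [] (i + m) T = 0" "pi_op \<beta> [] i (lower \<beta> T) = 0"
      \<comment> \<open>A zero in the right factor is moved to the left by balancedness:
        \<open>u \<otimes> 0\<close> equals \<open>u \<otimes> (0 0)\<close>, hence
        \<open>(0 u) \<otimes> 0\<close>, which is zero.\<close>
      have "0 \<in> carrier (V \<beta>)" by (simp add: carriers)
      then have "pure \<beta> ?u (0 \<odot>\<^bsub>V \<beta>\<^esub> 0) = pure \<beta> (0 \<odot>\<^bsub>U \<beta>\<^esub> ?u) 0"
        using UV.pure_balanced[OF single_closed(1)[OF Ts]] by simp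
      then show ?thesis
        unfolding lhs rhs using z UV.pure_zero_left[of 0] \<open>0 \<in> carrier (V \<beta>)\<close>
        by (simp add: part_zero W_fields scalings single_closed(1)[OF Ts]) (simp add: carriers)
    next
      fix T' assume T': "T' \<in> shaped \<beta>" "pi_op \<alpha> [] (i + m) T = Poly_Mapping.single T' 1"
        "pi_op \<beta> [] i (lower \<beta> T) = Poly_Mapping.single (lower \<beta> T') 1" "upper \<beta> T' = upper \<beta> T"
      then show ?thesis
        unfolding lhs rhs using shaped_SRCT[OF \<beta> T'(1)] by (simp add: part_of_single part_single_def)
    qed
  qed
qed

text \<open>The scalar multiples of the unit belong to the ring generators of the tensor algebra, so
  they need a check of their own.\<close>

lemma part_equivariant_scalar:
  assumes T: "T \<in> SRCT \<alpha> []"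
  shows "part (\<iota> (b \<odot>\<^bsub>TT.T\<^esub> \<one>\<^bsub>TT.T\<^esub>) \<odot>\<^bsub>srct_module \<alpha> []\<^esub> Poly_Mapping.single T c) =
    (b \<odot>\<^bsub>TT.T\<^esub> \<one>\<^bsub>TT.T\<^esub>) \<odot>\<^bsub>W \<beta>\<^esub> part_single T c"
proof -
  have one: "\<one>\<^bsub>TT.T\<^esub> \<in> carrier TT.T" by (rule TT.T.one_closed)
  have "\<iota> (b \<odot>\<^bsub>TT.T\<^esub> \<one>\<^bsub>TT.T\<^esub>) = b \<odot>\<^bsub>hecke n\<^esub> \<one>\<^bsub>hecke n\<^esub>"
    using \<iota>D(6)[OF one, of b] by (simp only: \<iota>D(5))
  then have lhs: "\<iota> (b \<odot>\<^bsub>TT.T\<^esub> \<one>\<^bsub>TT.T\<^esub>) \<odot>\<^bsub>srct_module \<alpha> []\<^esub> Poly_Mapping.single T c = Poly_Mapping.single T (b * c)"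
    using full.scalar_smult[of "Poly_Mapping.single T c" b] T by (simp add: sum_\<alpha>)
  have a: "b \<odot>\<^bsub>TT.T\<^esub> \<one>\<^bsub>TT.T\<^esub> = pure_tensor A B (b \<odot>\<^bsub>A\<^esub> \<one>\<^bsub>A\<^esub>) \<one>\<^bsub>B\<^esub>"
    using TT.smult_pure[OF Hm.H.one_closed Hk.H.one_closed, of b] by (simp only: TT.tensor_algebra_simps)
  show ?thesis
  proof (cases "T \<in> shaped \<beta>")
    case True
    have "(b \<odot>\<^bsub>A\<^esub> \<one>\<^bsub>A\<^esub>) \<odot>\<^bsub>srct_module \<alpha> \<beta>\<^esub> Poly_Mapping.single (upper \<beta> T) c = Poly_Mapping.single (upper \<beta> T) (b * c)"
      using Q.skew.scalar_smult[of "Poly_Mapping.single (upper \<beta> T) c" b] Q.upper_SRCT[OF True] by (simp add: Q.sizes)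
    moreover have "\<one>\<^bsub>B\<^esub> \<odot>\<^bsub>srct_module \<beta> []\<^esub> Poly_Mapping.single (lower \<beta> T) 1 = Poly_Mapping.single (lower \<beta> T) 1"
      using SV.smult_one[of "Poly_Mapping.single (lower \<beta> T) 1"] Q.lower_SRCT[OF True] by simp
    ultimately show ?thesis
      unfolding lhs unfolding a using T True smult_pure_W[OF Hm.H.scale_closed[OF Hm.H.one_closed] Hk.H.one_closed single_closed[OF True]]
      by (simp add: part_of_single part_single_def)
  next
    case False
    then show ?thesis
      unfolding lhs using T W.smult_r_null[OF TT.T.scale_closed[OF one]]
      by (simp add: part_of_single part_single_def)
  qed
qed

text \<open>The elements that are equivariant on all vectors are closed under the ring operations
  and include the generators. The vector stays arbitrary in the induction because a product
  \<open>a b\<close> uses the claim for \<open>a\<close> at the vector obtained by acting with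
  \<open>b\<close>.\<close>

lemma part_equivariant:
  assumes "a \<in> carrier TT.T" "Poly_Mapping.keys v \<subseteq> SRCT \<alpha> []"
  shows "part (\<iota> a \<odot>\<^bsub>srct_module \<alpha> []\<^esub> v) = a \<odot>\<^bsub>W \<beta>\<^esub> part v"
proof -
  let ?S = "tensor_gens \<union> {c \<odot>\<^bsub>TT.T\<^esub> \<one>\<^bsub>TT.T\<^esub> | c. True}"
  have cl: "x \<in> carrier TT.T" if "x \<in> generate_ring TT.T ?S" for x
    using that tensor_generated by blast
  have scalar: "part (\<iota> (c \<odot>\<^bsub>TT.T\<^esub> \<one>\<^bsub>TT.T\<^esub>) \<odot>\<^bsub>srct_module \<alpha> []\<^esub> v) = (c \<odot>\<^bsub>TT.T\<^esub> \<one>\<^bsub>TT.T\<^esub>) \<odot>\<^bsub>W \<beta>\<^esub> part v"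
    if "Poly_Mapping.keys v \<subseteq> SRCT \<alpha> []" for c v
    by (rule part_equivariant_single[OF TT.T.scale_closed[OF TT.T.one_closed] part_equivariant_scalar that])
  have mult: "part (\<iota> (a \<otimes>\<^bsub>TT.T\<^esub> b) \<odot>\<^bsub>srct_module \<alpha> []\<^esub> v) = (a \<otimes>\<^bsub>TT.T\<^esub> b) \<odot>\<^bsub>W \<beta>\<^esub> part v"
    if a: "a \<in> carrier TT.T" and b: "b \<in> carrier TT.T"
      and Pa: "\<And>v. Poly_Mapping.keys v \<subseteq> SRCT \<alpha> [] \<Longrightarrow> part (\<iota> a \<odot>\<^bsub>srct_module \<alpha> []\<^esub> v) = a \<odot>\<^bsub>W \<beta>\<^esub> part v"
      and Pb: "\<And>v. Poly_Mapping.keys v \<subseteq> SRCT \<alpha> [] \<Longrightarrow> part (\<iota> b \<odot>\<^bsub>srct_module \<alpha> []\<^esub> v) = b \<odot>\<^bsub>W \<beta>\<^esub> part v"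
      and v: "Poly_Mapping.keys v \<subseteq> SRCT \<alpha> []" for a b v
  proof -
    have "\<iota> (a \<otimes>\<^bsub>TT.T\<^esub> b) \<odot>\<^bsub>srct_module \<alpha> []\<^esub> v = \<iota> a \<odot>\<^bsub>srct_module \<alpha> []\<^esub> (\<iota> b \<odot>\<^bsub>srct_module \<alpha> []\<^esub> v)"
      unfolding \<iota>D(3)[OF a b] by (rule FM.smult_assoc) (use \<iota>D(2) a b v in auto)
    then show ?thesis
      using Pa[OF full_closed[OF b v]] Pb[OF v] W.smult_assoc[OF a b part_closed[OF v]] by simp
  qed
  have "a \<in> generate_ring TT.T ?S" using assms(1) tensor_generated by simp
  then show ?thesis
    using assms(2)
  proof (induction a arbitrary: v rule: generate_ring.induct)
    case one
    then show ?case using FM.smult_one[of v] W.smult_one[OF part_closed] by (simp only: \<iota>D(5) full.srct_module_simps mem_Collect_eq)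
  next
    case (incl h)
    from \<open>h \<in> ?S\<close> consider i where "i \<in> {1..<m}" "h = pure_tensor A B (hecke_gen m i) \<one>\<^bsub>B\<^esub>"
      | i where "i \<in> {1..<n - m}" "h = pure_tensor A B \<one>\<^bsub>A\<^esub> (hecke_gen (n - m) i)"
      | c where "h = c \<odot>\<^bsub>TT.T\<^esub> \<one>\<^bsub>TT.T\<^esub>"
      unfolding tensor_gens_def by blast
    then show ?case
    proof cases
      case 1
      show ?thesis
        by (rule part_equivariant_single)
          (use incl tensor_gens_closed 1 \<iota>_left part_equivariant_left[OF 1(1)] in auto)
    next
      case 2
      show ?thesis
        by (rule part_equivariant_single)
          (use incl tensor_gens_closed 2 \<iota>_right part_equivariant_right[OF 2(1)] in auto)
    next
      case 3
      then show ?thesis using scalar[OF incl(2)] by simp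
    qed
  next
    case (a_inv h)
    have h: "h \<in> carrier TT.T" by (rule cl) fact
    \<comment> \<open>Rewriting the inverse as a product with the scalar \<open>- 1\<close> reduces
      this case to \<open>mult\<close> and \<open>scalar\<close>.\<close>
    have "\<ominus>\<^bsub>TT.T\<^esub> h = ((- 1) \<odot>\<^bsub>TT.T\<^esub> \<one>\<^bsub>TT.T\<^esub>) \<otimes>\<^bsub>TT.T\<^esub> h"
      using TT.T.minus_scale[OF h] TT.T.scale_eq_mult[OF h] by simp
    then show ?case
      using mult[OF TT.T.scale_closed[OF TT.T.one_closed] h scalar a_inv(2) a_inv(3), of "- 1"] by simp
  next
    case (eng_add a b)
    have ab: "a \<in> carrier TT.T" "b \<in> carrier TT.T" using eng_add cl by blast+
    have "\<iota> (a \<oplus>\<^bsub>TT.T\<^esub> b) \<odot>\<^bsub>srct_module \<alpha> []\<^esub> v = \<iota> a \<odot>\<^bsub>srct_module \<alpha> []\<^esub> v + \<iota> b \<odot>\<^bsub>srct_module \<alpha> []\<^esub> v"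
      unfolding \<iota>D(4)[OF ab] using FM.smult_l_distr[OF \<iota>D(2)[OF ab(1)] \<iota>D(2)[OF ab(2)], of v] eng_add(5) by simp
    then show ?case
      using eng_add full_closed[OF ab(1)] full_closed[OF ab(2)] W.smult_l_distr[OF ab part_closed[OF eng_add(5)]]
      by (simp only: part_add)
  next
    case (eng_mult a b)
    then show ?case using mult[of a b v] cl by blast
  qed
qed

end

end

text \<open>The isomorphism collects the maps \<open>part \<beta>\<close>. It is injective because
  the coefficient of each tableau is visible in the component of its own composition, and surjective
  because preimages for different components do not interfere.\<close>

lemma restriction_isomorphism:
  "\<exists>\<iota>. parabolic_identification n m \<iota> \<and>
    left_module_isomorphic (tensor_algebra A B) (restrict_scalars \<iota> (srct_module \<alpha> [])) (direct_sum_module I W)"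
proof -
  obtain \<iota> where pid: "parabolic_identification n m \<iota>" and \<iota>: "\<iota> \<in> algebra_hom TT.T (hecke n)"
    "\<And>i. i \<in> {1..<m} \<Longrightarrow> \<iota> (pure_tensor A B (hecke_gen m i) \<one>\<^bsub>B\<^esub>) = hecke_gen n i"
    "\<And>i. i \<in> {1..<n - m} \<Longrightarrow> \<iota> (pure_tensor A B \<one>\<^bsub>A\<^esub> (hecke_gen (n - m) i)) = hecke_gen n (i + m)"
    by (rule parabolic_identification_exists) (rule that)
  let ?M = "restrict_scalars \<iota> (srct_module \<alpha> [])" and ?D = "direct_sum_module I W"
  note ds = left_module_direct_sum[OF TT.T.ring_axioms left_module_W, of I]
  have D: "carrier ?D = (\<Pi>\<^sub>E \<beta>\<in>I. carrier (W \<beta>))"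
    using ds(2) finite_I by simp
  have M: "carrier ?M = {v. Poly_Mapping.keys v \<subseteq> SRCT \<alpha> []}" "add ?M = (+)"
    "a \<odot>\<^bsub>?M\<^esub> v = \<iota> a \<odot>\<^bsub>srct_module \<alpha> []\<^esub> v" for a v
    by (simp_all add: restrict_scalars_def)
  have lm: "left_module TT.T ?M"
    by (rule left_module_restrict_scalars[OF TT.T.ring_axioms full_module algebra_homD(1)[OF \<iota>(1)]])
  define \<Phi> where "\<Phi> v = (\<lambda>\<beta>\<in>I. part \<beta> v)" for v
  have hom: "\<Phi> \<in> hom (add_monoid ?M) (add_monoid ?D)"
    by (rule homI) (auto simp: M D ds(3) \<Phi>_def part_closed part_add intro!: restrict_ext)
  have inj: "inj_on \<Phi> (carrier ?M)"
  proof (rule inj_onI)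
    fix v w assume v: "v \<in> carrier ?M" and w: "w \<in> carrier ?M" and eq: "\<Phi> v = \<Phi> w"
    show "v = w"
    proof (rule poly_mapping_eqI)
      fix T
      show "Poly_Mapping.lookup v T = Poly_Mapping.lookup w T"
      proof (cases "T \<in> SRCT \<alpha> []")
        case True
        then obtain \<beta> where \<beta>: "\<beta> \<in> I" "T \<in> shaped \<beta>" by (rule shape_exists)
        have "part \<beta> v = part \<beta> w" using fun_cong[OF eq, of \<beta>] \<beta>(1) by (simp add: \<Phi>_def)
        then show ?thesis using v w by (intro part_coefficient[OF \<beta>]) (simp_all only: M mem_Collect_eq)
      next
        case False
        then have "T \<notin> Poly_Mapping.keys v" "T \<notin> Poly_Mapping.keys w" using v w by (auto simp: M)
        then show ?thesis by (simp add: in_keys_iff)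
      qed
    qed
  qed
  have surj: "\<Phi> ` carrier ?M = carrier ?D"
  proof
    show "\<Phi> ` carrier ?M \<subseteq> carrier ?D" using hom by (auto simp: hom_def)
    show "carrier ?D \<subseteq> \<Phi> ` carrier ?M"
    proof
      fix x assume x: "x \<in> carrier ?D"
      then have "\<forall>\<beta>\<in>I. \<exists>v. Poly_Mapping.keys v \<subseteq> shaped \<beta> \<and> part \<beta> v = x \<beta>"
        using part_surj by (auto simp: D)
      then obtain f where f: "\<And>\<beta>. \<beta> \<in> I \<Longrightarrow> Poly_Mapping.keys (f \<beta>) \<subseteq> shaped \<beta>" "\<And>\<beta>. \<beta> \<in> I \<Longrightarrow> part \<beta> (f \<beta>) = x \<beta>"
        by metis
      have fk: "Poly_Mapping.keys (f \<beta>) \<subseteq> SRCT \<alpha> []" if "\<beta> \<in> I" for \<beta>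
        using f(1)[OF that] shaped_SRCT[OF that] by blast
      \<comment> \<open>The preimages are added one composition at a time; \<open>f \<gamma>\<close>
        contributes to the component of \<open>\<gamma>\<close> only, by
        \<open>part_other_shape\<close>.\<close>
      have "Poly_Mapping.keys (sum f J) \<subseteq> SRCT \<alpha> [] \<and>
          (\<forall>\<beta>\<in>I. part \<beta> (sum f J) = (if \<beta> \<in> J then x \<beta> else \<zero>\<^bsub>W \<beta>\<^esub>))" if "finite J" "J \<subseteq> I" for J
        using that
      proof (induction J rule: finite_induct)
        case empty
        then show ?case by (simp add: part_zero)
      next
        case (insert \<gamma> J)
        then have \<gamma>: "\<gamma> \<in> I" and k: "Poly_Mapping.keys (sum f J) \<subseteq> SRCT \<alpha> []" by simp_all
        have "part \<beta> (f \<gamma> + sum f J) = (if \<beta> \<in> insert \<gamma> J then x \<beta> else \<zero>\<^bsub>W \<beta>\<^esub>)" if \<beta>: "\<beta> \<in> I" for \<beta>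
        proof -
          interpret W: left_module TT.T "W \<beta>" by (rule left_module_W[OF \<beta>])
          have xc: "x \<beta> \<in> carrier (W \<beta>)" using x \<beta> by (auto simp: D)
          show ?thesis
          proof (cases "\<beta> = \<gamma>")
            case True
            then show ?thesis
              using insert part_add[OF \<beta> fk[OF \<gamma>] k] f(2)[OF \<gamma>] \<beta> W.M.r_zero[OF xc] by simp
          next
            case False
            have "part \<beta> (f \<gamma>) = \<zero>\<^bsub>W \<beta>\<^esub>"
              using part_other_shape[OF \<beta> \<gamma> _ f(1)[OF \<gamma>]] False by blast
            then show ?thesis
              using insert part_add[OF \<beta> fk[OF \<gamma>] k] \<beta> False W.M.l_zero[OF xc] W.M.l_zero[OF W.M.zero_closed] by simp
          qed
        qed
        then show ?case using insert keys_add_subset[OF fk[OF \<gamma>] k] by simp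
      qed
      from this[OF finite_I subset_refl] have "sum f I \<in> carrier ?M" "\<And>\<beta>. \<beta> \<in> I \<Longrightarrow> part \<beta> (sum f I) = x \<beta>"
        by (simp_all add: M)
      moreover then have "\<Phi> (sum f I) = x"
        using x by (auto simp: \<Phi>_def D fun_eq_iff PiE_iff extensional_def)
      ultimately show "x \<in> \<Phi> ` carrier ?M" by blast
    qed
  qed
  have "\<Phi> (a \<odot>\<^bsub>?M\<^esub> v) = a \<odot>\<^bsub>?D\<^esub> \<Phi> v" if "a \<in> carrier TT.T" "v \<in> carrier ?M" for a v
  proof -
    have v: "Poly_Mapping.keys v \<subseteq> SRCT \<alpha> []" using that(2) by (simp only: M mem_Collect_eq)
    have "(\<lambda>\<beta>\<in>I. part \<beta> (\<iota> a \<odot>\<^bsub>srct_module \<alpha> []\<^esub> v)) = (\<lambda>\<beta>\<in>I. a \<odot>\<^bsub>W \<beta>\<^esub> (\<lambda>\<beta>\<in>I. part \<beta> v) \<beta>)"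
    proof (rule restrict_ext)
      fix \<beta> assume \<beta>: "\<beta> \<in> I"
      have "part \<beta> (\<iota> a \<odot>\<^bsub>srct_module \<alpha> []\<^esub> v) = a \<odot>\<^bsub>W \<beta>\<^esub> part \<beta> v"
        by (rule part_equivariant[OF \<beta> \<iota> that(1) v])
      then show "part \<beta> (\<iota> a \<odot>\<^bsub>srct_module \<alpha> []\<^esub> v) = a \<odot>\<^bsub>W \<beta>\<^esub> (\<lambda>\<beta>\<in>I. part \<beta> v) \<beta>"
        using \<beta> by simp
    qed
    then show ?thesis by (simp only: \<Phi>_def ds(4) M(3))
  qed
  then have "\<Phi> \<in> left_module_iso TT.T ?M ?D"
    using hom inj surj by (auto simp: left_module_iso_def iso_def bij_betw_def)
  then show ?thesis
    using pid lm ds(1) by (auto simp: left_module_isomorphic_def)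
qed

end

theorem theorem9p10:
  fixes \<alpha> :: "nat list" and m n :: nat
  assumes "is_composition \<alpha> n" and "m \<le> n"
  shows "\<exists>\<iota>. parabolic_identification n m \<iota> \<and>
    left_module_isomorphic
      (tensor_algebra (hecke m) (hecke (n - m)))
      (restrict_scalars \<iota> (srct_module \<alpha> []))
      (direct_sum_module {\<beta>. is_composition \<beta> (n - m) \<and> \<beta> \<le>\<^sub>c \<alpha>}
        (\<lambda>\<beta>. tensor_module (hecke m) (hecke (n - m)) (srct_module \<alpha> \<beta>) (srct_module \<beta> [])))"
proof -
  interpret restriction_rule n m \<alpha> by unfold_locales (use assms in auto)
  show ?thesis using restriction_isomorphism unfolding I_def .
qed

end
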